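(* Let $[\Gamma]$ be a real analytic projective structure on an open set $U\subset\mathbb{R}^2$ such that $\operatorname{rank}\mathcal M([\Gamma])<6$ on $U$, and suppose there exists $p\in U$ such that $\operatorname{rank}\mathcal M([\Gamma])=5$ and $W_1W_3-W_2^2\neq0$ at $p$, where $(W_1,W_2,\dots,W_6)$ spans the kernel of $\mathcal M([\Gamma])$. Then $[\Gamma]$ is metrisable in a sufficiently small neighbourhood of $p$ if the rank of the $10\times6$ matrix with the rows $$\big(\mathbf V,\ D_a\mathbf V,\ D_{(a}D_{b)}\mathbf V,\ D_{(a}D_bD_{c)}\mathbf V\big)$$ is equal to $5$. Moreover, this rank condition holds if and only if two relative invariants $E_1,E_2$ of order $6$ constructed from the projective structure (described in the context) vanish.
   Context: Coordinates on $U$ are $(x^1,x^2)=(x,y)$; $\partial_1=\partial_x$, $\partial_2=\partial_y$. A projective structure $[\Gamma]$ on $U$ is an equivalence class of torsion-free connections, where $\Gamma\sim\hat\Gamma$ iff they have the same unparametrised geodesics, i.e. $\hat\Gamma^c_{ab}=\Gamma^c_{ab}+\delta^c_a\omega_b+\delta^c_b\omega_a$ for some one-form $\omega$. $[\Gamma]$ is metrisable in a neighbourhood of $p\in U$ if on that neighbourhood there is a metric $g$ (symmetric, non-degenerate, of any signature) whose Levi-Civita connection belongs to $[\Gamma]$. The functions $$A_3=\Gamma^1_{22},\quad A_2=2\Gamma^1_{12}-\Gamma^2_{22},\quad A_1=\Gamma^1_{11}-2\Gamma^2_{12},\quad A_0=-\Gamma^2_{11}$$ depend only on $[\Gamma]$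 and determine it; $[\Gamma]$ is real analytic if they are. "Order" refers to the order of derivatives of the connection components. Liouville expressions: $L_1=\frac23\partial_x\partial_yA_1-\frac13\partial_x^2A_2-\partial_y^2A_0+A_0\partial_yA_2+A_2\partial_yA_0-A_3\partial_xA_0-2A_0\partial_xA_3-\frac23A_1\partial_yA_1+\frac13A_1\partial_xA_2$, $L_2=\frac23\partial_x\partial_yA_2-\frac13\partial_y^2A_1-\partial_x^2A_3-A_3\partial_xA_1-A_1\partial_xA_3+A_0\partial_yA_3+2A_3\partial_yA_0+\frac23A_2\partial_xA_2-\frac13A_2\partial_yA_1$. The row vector $\mathbf V=(V_1,\dots,V_6)$: $V_1=2\partial_yL_2+4A_2L_2+8A_3L_1$, $V_2=-2\partial_yL_1-2\partial_xL_2-\frac43A_1L_2+\frac43A_2L_1$, $V_3=2\partial_xL_1-8A_0L_2-4A_1L_1$, $V_4=-5L_2$, $V_5=-5L_1$, $V_6=0$. The $6\times6$ matrices $\mathbf\Omega_1,\mathbf\Omega_2$: $$\mathbf\Omega_1=\begin{pmatrix} -\frac23A_1&2A_0&0&0&0&0 \\ 0&0&0&-\frac12&0&0 \\ -2A_3&-\frac23A_2&\frac43A_1&0&1&0 \\ {a_{41}}&a_{42}&a_{43}&-\frac13A_1&-3A_0&0 \\ 0&0&0&0&0&-1 \\ {a_{61}}&a_{62}&a_{63}&a_{64}&a_{65}&-\frac13A_1 \end{pmatrix},\quad \mathbf\Omega_2=\begin{pmatrix} -\frac43A_2&\frac23A_1&2A_0&1&0&0 \\ 0&0&0&0&-\frac12&0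 \\ 0&-2A_3&\frac23A_2&0&0&0 \\ 0&0&0&0&0&-1 \\ {b_{51}}&b_{52}&b_{53}&3A_3&\frac13A_2&0 \\ {b_{61}}&b_{62}&b_{63}&b_{64}&b_{65}&\frac13A_2 \end{pmatrix}$$ with $a_{41}=-\frac43\partial_xA_2+4A_0A_3+\frac23\partial_yA_1$; $a_{42}=-2\partial_yA_0+\frac23\partial_xA_1+4A_2A_0-\frac49A_1^2$; $a_{43}=2\partial_xA_0-4A_0A_1$; $a_{61}=-\frac43\partial_x\partial_yA_2-\frac{20}3A_0A_2A_3+\frac23\partial_y^2A_1+4A_3\partial_yA_0-2A_0\partial_yA_3-\frac{16}9A_2\partial_xA_2+\frac89A_2\partial_yA_1$; $a_{62}=\frac23\partial_x\partial_yA_1-\frac43A_1\partial_yA_1+2A_0\partial_yA_2-2\partial_y^2A_0+4A_2\partial_yA_0+4A_3\partial_xA_0+6A_0\partial_xA_3+\frac89A_1\partial_xA_2+\frac43A_0A_1A_3-\frac43A_0A_2^2$; $a_{63}=2\partial_x\partial_yA_0+\frac23A_0\partial_xA_2-\frac43A_2\partial_xA_0-4A_1\partial_yA_0-\frac43A_0\partial_yA_1+\frac83A_0A_1A_2+4A_3A_0^2$; $a_{64}=\frac43\partial_xA_2-\partial_yA_1+5A_0A_3$; $a_{65}=\frac13\partial_xA_1-4\partial_yA_0+3A_2A_0-\frac29A_1^2$; $b_{51}=-2\partial_yA_3-4A_3A_2$; $b_{52}=2\partial_xA_3-\frac23\partial_yA_2+4A_1A_3-\frac49A_2^2$; $b_{53}=\frac43\partial_yA_1-\frac23\partial_xA_2+4A_0A_3$;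 $b_{61}=-2\partial_x\partial_yA_3-4A_2\partial_xA_3-\frac43A_3\partial_xA_2+\frac23A_3\partial_yA_1-\frac43A_1\partial_yA_3-4A_0A_3^2-\frac83A_1A_2A_3$; $b_{62}=2\partial_x^2A_3-\frac43A_2\partial_xA_2-\frac43A_0A_2A_3-\frac23\partial_x\partial_yA_2+4A_1\partial_xA_3+4A_0\partial_yA_3+6A_3\partial_yA_0+\frac43A_3A_1^2+2A_3\partial_xA_1+\frac89A_2\partial_yA_1$; $b_{63}=-\frac23\partial_x^2A_2+\frac89A_1\partial_xA_2+4A_0\partial_xA_3-2A_3\partial_xA_0-\frac{16}9A_1\partial_yA_1+\frac43\partial_x\partial_yA_1+\frac{20}3A_0A_1A_3$; $b_{64}=4\partial_xA_3-\frac13\partial_yA_2+3A_1A_3-\frac29A_2^2$; $b_{65}=\partial_xA_2-\frac43\partial_yA_1+5A_0A_3$. For a row-vector valued function $\mathbf W:U\to\mathbb{R}^6$ set $D_a\mathbf W=\partial_a\mathbf W-\mathbf W\,\mathbf\Omega_a$ ($a=1,2$), iterated: $D_aD_b\cdots D_d\mathbf V=\partial_a(D_b\cdots D_d\mathbf V)-(D_b\cdots D_d\mathbf V)\mathbf\Omega_a$. Round brackets around indices denote symmetrisation. $\mathcal M([\Gamma])$ is the $6\times6$ matrix with rows $\mathbf V,D_1\mathbf V,D_2\mathbf V,D_{(1}D_{1)}\mathbf V,D_{(1}D_{2)}\mathbf V,D_{(2}D_{2)}\mathbf V$; the $10\times 6$ matrix has in addition the four rows $D_{(a}D_bD_{c)}\mathbf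 V$. The kernel of $\mathcal M([\Gamma])$ consists of the column vectors it annihilates. The invariants $E_1,E_2$. Write $\mathbf V_x=D_1\mathbf V$, $\mathbf V_y=D_2\mathbf V$, $\mathbf V_{xx}=D_1D_1\mathbf V$, $\mathbf V_{xy}=D_{(1}D_{2)}\mathbf V$, $\mathbf V_{yy}=D_2D_2\mathbf V$, $\mathbf V_{xxx}=D_1D_1D_1\mathbf V$, $\mathbf V_{yyy}=D_2D_2D_2\mathbf V$. In the situation of the theorem $\mathbf V,\mathbf V_x,\mathbf V_y$ are linearly independent, and one picks two of $\mathbf V_{xx},\mathbf V_{xy},\mathbf V_{yy}$ so that the resulting five vectors are linearly independent. If $\mathbf V_{xx}$ and $\mathbf V_{yy}$ are picked, so that $\mathbf V_{xy}$ is in the span of $\mathbf V,\mathbf V_x,\mathbf V_y,\mathbf V_{xx},\mathbf V_{yy}$, then $E_1$ and $E_2$ are the determinants of the $6\times6$ matrices with rows $$E_1=\det(\mathbf V,\mathbf V_x,\mathbf V_y,\mathbf V_{xx},\mathbf V_{yy},\mathbf V_{xxx}),\qquad E_2=\det(\mathbf V,\mathbf V_x,\mathbf V_y,\mathbf V_{xx},\mathbf V_{yy},\mathbf V_{yyy}).$$ (The other two third-order vectors are disposed of by differentiating the linear relation for $\mathbf V_{xy}$ with respect to $x$ and $y$.) If instead $\mathbf V_{yy}$ is in the span of $\mathbf V,\mathbf V_x,\mathbf V_y,\mathbf V_{xx},\mathbf V_{xy}$, the same procedure is repeated with that relation.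
   Formalization: If V_xx and V_yy are picked, with V_xy = … + c4 V_xx + c5 V_yy, the equivalence with E1 = E2 = 0 is claimed only where c4·c5 ≠ 1; when c4·c5 = 1 the other two third-order vectors are not determined and the equivalence can fail, and another pick is then used. *)

theory Defs
  imports "HOL-Analysis.Analysis"
begin

definition partial :: "2 \<Rightarrow> (real^2 \<Rightarrow> 'a::real_normed_vector) \<Rightarrow> real^2 \<Rightarrow> 'a" where
  "partial a f q = vector_derivative (\<lambda>t. f (q + t *\<^sub>R axis a 1)) (at 0)"

abbreviation partial_x ("\<partial>\<^sub>x") where "\<partial>\<^sub>x \<equiv> partial 1"
abbreviation partial_y ("\<partial>\<^sub>y") where "\<partial>\<^sub>y \<equiv> partial 2"

primrec C_k_on :: "nat \<Rightarrow> (real^2) set \<Rightarrow> (real^2 \<Rightarrow> 'a::real_normed_vector) \<Rightarrow> bool" where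
  "C_k_on 0 U f \<longleftrightarrow> continuous_on U f"
| "C_k_on (Suc k) U f \<longleftrightarrow> f differentiable_on U \<and> (\<forall>a. C_k_on k U (partial a f))"

text \<open>Both notions below are only used on open sets.\<close>

definition smooth_on :: "(real^2) set \<Rightarrow> (real^2 \<Rightarrow> 'a::real_normed_vector) \<Rightarrow> bool" where
  "smooth_on U f \<longleftrightarrow> (\<forall>k. C_k_on k U f)"

definition real_analytic_on :: "(real^2) set \<Rightarrow> (real^2 \<Rightarrow> real) \<Rightarrow> bool" where
  "real_analytic_on U f \<longleftrightarrow>
     (\<forall>p\<in>U. \<exists>r>0. \<exists>c :: nat \<Rightarrow> nat \<Rightarrow> real. \<forall>q\<in>ball p r.
        ((\<lambda>(i, j). c i j * (q$1 - p$1) ^ i * (q$2 - p$2) ^ j) has_sum f q) UNIV)"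

text \<open>A connection is given by its components: \<open>\<Gamma> c a b\<close> is \<open>\<Gamma>\<^sup>c\<^bsub>ab\<^esub>\<close>.
  The index type \<^typ>\<open>2\<close> has the elements \<open>1\<close> (for \<open>x\<close>) and \<open>2\<close> (for \<open>y\<close>).\<close>

type_synonym connection = "2 \<Rightarrow> 2 \<Rightarrow> 2 \<Rightarrow> real^2 \<Rightarrow> real"

definition torsion_free_connection_on :: "(real^2) set \<Rightarrow> connection \<Rightarrow> bool" where
  "torsion_free_connection_on U \<Gamma> \<longleftrightarrow>
     (\<forall>c a b. smooth_on U (\<Gamma> c a b)) \<and> (\<forall>c a b. \<forall>q\<in>U. \<Gamma> c a b q = \<Gamma> c b a q)"

text \<open>The class \<open>[\<Gamma>]\<close> on \<open>U\<close>. The one-form \<open>\<omega>\<close> is automatically smooth on \<open>U\<close> when both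
  connections are.\<close>

definition projective_class :: "(real^2) set \<Rightarrow> connection \<Rightarrow> connection set" where
  "projective_class U \<Gamma> =
     {\<Gamma>'. torsion_free_connection_on U \<Gamma>' \<and>
          (\<exists>\<omega> :: 2 \<Rightarrow> real^2 \<Rightarrow> real. \<forall>c a b. \<forall>q\<in>U.
             \<Gamma>' c a b q = \<Gamma> c a b q + of_bool (c = a) * \<omega> b q + of_bool (c = b) * \<omega> a q)}"

definition metric_on :: "(real^2) set \<Rightarrow> (real^2 \<Rightarrow> real^2^2) \<Rightarrow> bool" where
  "metric_on U g \<longleftrightarrow> smooth_on U g \<and> (\<forall>q\<in>U. transpose (g q) = g q \<and> det (g q) \<noteq> 0)"

definition levi_civita :: "(real^2 \<Rightarrow> real^2^2) \<Rightarrow> connection" where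
  "levi_civita g c a b q =
     1/2 * (\<Sum>d\<in>UNIV. matrix_inv (g q) $ c $ d *
       (partial a (\<lambda>z. g z $ b $ d) q + partial b (\<lambda>z. g z $ a $ d) q
          - partial d (\<lambda>z. g z $ a $ b) q))"

definition metrisable_near :: "(real^2) set \<Rightarrow> connection \<Rightarrow> real^2 \<Rightarrow> bool" where
  "metrisable_near U \<Gamma> p \<longleftrightarrow>
     (\<exists>N g. open N \<and> p \<in> N \<and> N \<subseteq> U \<and> metric_on N g \<and> levi_civita g \<in> projective_class N \<Gamma>)"

context
  fixes \<Gamma> :: connection
begin

definition A0 :: "real^2 \<Rightarrow> real" where "A0 q = - \<Gamma> 2 1 1 q"
definition A1 :: "real^2 \<Rightarrow> real" where "A1 q = \<Gamma> 1 1 1 q - 2 * \<Gamma> 2 1 2 q"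
definition A2 :: "real^2 \<Rightarrow> real" where "A2 q = 2 * \<Gamma> 1 1 2 q - \<Gamma> 2 2 2 q"
definition A3 :: "real^2 \<Rightarrow> real" where "A3 q = \<Gamma> 1 2 2 q"

definition L1 :: "real^2 \<Rightarrow> real" where
  "L1 q = 2/3 * \<partial>\<^sub>x (\<partial>\<^sub>y A1) q - 1/3 * \<partial>\<^sub>x (\<partial>\<^sub>x A2) q
            - \<partial>\<^sub>y (\<partial>\<^sub>y A0) q + A0 q * \<partial>\<^sub>y A2 q
            + A2 q * \<partial>\<^sub>y A0 q - A3 q * \<partial>\<^sub>x A0 q - 2 * A0 q * \<partial>\<^sub>x A3 q
            - 2/3 * A1 q * \<partial>\<^sub>y A1 q + 1/3 * A1 q * \<partial>\<^sub>x A2 q"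

definition L2 :: "real^2 \<Rightarrow> real" where
  "L2 q = 2/3 * \<partial>\<^sub>x (\<partial>\<^sub>y A2) q - 1/3 * \<partial>\<^sub>y (\<partial>\<^sub>y A1) q
            - \<partial>\<^sub>x (\<partial>\<^sub>x A3) q - A3 q * \<partial>\<^sub>x A1 q
            - A1 q * \<partial>\<^sub>x A3 q + A0 q * \<partial>\<^sub>y A3 q + 2 * A3 q * \<partial>\<^sub>y A0 q
            + 2/3 * A2 q * \<partial>\<^sub>x A2 q - 1/3 * A2 q * \<partial>\<^sub>y A1 q"

definition V_row :: "real^2 \<Rightarrow> real^6" where
  "V_row q = vector
     [2 * \<partial>\<^sub>y L2 q + 4 * A2 q * L2 q + 8 * A3 q * L1 q,
      - 2 * \<partial>\<^sub>y L1 q - 2 * \<partial>\<^sub>x L2 q - 4/3 * A1 q * L2 q + 4/3 * A2 q * L1 q,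
      2 * \<partial>\<^sub>x L1 q - 8 * A0 q * L2 q - 4 * A1 q * L1 q,
      - 5 * L2 q,
      - 5 * L1 q,
      0]"

definition \<Omega>1 :: "real^2 \<Rightarrow> real^6^6" where
  "\<Omega>1 q =
     (let a41 = - 4/3 * \<partial>\<^sub>x A2 q + 4 * A0 q * A3 q + 2/3 * \<partial>\<^sub>y A1 q;
          a42 = - 2 * \<partial>\<^sub>y A0 q + 2/3 * \<partial>\<^sub>x A1 q + 4 * A2 q * A0 q - 4/9 * (A1 q)^2;
          a43 = 2 * \<partial>\<^sub>x A0 q - 4 * A0 q * A1 q;
          a61 = - 4/3 * \<partial>\<^sub>x (\<partial>\<^sub>y A2) q - 20/3 * A0 q * A2 q * A3 q
            + 2/3 * \<partial>\<^sub>y (\<partial>\<^sub>y A1) q + 4 * A3 q * \<partial>\<^sub>y A0 q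
            - 2 * A0 q * \<partial>\<^sub>y A3 q - 16/9 * A2 q * \<partial>\<^sub>x A2 q
            + 8/9 * A2 q * \<partial>\<^sub>y A1 q;
          a62 = 2/3 * \<partial>\<^sub>x (\<partial>\<^sub>y A1) q - 4/3 * A1 q * \<partial>\<^sub>y A1 q
            + 2 * A0 q * \<partial>\<^sub>y A2 q - 2 * \<partial>\<^sub>y (\<partial>\<^sub>y A0) q
            + 4 * A2 q * \<partial>\<^sub>y A0 q + 4 * A3 q * \<partial>\<^sub>x A0 q + 6 * A0 q * \<partial>\<^sub>x A3 q
            + 8/9 * A1 q * \<partial>\<^sub>x A2 q + 4/3 * A0 q * A1 q * A3 q - 4/3 * A0 q * (A2 q)^2;
          a63 = 2 * \<partial>\<^sub>x (\<partial>\<^sub>y A0) q + 2/3 * A0 q * \<partial>\<^sub>x A2 q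
            - 4/3 * A2 q * \<partial>\<^sub>x A0 q - 4 * A1 q * \<partial>\<^sub>y A0 q
            - 4/3 * A0 q * \<partial>\<^sub>y A1 q + 8/3 * A0 q * A1 q * A2 q + 4 * A3 q * (A0 q)^2;
          a64 = 4/3 * \<partial>\<^sub>x A2 q - \<partial>\<^sub>y A1 q + 5 * A0 q * A3 q;
          a65 = 1/3 * \<partial>\<^sub>x A1 q - 4 * \<partial>\<^sub>y A0 q + 3 * A2 q * A0 q - 2/9 * (A1 q)^2
      in vector
        [vector [- 2/3 * A1 q, 2 * A0 q, 0, 0, 0, 0],
         vector [0, 0, 0, - 1/2, 0, 0],
         vector [- 2 * A3 q, - 2/3 * A2 q, 4/3 * A1 q, 0, 1, 0],
         vector [a41, a42, a43, - 1/3 * A1 q, - 3 * A0 q, 0],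
         vector [0, 0, 0, 0, 0, - 1],
         vector [a61, a62, a63, a64, a65, - 1/3 * A1 q]])"

definition \<Omega>2 :: "real^2 \<Rightarrow> real^6^6" where
  "\<Omega>2 q =
     (let b51 = - 2 * \<partial>\<^sub>y A3 q - 4 * A3 q * A2 q;
          b52 = 2 * \<partial>\<^sub>x A3 q - 2/3 * \<partial>\<^sub>y A2 q + 4 * A1 q * A3 q - 4/9 * (A2 q)^2;
          b53 = 4/3 * \<partial>\<^sub>y A1 q - 2/3 * \<partial>\<^sub>x A2 q + 4 * A0 q * A3 q;
          b61 = - 2 * \<partial>\<^sub>x (\<partial>\<^sub>y A3) q - 4 * A2 q * \<partial>\<^sub>x A3 q
            - 4/3 * A3 q * \<partial>\<^sub>x A2 q + 2/3 * A3 q * \<partial>\<^sub>y A1 q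
            - 4/3 * A1 q * \<partial>\<^sub>y A3 q - 4 * A0 q * (A3 q)^2 - 8/3 * A1 q * A2 q * A3 q;
          b62 = 2 * \<partial>\<^sub>x (\<partial>\<^sub>x A3) q - 4/3 * A2 q * \<partial>\<^sub>x A2 q
            - 4/3 * A0 q * A2 q * A3 q - 2/3 * \<partial>\<^sub>x (\<partial>\<^sub>y A2) q
            + 4 * A1 q * \<partial>\<^sub>x A3 q + 4 * A0 q * \<partial>\<^sub>y A3 q + 6 * A3 q * \<partial>\<^sub>y A0 q
            + 4/3 * A3 q * (A1 q)^2 + 2 * A3 q * \<partial>\<^sub>x A1 q + 8/9 * A2 q * \<partial>\<^sub>y A1 q;
          b63 = - 2/3 * \<partial>\<^sub>x (\<partial>\<^sub>x A2) q + 8/9 * A1 q * \<partial>\<^sub>x A2 q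
            + 4 * A0 q * \<partial>\<^sub>x A3 q - 2 * A3 q * \<partial>\<^sub>x A0 q
            - 16/9 * A1 q * \<partial>\<^sub>y A1 q + 4/3 * \<partial>\<^sub>x (\<partial>\<^sub>y A1) q
            + 20/3 * A0 q * A1 q * A3 q;
          b64 = 4 * \<partial>\<^sub>x A3 q - 1/3 * \<partial>\<^sub>y A2 q + 3 * A1 q * A3 q - 2/9 * (A2 q)^2;
          b65 = \<partial>\<^sub>x A2 q - 4/3 * \<partial>\<^sub>y A1 q + 5 * A0 q * A3 q
      in vector
        [vector [- 4/3 * A2 q, 2/3 * A1 q, 2 * A0 q, 1, 0, 0],
         vector [0, 0, 0, 0, - 1/2, 0],
         vector [0, - 2 * A3 q, 2/3 * A2 q, 0, 0, 0],
         vector [0, 0, 0, 0, 0, - 1],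
         vector [b51, b52, b53, 3 * A3 q, 1/3 * A2 q, 0],
         vector [b61, b62, b63, b64, b65, 1/3 * A2 q]])"

definition D :: "2 \<Rightarrow> (real^2 \<Rightarrow> real^6) \<Rightarrow> real^2 \<Rightarrow> real^6" where
  "D a W q = partial a W q - W q v* (if a = 1 then \<Omega>1 q else \<Omega>2 q)"

definition DD_sym :: "2 \<Rightarrow> 2 \<Rightarrow> real^2 \<Rightarrow> real^6" where
  "DD_sym a b q = (1/2) *\<^sub>R (D a (D b V_row) q + D b (D a V_row) q)"

definition DDD_sym :: "2 \<Rightarrow> 2 \<Rightarrow> 2 \<Rightarrow> real^2 \<Rightarrow> real^6" where
  "DDD_sym a b c q = (1/6) *\<^sub>R
     (D a (D b (D c V_row)) q + D a (D c (D b V_row)) q + D b (D a (D c V_row)) q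
    + D b (D c (D a V_row)) q + D c (D a (D b V_row)) q + D c (D b (D a V_row)) q)"

definition M_mat :: "real^2 \<Rightarrow> real^6^6" where
  "M_mat q = vector
     [V_row q, D 1 V_row q, D 2 V_row q, DD_sym 1 1 q, DD_sym 1 2 q, DD_sym 2 2 q]"

definition M_mat10 :: "real^2 \<Rightarrow> real^6^10" where
  "M_mat10 q = vector
     [V_row q, D 1 V_row q, D 2 V_row q, DD_sym 1 1 q, DD_sym 1 2 q, DD_sym 2 2 q,
      DDD_sym 1 1 1 q, DDD_sym 1 1 2 q, DDD_sym 1 2 2 q, DDD_sym 2 2 2 q]"

end

datatype second_order_choice = XX_YY | XX_XY | XY_YY

context
  fixes \<Gamma> :: connection
begin

fun chosen_rows :: "second_order_choice \<Rightarrow> real^2 \<Rightarrow> (real^6) list" where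
  "chosen_rows XX_YY q =
     [V_row \<Gamma> q, D \<Gamma> 1 (V_row \<Gamma>) q, D \<Gamma> 2 (V_row \<Gamma>) q, DD_sym \<Gamma> 1 1 q, DD_sym \<Gamma> 2 2 q]"
| "chosen_rows XX_XY q =
     [V_row \<Gamma> q, D \<Gamma> 1 (V_row \<Gamma>) q, D \<Gamma> 2 (V_row \<Gamma>) q, DD_sym \<Gamma> 1 1 q, DD_sym \<Gamma> 1 2 q]"
| "chosen_rows XY_YY q =
     [V_row \<Gamma> q, D \<Gamma> 1 (V_row \<Gamma>) q, D \<Gamma> 2 (V_row \<Gamma>) q, DD_sym \<Gamma> 1 2 q, DD_sym \<Gamma> 2 2 q]"

text \<open>A choice is admissible at \<open>q\<close> if the five vectors are linearly independent there, the
  remaining second-order vector is in their span, and the first derivatives of that linear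
  relation determine the two third-order vectors not used in \<open>E1\<close> and \<open>E2\<close>.
  For \<open>V\<^bsub>xy\<^esub> = c1 V + c2 V\<^bsub>x\<^esub> + c3 V\<^bsub>y\<^esub> + c4 V\<^bsub>xx\<^esub> + c5 V\<^bsub>yy\<^esub>\<close> the derivatives read
  \<open>V\<^bsub>xxy\<^esub> - c5 V\<^bsub>xyy\<^esub> = c4 V\<^bsub>xxx\<^esub>\<close> and \<open>V\<^bsub>xyy\<^esub> - c4 V\<^bsub>xxy\<^esub> = c5 V\<^bsub>yyy\<^esub>\<close> modulo the five vectors,
  which can be solved for \<open>V\<^bsub>xxy\<^esub>\<close> and \<open>V\<^bsub>xyy\<^esub>\<close> iff \<open>c4 * c5 \<noteq> 1\<close>.
  The relations for \<open>V\<^bsub>yy\<^esub>\<close> and for \<open>V\<^bsub>xx\<^esub>\<close> can always be solved.\<close>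

fun admissible :: "second_order_choice \<Rightarrow> real^2 \<Rightarrow> bool" where
  "admissible XX_YY q \<longleftrightarrow>
     distinct (chosen_rows XX_YY q) \<and> independent (set (chosen_rows XX_YY q)) \<and>
     (\<exists>c1 c2 c3 c4 c5 :: real.
        DD_sym \<Gamma> 1 2 q = c1 *\<^sub>R V_row \<Gamma> q + c2 *\<^sub>R D \<Gamma> 1 (V_row \<Gamma>) q + c3 *\<^sub>R D \<Gamma> 2 (V_row \<Gamma>) q
          + c4 *\<^sub>R DD_sym \<Gamma> 1 1 q + c5 *\<^sub>R DD_sym \<Gamma> 2 2 q \<and> c4 * c5 \<noteq> 1)"
| "admissible XX_XY q \<longleftrightarrow>
     distinct (chosen_rows XX_XY q) \<and> independent (set (chosen_rows XX_XY q)) \<and>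
     DD_sym \<Gamma> 2 2 q \<in> span (set (chosen_rows XX_XY q))"
| "admissible XY_YY q \<longleftrightarrow>
     distinct (chosen_rows XY_YY q) \<and> independent (set (chosen_rows XY_YY q)) \<and>
     DD_sym \<Gamma> 1 1 q \<in> span (set (chosen_rows XY_YY q))"

fun E1 :: "second_order_choice \<Rightarrow> real^2 \<Rightarrow> real" where
  "E1 XX_YY q = det (vector (chosen_rows XX_YY q @ [DDD_sym \<Gamma> 1 1 1 q]) :: real^6^6)"
| "E1 XX_XY q = det (vector (chosen_rows XX_XY q @ [DDD_sym \<Gamma> 1 1 1 q]) :: real^6^6)"
| "E1 XY_YY q = det (vector (chosen_rows XY_YY q @ [DDD_sym \<Gamma> 1 2 2 q]) :: real^6^6)"

fun E2 :: "second_order_choice \<Rightarrow> real^2 \<Rightarrow> real" where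
  "E2 XX_YY q = det (vector (chosen_rows XX_YY q @ [DDD_sym \<Gamma> 2 2 2 q]) :: real^6^6)"
| "E2 XX_XY q = det (vector (chosen_rows XX_XY q @ [DDD_sym \<Gamma> 1 1 2 q]) :: real^6^6)"
| "E2 XY_YY q = det (vector (chosen_rows XY_YY q @ [DDD_sym \<Gamma> 2 2 2 q]) :: real^6^6)"

end

end

theory Submission
  imports Defs
begin

text \<open>The operators \<open>D\<^sub>a\<close> are dual to the connection \<open>\<nabla>\<^sub>a \<psi> = \<partial>\<^sub>a \<psi> + \<Omega>\<^sub>a \<psi>\<close> on column
  vectors, which prolongs Liouville's linear system: a parallel \<open>\<psi>\<close> with
  \<open>\<psi>\<^sub>1 \<psi>\<^sub>3 - \<psi>\<^sub>2\<^sup>2 \<noteq> 0\<close> is the same thing as a compatible metric. The curvature of this connection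
  has \<open>V\<close> as its last row and vanishes otherwise. Near \<open>p\<close> the kernel of \<open>M\<close> is spanned by a smooth
  section \<open>W\<close>, a column of the adjugate of \<open>M\<close>. Pairing the rows with \<open>W\<close> and differentiating shows
  that \<open>\<nabla>\<^sub>a W\<close> is annihilated by \<open>V\<close> and \<open>D\<^sub>b V\<close>, and that its product with \<open>D\<^sub>b D\<^sub>c V\<close> is
  minus that of \<open>D\<^sub>a D\<^sub>b D\<^sub>c V\<close> with \<open>W\<close>. Hence the rank of the big matrix stays \<open>5\<close> iff
  \<open>\<nabla>\<^sub>a W = \<lambda>\<^sub>a W\<close>; then \<open>\<lambda>\<close> is closed by the curvature formula, and rescaling \<open>W\<close> by the
  exponential of a potential makes it parallel. The linear relation among the second-order rows
  expresses all products of third-order rows with \<open>W\<close> through the two that enter \<open>E\<^sub>1\<close> and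
  \<open>E\<^sub>2\<close>. The points where \<open>V, D\<^sub>1 V, D\<^sub>2 V\<close> are independent are dense near \<open>p\<close>, because a
  first-order relation on an open set would propagate and bound the rank of \<open>M\<close> by \<open>3\<close>.\<close>

section \<open>Partial derivatives and smooth functions\<close>

lemma has_derivative_partial:
  assumes "(f has_derivative F) (at q)"
  shows "partial a f q = F (axis a 1)"
proof -
  have F: "bounded_linear F" using assms by (rule has_derivative_bounded_linear)
  have "((\<lambda>t. q + t *\<^sub>R axis a (1::real)) has_derivative (\<lambda>t. t *\<^sub>R axis a 1)) (at 0)"
    by (auto intro!: derivative_eq_intros)
  from has_derivative_compose[OF this] assms
  have "((\<lambda>t. f (q + t *\<^sub>R axis a 1)) has_derivative (\<lambda>t. F (t *\<^sub>R axis a 1))) (at 0)" by simp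
  then have "((\<lambda>t. f (q + t *\<^sub>R axis a 1)) has_vector_derivative F (axis a 1)) (at 0)"
    by (simp add: has_vector_derivative_def linear_cmul bounded_linear.linear[OF F])
  then show ?thesis
    unfolding partial_def by (rule vector_derivative_at)
qed

lemma has_derivative_partials:
  assumes "f differentiable (at q)"
  shows "(f has_derivative (\<lambda>v. \<Sum>a\<in>UNIV. v $ a *\<^sub>R partial a f q)) (at q)"
proof -
  obtain F where F: "(f has_derivative F) (at q)" using assms by (auto simp: differentiable_def)
  have "F v = (\<Sum>a\<in>UNIV. v $ a *\<^sub>R partial a f q)" for v
  proof -
    have "F v = F (\<Sum>a\<in>UNIV. v $ a *\<^sub>R axis a 1)"
      by (simp add: basis_expansion flip: scalar_mult_eq_scaleR)
    also have "\<dots> = (\<Sum>a\<in>UNIV. v $ a *\<^sub>R F (axis a 1))"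
      using has_derivative_linear[OF F] by (simp add: linear_sum linear_cmul)
    finally show ?thesis using has_derivative_partial[OF F] by simp
  qed
  then show ?thesis using F by (metis (no_types, lifting) ext)
qed

lemma sum_axis_partial: "(\<Sum>b\<in>UNIV. axis a 1 $ b *\<^sub>R partial b f q) = partial a f q"
  by (simp add: axis_def if_distrib[of "\<lambda>x. x *\<^sub>R _"] cong: if_cong)

text \<open>A partial derivative depends only on the germ of the function, so identities that hold
  on an open set can be differentiated there.\<close>

lemma partial_cong:
  assumes "open U" "q \<in> U" "\<And>z. z \<in> U \<Longrightarrow> f z = g z"
  shows "partial a f q = partial a g q"
proof -
  have "((\<lambda>t. q + t *\<^sub>R axis a (1::real)) \<longlongrightarrow> q + 0 *\<^sub>R axis a 1) (nhds 0)"
    by (intro tendsto_intros filterlim_ident)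
  then have "\<forall>\<^sub>F t in nhds 0. q + t *\<^sub>R axis a (1::real) \<in> U"
    using assms(1,2) by (auto dest: topological_tendstoD)
  then have "\<forall>\<^sub>F t in nhds 0. t \<in> UNIV \<longrightarrow> f (q + t *\<^sub>R axis a 1) = g (q + t *\<^sub>R axis a 1)"
    by eventually_elim (simp add: assms(3))
  then show ?thesis
    unfolding partial_def by (intro vector_derivative_cong_eq) auto
qed

text \<open>\<open>partial\<close> produces total functions, while the sum, chain and product rules
  identify them only on \<open>U\<close>. This congruence lets such formulas be substituted at every
  level of the recursion behind \<open>C_k_on\<close>.\<close>

lemma C_k_on_cong:
  assumes "open U" "\<And>z. z \<in> U \<Longrightarrow> f z = g z"
  shows "C_k_on k U f \<longleftrightarrow> C_k_on k U g"
  using assms(2)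
proof (induction k arbitrary: f g)
  case 0
  then show ?case by (auto intro!: continuous_on_cong)
next
  case (Suc k)
  have "h' differentiable_on U" if "h differentiable_on U" "\<And>z. z \<in> U \<Longrightarrow> h' z = h z" for h h' :: "real^2 \<Rightarrow> 'a"
    using that unfolding differentiable_on_def differentiable_def by (meson has_derivative_transform)
  then have "f differentiable_on U \<longleftrightarrow> g differentiable_on U"
    using Suc.prems by metis
  moreover have "C_k_on k U (partial a f) \<longleftrightarrow> C_k_on k U (partial a g)" for a
    by (rule Suc.IH) (rule partial_cong[OF assms(1) _ Suc.prems])
  ultimately show ?case by simp
qed

lemma C_k_on_Suc_imp: "C_k_on (Suc k) U f \<Longrightarrow> C_k_on k U f"
proof (induction k arbitrary: f)
  case 0
  then show ?case by (simp add: differentiable_imp_continuous_on)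
qed auto

lemma differentiable_onD:
  assumes "open U" "f differentiable_on U" "q \<in> U"
  shows "f differentiable (at q)"
  using assms by (simp add: differentiable_on_eq_differentiable_at)

lemma C_k_on_subset:
  assumes "C_k_on k U f" "V \<subseteq> U"
  shows "C_k_on k V f"
  using assms by (induction k arbitrary: f) (auto intro: continuous_on_subset differentiable_on_subset)

lemma C_k_on_bounded_linear:
  assumes "open U" "bounded_linear h" "C_k_on k U f"
  shows "C_k_on k U (\<lambda>q. h (f q))"
  using assms(3)
proof (induction k arbitrary: f)
  case 0
  then show ?case
    using bounded_linear.continuous_on[OF assms(2)] by simp
next
  case (Suc k)
  have f: "f differentiable (at q)" if "q \<in> U" for q
    using Suc.prems differentiable_onD[OF assms(1) _ that] by auto
  have d: "((\<lambda>q. h (f q)) has_derivative (\<lambda>v. h (\<Sum>b\<in>UNIV. v $ b *\<^sub>R partial b f q))) (at q)" if "q \<in> U" for q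
    by (rule bounded_linear.has_derivative[OF assms(2) has_derivative_partials[OF f[OF that]]])
  have "partial a (\<lambda>q. h (f q)) q = h (partial a f q)" if "q \<in> U" for a q
    unfolding has_derivative_partial[OF d[OF that]] sum_axis_partial ..
  then have "C_k_on k U (partial a (\<lambda>q. h (f q)))" for a
    using C_k_on_cong[OF assms(1), of "partial a (\<lambda>q. h (f q))" "\<lambda>q. h (partial a f q)"] Suc by auto
  moreover have "(\<lambda>q. h (f q)) differentiable_on U"
    using d assms(1) by (auto simp: differentiable_on_eq_differentiable_at differentiable_def)
  ultimately show ?case by simp
qed

lemma C_k_on_const: "C_k_on k U (\<lambda>q. c)"
proof (induction k arbitrary: c)
  case (Suc k)
  have "partial a (\<lambda>q. c) = (\<lambda>q. 0)" for a
    by (rule ext, subst has_derivative_partial[OF has_derivative_const]) simp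
  then show ?case using Suc by simp
qed simp

lemma C_k_on_add:
  assumes "open U" "C_k_on k U f" "C_k_on k U g"
  shows "C_k_on k U (\<lambda>q. f q + g q)"
  using assms(2,3)
proof (induction k arbitrary: f g)
  case 0
  then show ?case by (auto intro: continuous_intros)
next
  case (Suc k)
  have f: "f differentiable (at q)" and g: "g differentiable (at q)" if "q \<in> U" for q
    using Suc.prems differentiable_onD[OF assms(1) _ that] by auto
  have "partial a (\<lambda>q. f q + g q) q = partial a f q + partial a g q" if "q \<in> U" for a q
    unfolding has_derivative_partial[OF has_derivative_add[OF has_derivative_partials[OF f[OF that]] has_derivative_partials[OF g[OF that]]]]
      sum_axis_partial ..
  then have "C_k_on k U (partial a (\<lambda>q. f q + g q))" for a
    using C_k_on_cong[OF assms(1), of "partial a (\<lambda>q. f q + g q)" "\<lambda>q. partial a f q + partial a g q"] Suc by auto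
  moreover have "(\<lambda>q. f q + g q) differentiable_on U"
    using f g assms(1) by (auto simp: differentiable_on_eq_differentiable_at)
  ultimately show ?case by simp
qed

lemma partial_bilinear_at:
  assumes "bounded_bilinear h" "f differentiable (at q)" "g differentiable (at q)"
  shows "(\<lambda>z. h (f z) (g z)) differentiable (at q)"
    and "partial a (\<lambda>z. h (f z) (g z)) q = h (partial a f q) (g q) + h (f q) (partial a g q)"
proof -
  have *: "((\<lambda>z. h (f z) (g z)) has_derivative
      (\<lambda>v. h (f q) (\<Sum>b\<in>UNIV. v $ b *\<^sub>R partial b g q) + h (\<Sum>b\<in>UNIV. v $ b *\<^sub>R partial b f q) (g q))) (at q)"
    by (intro bounded_bilinear.FDERIV[OF assms(1)] has_derivative_partials assms)
  then show "(\<lambda>z. h (f z) (g z)) differentiable (at q)" by (auto simp: differentiable_def)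
  show "partial a (\<lambda>z. h (f z) (g z)) q = h (partial a f q) (g q) + h (f q) (partial a g q)"
    unfolding has_derivative_partial[OF *] sum_axis_partial by (rule add.commute)
qed

lemma C_k_on_bilinear:
  assumes "bounded_bilinear h" "open U" "C_k_on k U f" "C_k_on k U g"
  shows "C_k_on k U (\<lambda>q. h (f q) (g q))"
  using assms(3,4)
proof (induction k arbitrary: f g)
  case 0
  then show ?case using bounded_bilinear.continuous_on[OF assms(1)] by auto
next
  case (Suc k)
  have f: "f differentiable (at q)" and g: "g differentiable (at q)" if "q \<in> U" for q
    using Suc.prems differentiable_onD[OF assms(2) _ that] by auto
  \<comment> \<open>Each term of the product rule keeps one undifferentiated factor, whose order has
    to be lowered by one before the induction hypothesis applies.\<close>
  have "C_k_on k U (\<lambda>q. h (partial a f q) (g q) + h (f q) (partial a g q))" for a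
    using Suc C_k_on_Suc_imp[OF Suc.prems(1)] C_k_on_Suc_imp[OF Suc.prems(2)] by (intro C_k_on_add assms(2)) auto
  then have "C_k_on k U (partial a (\<lambda>q. h (f q) (g q)))" for a
    using C_k_on_cong[OF assms(2), of "partial a (\<lambda>q. h (f q) (g q))" "\<lambda>q. h (partial a f q) (g q) + h (f q) (partial a g q)"]
       partial_bilinear_at(2)[OF assms(1) f g] by simp
  moreover have "(\<lambda>q. h (f q) (g q)) differentiable_on U"
    using f g assms(2) partial_bilinear_at(1)[OF assms(1)] by (auto simp: differentiable_on_eq_differentiable_at)
  ultimately show ?case by simp
qed

text \<open>Both reciprocals and exponentials satisfy an equation \<open>\<partial> f = u f + v f\<^sup>2\<close>
  with smooth \<open>u\<close> and \<open>v\<close>, which bootstraps the regularity of \<open>f\<close>.\<close>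

lemma C_k_on_riccati:
  fixes f :: "real^2 \<Rightarrow> real"
  assumes "open U" "f differentiable_on U"
    and "\<And>a q. q \<in> U \<Longrightarrow> partial a f q = u a q * f q + v a q * (f q * f q)"
    and uv: "\<And>a k. C_k_on k U (u a)" "\<And>a k. C_k_on k U (v a)"
  shows "C_k_on k U f"
proof (induction k)
  case 0
  then show ?case using assms(2) by (simp add: differentiable_imp_continuous_on)
next
  case (Suc k)
  note prod = C_k_on_bilinear[OF bounded_bilinear_mult assms(1)]
  have "C_k_on k U (\<lambda>q. u a q * f q + v a q * (f q * f q))" for a
    by (intro C_k_on_add assms(1) prod Suc uv)
  then have "C_k_on k U (partial a f)" for a
    using C_k_on_cong[OF assms(1), of "partial a f" "\<lambda>q. u a q * f q + v a q * (f q * f q)"] assms(3) by simp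
  then show ?case using assms(2) by simp
qed

section \<open>Closure properties and differentiation rules for smooth functions\<close>

named_theorems smooth

lemma smooth_on_partial [smooth]: "smooth_on U f \<Longrightarrow> smooth_on U (partial a f)"
  unfolding smooth_on_def by (metis C_k_on.simps(2))

lemma smooth_on_differentiable:
  assumes "open U" "smooth_on U f" "q \<in> U"
  shows "f differentiable (at q)"
  using assms differentiable_onD C_k_on.simps(2) unfolding smooth_on_def by metis

lemma smooth_on_imp_continuous_on: "smooth_on U f \<Longrightarrow> continuous_on U f"
  unfolding smooth_on_def by (metis C_k_on.simps(1))

lemma smooth_on_subset: "smooth_on U f \<Longrightarrow> V \<subseteq> U \<Longrightarrow> smooth_on V f"
  unfolding smooth_on_def by (blast intro: C_k_on_subset)

lemma smooth_on_cong:
  assumes "open U" "\<And>z. z \<in> U \<Longrightarrow> f z = g z"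
  shows "smooth_on U f \<longleftrightarrow> smooth_on U g"
  unfolding smooth_on_def using C_k_on_cong[OF assms] by simp

lemma smooth_onI:
  assumes "f differentiable_on U" "\<And>a. smooth_on U (partial a f)"
  shows "smooth_on U f"
  unfolding smooth_on_def
proof
  fix k show "C_k_on k U f"
    using assms by (cases k) (auto simp: smooth_on_def differentiable_imp_continuous_on)
qed

lemma smooth_on_const [smooth]: "smooth_on U (\<lambda>q. c)"
  by (simp add: smooth_on_def C_k_on_const)

lemma smooth_on_add [smooth]: "open U \<Longrightarrow> smooth_on U f \<Longrightarrow> smooth_on U g \<Longrightarrow> smooth_on U (\<lambda>q. f q + g q)"
  by (simp add: smooth_on_def C_k_on_add)

lemma smooth_on_bounded_linear:
  "bounded_linear h \<Longrightarrow> open U \<Longrightarrow> smooth_on U f \<Longrightarrow> smooth_on U (\<lambda>q. h (f q))"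
  by (simp add: smooth_on_def C_k_on_bounded_linear)

lemma smooth_on_bilinear:
  "bounded_bilinear h \<Longrightarrow> open U \<Longrightarrow> smooth_on U f \<Longrightarrow> smooth_on U g \<Longrightarrow> smooth_on U (\<lambda>q. h (f q) (g q))"
  by (simp add: smooth_on_def C_k_on_bilinear)

lemmas smooth_on_mult [smooth] = smooth_on_bilinear[OF bounded_bilinear_mult]
lemmas smooth_on_scaleR [smooth] = smooth_on_bilinear[OF bounded_bilinear_scaleR]
lemmas smooth_on_inner [smooth] = smooth_on_bilinear[OF bounded_bilinear_inner]
lemmas smooth_on_minus [smooth] = smooth_on_bounded_linear[OF bounded_linear_minus[OF bounded_linear_ident]]
lemmas smooth_on_nth [smooth] = smooth_on_bounded_linear[OF bounded_linear_vec_nth]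

lemma smooth_on_diff [smooth]:
  "open U \<Longrightarrow> smooth_on U f \<Longrightarrow> smooth_on U g \<Longrightarrow> smooth_on U (\<lambda>q. f q - g q)"
  using smooth_on_add[of U f "\<lambda>q. - g q"] smooth_on_minus[of U g] by simp

lemma smooth_on_power [smooth]:
  fixes f :: "real^2 \<Rightarrow> real"
  shows "open U \<Longrightarrow> smooth_on U f \<Longrightarrow> smooth_on U (\<lambda>q. f q ^ n)"
  by (induction n) (auto intro!: smooth)

lemma smooth_on_sum [smooth]:
  "open U \<Longrightarrow> (\<And>i. i \<in> I \<Longrightarrow> smooth_on U (f i)) \<Longrightarrow> smooth_on U (\<lambda>q. \<Sum>i\<in>I. f i q)"
  by (induction I rule: infinite_finite_induct) (auto intro!: smooth)

lemma smooth_on_prod [smooth]: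
  fixes f :: "'i \<Rightarrow> real^2 \<Rightarrow> real"
  shows "open U \<Longrightarrow> (\<And>i. i \<in> I \<Longrightarrow> smooth_on U (f i)) \<Longrightarrow> smooth_on U (\<lambda>q. \<Prod>i\<in>I. f i q)"
  by (induction I rule: infinite_finite_induct) (auto intro!: smooth)

text \<open>A vector function is the sum of its components placed on the axes, that is, a finite sum
  of bounded linear images. For matrices the rule is applied twice.\<close>

lemma smooth_on_componentwise:
  fixes f :: "real^2 \<Rightarrow> 'a::euclidean_space^'n"
  assumes "open U" "\<And>i. smooth_on U (\<lambda>q. f q $ i)"
  shows "smooth_on U f"
proof -
  have *: "bounded_linear (axis i :: 'a \<Rightarrow> 'a^'n)" for i
    by (rule linear_conv_bounded_linear[THEN iffD1]) (auto intro!: linearI simp: vec_eq_iff axis_def)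
  have "f = (\<lambda>q. \<Sum>i\<in>UNIV. axis i (f q $ i))"
    by (auto simp: vec_eq_iff axis_def if_distrib cong: if_cong)
  moreover have "smooth_on U (\<lambda>q. \<Sum>i\<in>UNIV. axis i (f q $ i))"
    by (intro smooth assms(1) smooth_on_bounded_linear[OF *] assms(2))
  ultimately show ?thesis by metis
qed

text \<open>The reciprocal fits \<open>C_k_on_riccati\<close> with \<open>u = 0\<close> and
  \<open>v = - partial a f\<close>.\<close>

lemma smooth_on_inverse [smooth]:
  fixes f :: "real^2 \<Rightarrow> real"
  assumes "open U" "smooth_on U f" "\<And>q. q \<in> U \<Longrightarrow> f q \<noteq> 0"
  shows "smooth_on U (\<lambda>q. inverse (f q))"
  unfolding smooth_on_def
proof
  fix k
  have d: "((\<lambda>q. inverse (f q)) has_derivative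
      (\<lambda>v. - (inverse (f q) * (\<Sum>b\<in>UNIV. v $ b *\<^sub>R partial b f q) * inverse (f q)))) (at q)" if "q \<in> U" for q
    by (intro Deriv.has_derivative_inverse assms(3) has_derivative_partials smooth_on_differentiable[OF assms(1,2)] that)
  have p: "partial a (\<lambda>q. inverse (f q)) q = 0 * inverse (f q) + - partial a f q * (inverse (f q) * inverse (f q))"
    if "q \<in> U" for a q
    unfolding has_derivative_partial[OF d[OF that]] sum_axis_partial by simp
  have "(\<lambda>q. inverse (f q)) differentiable_on U"
    using d assms(1) by (auto simp: differentiable_on_eq_differentiable_at differentiable_def)
  then show "C_k_on k U (\<lambda>q. inverse (f q))"
    using C_k_on_riccati[OF assms(1) _ p] smooth_on_minus[OF assms(1) smooth_on_partial[OF assms(2)]]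
      C_k_on_const[of _ U "0::real"] unfolding smooth_on_def by blast
qed

text \<open>The exponential fits \<open>C_k_on_riccati\<close> with \<open>u = partial a f\<close>
  and quadratic coefficient zero.\<close>

lemma smooth_on_exp [smooth]:
  fixes f :: "real^2 \<Rightarrow> real"
  assumes "open U" "smooth_on U f"
  shows "smooth_on U (\<lambda>q. exp (f q))"
    and "q \<in> U \<Longrightarrow> partial a (\<lambda>q. exp (f q)) q = partial a f q * exp (f q)"
proof -
  have d: "((\<lambda>q. exp (f q)) has_derivative
      (\<lambda>v. (\<Sum>b\<in>UNIV. v $ b *\<^sub>R partial b f q) * exp (f q))) (at q)" if "q \<in> U" for q
    using has_derivative_partials[OF smooth_on_differentiable[OF assms that]] by (rule has_derivative_exp)
  have p: "partial a (\<lambda>q. exp (f q)) q = partial a f q * exp (f q) + 0 * (exp (f q) * exp (f q))"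
    if "q \<in> U" for a q
    unfolding has_derivative_partial[OF d[OF that]] sum_axis_partial by simp
  have "(\<lambda>q. exp (f q)) differentiable_on U"
    using d assms(1) by (auto simp: differentiable_on_eq_differentiable_at differentiable_def)
  then show "smooth_on U (\<lambda>q. exp (f q))"
    using C_k_on_riccati[OF assms(1) _ p] smooth_on_partial[OF assms(2)]
      C_k_on_const[of _ U "0::real"] unfolding smooth_on_def by blast
  show "q \<in> U \<Longrightarrow> partial a (\<lambda>q. exp (f q)) q = partial a f q * exp (f q)" using p by simp
qed

lemma smooth_on_det [smooth]:
  fixes A :: "real^2 \<Rightarrow> real^'n^'n"
  assumes "open U" "\<And>i j. smooth_on U (\<lambda>q. A q $ i $ j)"
  shows "smooth_on U (\<lambda>q. det (A q))"
  unfolding det_def by (intro smooth assms)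

lemma partial_const: "partial a (\<lambda>z. c) q = 0"
  using has_derivative_partial[OF has_derivative_const] .

context
  fixes U :: "(real^2) set" and q :: "real^2"
  assumes U: "open U" "q \<in> U"
begin

lemma partial_add:
  assumes "smooth_on U f" "smooth_on U g"
  shows "partial a (\<lambda>z. f z + g z) q = partial a f q + partial a g q"
  unfolding has_derivative_partial[OF has_derivative_add[OF
        has_derivative_partials[OF smooth_on_differentiable[OF U(1) assms(1) U(2)]]
        has_derivative_partials[OF smooth_on_differentiable[OF U(1) assms(2) U(2)]]]]
    sum_axis_partial ..

lemma partial_bounded_linear:
  assumes "bounded_linear h" "smooth_on U f"
  shows "partial a (\<lambda>z. h (f z)) q = h (partial a f q)"
  unfolding has_derivative_partial[OF bounded_linear.has_derivative[OF assms(1)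
        has_derivative_partials[OF smooth_on_differentiable[OF U(1) assms(2) U(2)]]]]
    sum_axis_partial ..

lemma partial_bilinear:
  assumes "bounded_bilinear h" "smooth_on U f" "smooth_on U g"
  shows "partial a (\<lambda>z. h (f z) (g z)) q = h (partial a f q) (g q) + h (f q) (partial a g q)"
  by (intro partial_bilinear_at(2) assms(1) smooth_on_differentiable[OF U(1) _ U(2)] assms(2,3))

lemmas partial_mult = partial_bilinear[OF bounded_bilinear_mult]
lemmas partial_scaleR = partial_bilinear[OF bounded_bilinear_scaleR]
lemmas partial_inner = partial_bilinear[OF bounded_bilinear_inner]
lemmas partial_nth = partial_bounded_linear[OF bounded_linear_vec_nth]
lemmas partial_minus = partial_bounded_linear[OF bounded_linear_minus[OF bounded_linear_ident]]

lemma partial_diff: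
  assumes "smooth_on U f" "smooth_on U g"
  shows "partial a (\<lambda>z. f z - g z) q = partial a f q - partial a g q"
  using partial_add[OF assms(1) smooth_on_minus[OF U(1) assms(2)]] partial_minus[OF assms(2)] by simp

lemma partial_inverse:
  fixes f :: "real^2 \<Rightarrow> real"
  assumes "smooth_on U f" "f q \<noteq> 0"
  shows "partial a (\<lambda>z. inverse (f z)) q = - partial a f q * (inverse (f q))\<^sup>2"
  unfolding has_derivative_partial[OF Deriv.has_derivative_inverse[OF assms(2)
        has_derivative_partials[OF smooth_on_differentiable[OF U(1) assms(1) U(2)]]]]
    sum_axis_partial by (simp add: power2_eq_square)

end

section \<open>Symmetry of mixed partial derivatives\<close>

lemma has_vector_derivative_partial:
  assumes "f differentiable (at (z + s *\<^sub>R axis a 1))"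
  shows "((\<lambda>t. f (z + t *\<^sub>R axis a 1)) has_vector_derivative partial a f (z + s *\<^sub>R axis a 1)) (at s)"
proof -
  let ?F = "\<lambda>v. \<Sum>b\<in>UNIV. v $ b *\<^sub>R partial b f (z + s *\<^sub>R axis a 1)"
  have F: "(f has_derivative ?F) (at (z + s *\<^sub>R axis a 1))"
    by (rule has_derivative_partials[OF assms])
  have "((\<lambda>t. z + t *\<^sub>R axis a (1::real)) has_derivative (\<lambda>t. t *\<^sub>R axis a 1)) (at s)"
    by (auto intro!: derivative_eq_intros)
  from has_derivative_compose[OF this F]
  have "((\<lambda>t. f (z + t *\<^sub>R axis a 1)) has_derivative (\<lambda>t. ?F (t *\<^sub>R axis a 1))) (at s)" .
  moreover have "?F (t *\<^sub>R axis a 1) = t *\<^sub>R ?F (axis a 1)" for t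
    by (simp add: scaleR_sum_right)
  ultimately show ?thesis
    unfolding has_vector_derivative_def by (simp add: sum_axis_partial)
qed

text \<open>The mean value theorem is applied in direction \<open>a\<close> to the increment of
  \<open>f\<close> across the step in direction \<open>b\<close>, and then in direction
  \<open>b\<close> to the increment of \<open>partial a f\<close> that results.\<close>

lemma second_difference:
  fixes f :: "real^2 \<Rightarrow> real"
  assumes "open U" "smooth_on U f" "0 < h"
    and U: "\<And>s t. 0 \<le> s \<Longrightarrow> s \<le> h \<Longrightarrow> 0 \<le> t \<Longrightarrow> t \<le> h \<Longrightarrow> q + s *\<^sub>R axis a 1 + t *\<^sub>R axis b 1 \<in> U"
  obtains s t where "0 < s" "s < h" "0 < t" "t < h"
    "f (q + h *\<^sub>R axis a 1 + h *\<^sub>R axis b 1) - f (q + h *\<^sub>R axis a 1) - f (q + h *\<^sub>R axis b 1) + f q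
      = h * (h * partial b (partial a f) (q + s *\<^sub>R axis a 1 + t *\<^sub>R axis b 1))"
proof -
  let ?u = "axis a (1::real)" and ?v = "axis b (1::real)"
  define \<phi> where "\<phi> s = f ((q + h *\<^sub>R ?v) + s *\<^sub>R ?u) - f (q + s *\<^sub>R ?u)" for s
  have "DERIV \<phi> s :> partial a f ((q + h *\<^sub>R ?v) + s *\<^sub>R ?u) - partial a f (q + s *\<^sub>R ?u)"
    if "0 \<le> s" "s \<le> h" for s
  proof -
    have "(q + h *\<^sub>R ?v) + s *\<^sub>R ?u \<in> U" "q + s *\<^sub>R ?u \<in> U"
      using U[of s h] U[of s 0] that assms(3) by (auto simp: algebra_simps)
    then show ?thesis unfolding \<phi>_def has_real_derivative_iff_has_vector_derivative
      by (intro derivative_intros has_vector_derivative_partial smooth_on_differentiable[OF assms(1,2)])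
  qed
  from MVT2[OF assms(3) this] obtain s where s: "0 < s" "s < h"
    "\<phi> h - \<phi> 0 = h * (partial a f ((q + h *\<^sub>R ?v) + s *\<^sub>R ?u) - partial a f (q + s *\<^sub>R ?u))" by auto
  have "DERIV (\<lambda>t. partial a f ((q + s *\<^sub>R ?u) + t *\<^sub>R ?v)) t :> partial b (partial a f) ((q + s *\<^sub>R ?u) + t *\<^sub>R ?v)"
    if "0 \<le> t" "t \<le> h" for t
    unfolding has_real_derivative_iff_has_vector_derivative
    using U[of s t] that s
    by (intro has_vector_derivative_partial smooth_on_differentiable[OF assms(1) smooth_on_partial[OF assms(2)]]) auto
  from MVT2[OF assms(3) this] obtain t where t: "0 < t" "t < h"
    "partial a f (q + s *\<^sub>R ?u + h *\<^sub>R ?v) - partial a f (q + s *\<^sub>R ?u) = h * partial b (partial a f) (q + s *\<^sub>R ?u + t *\<^sub>R ?v)"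
    by auto
  have "f (q + h *\<^sub>R ?u + h *\<^sub>R ?v) - f (q + h *\<^sub>R ?u) - f (q + h *\<^sub>R ?v) + f q = \<phi> h - \<phi> 0"
    by (simp add: \<phi>_def add_ac)
  also have "\<dots> = h * (partial a f (q + s *\<^sub>R ?u + h *\<^sub>R ?v) - partial a f (q + s *\<^sub>R ?u))"
    unfolding s(3) by (simp add: add_ac)
  finally have "f (q + h *\<^sub>R ?u + h *\<^sub>R ?v) - f (q + h *\<^sub>R ?u) - f (q + h *\<^sub>R ?v) + f q
      = h * (h * partial b (partial a f) (q + s *\<^sub>R ?u + t *\<^sub>R ?v))"
    unfolding t(3) .
  then show ?thesis using that s t by blast
qed

text \<open>The second difference is symmetric in the two directions, so both mixed derivatives take
  a common value somewhere on the same small square. Continuity then excludes a gap at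
  \<open>q\<close>.\<close>

theorem partial_commute:
  fixes f :: "real^2 \<Rightarrow> real"
  assumes "open U" "smooth_on U f" "q \<in> U"
  shows "partial b (partial a f) q = partial a (partial b f) q"
proof (rule ccontr)
  let ?u = "axis a (1::real)" and ?v = "axis b (1::real)"
  let ?X = "partial b (partial a f)" and ?Y = "partial a (partial b f)"
  assume ne: "?X q \<noteq> ?Y q"
  \<comment> \<open>A common value cannot be closer than half the gap to both \<open>?X q\<close>
    and \<open>?Y q\<close>.\<close>
  define e where "e = \<bar>?X q - ?Y q\<bar> / 2"
  have e: "e > 0" using ne by (simp add: e_def)
  have "continuous (at q) ?X" "continuous (at q) ?Y"
    using smooth_on_imp_continuous_on[OF smooth_on_partial[OF smooth_on_partial[OF assms(2)]]] assms(1,3)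
    by (simp_all add: continuous_on_eq_continuous_at)
  then obtain d1 d2 where d: "d1 > 0" "\<And>z. dist z q < d1 \<Longrightarrow> dist (?X z) (?X q) < e"
     "d2 > 0" "\<And>z. dist z q < d2 \<Longrightarrow> dist (?Y z) (?Y q) < e"
    using e unfolding continuous_at_eps_delta by metis
  obtain d3 where d3: "d3 > 0" "ball q d3 \<subseteq> U" using assms(1,3) openE by blast
  \<comment> \<open>Points of the square lie within \<open>2 * h\<close> of \<open>q\<close>; the
    divisor three makes this strictly smaller than all three radii.\<close>
  define h where "h = min d1 (min d2 d3) / 3"
  have h: "h > 0" "2 * h < d1" "2 * h < d2" "2 * h < d3" using d d3 by (auto simp: h_def min_def)
  have nrm: "dist (q + s *\<^sub>R axis a' 1 + t *\<^sub>R axis b' 1) q \<le> 2 * h" if "0 \<le> s" "s \<le> h" "0 \<le> t" "t \<le> h" for s t and a' b' :: 2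
  proof -
    have "norm (s *\<^sub>R axis a' (1::real) + t *\<^sub>R axis b' 1) \<le> norm (s *\<^sub>R axis a' (1::real)) + norm (t *\<^sub>R axis b' (1::real))"
      by (rule norm_triangle_ineq)
    then show ?thesis using that by (simp add: dist_norm norm_axis_1 add.assoc)
  qed
  have U: "q + s *\<^sub>R axis a' 1 + t *\<^sub>R axis b' 1 \<in> U" if "0 \<le> s" "s \<le> h" "0 \<le> t" "t \<le> h" for s t and a' b' :: 2
    using nrm[OF that, of a' b'] h(4) d3(2) by (auto simp: dist_commute)
  obtain s t where st: "0 < s" "s < h" "0 < t" "t < h"
    "f (q + h *\<^sub>R ?u + h *\<^sub>R ?v) - f (q + h *\<^sub>R ?u) - f (q + h *\<^sub>R ?v) + f q = h * (h * ?X (q + s *\<^sub>R ?u + t *\<^sub>R ?v))"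
    using second_difference[OF assms(1,2) h(1), of q a b, OF U] by blast
  obtain s' t' where st': "0 < s'" "s' < h" "0 < t'" "t' < h"
    "f (q + h *\<^sub>R ?v + h *\<^sub>R ?u) - f (q + h *\<^sub>R ?v) - f (q + h *\<^sub>R ?u) + f q = h * (h * ?Y (q + s' *\<^sub>R ?v + t' *\<^sub>R ?u))"
    using second_difference[OF assms(1,2) h(1), of q b a, OF U] by blast
  have "q + h *\<^sub>R ?v + h *\<^sub>R ?u = q + h *\<^sub>R ?u + h *\<^sub>R ?v" by simp
  then have "?X (q + s *\<^sub>R ?u + t *\<^sub>R ?v) = ?Y (q + s' *\<^sub>R ?v + t' *\<^sub>R ?u)"
    using st(5) st'(5) h(1) by (auto simp: algebra_simps)
  moreover have "dist (?X (q + s *\<^sub>R ?u + t *\<^sub>R ?v)) (?X q) < e"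
    using d(2) nrm[of s t a b] st h by auto
  moreover have "dist (?Y (q + s' *\<^sub>R ?v + t' *\<^sub>R ?u)) (?Y q) < e"
    using d(4) nrm[of s' t' b a] st' h by auto
  ultimately show False by (auto simp: e_def dist_real_def abs_if split: if_splits)
qed

section \<open>The Poincare lemma on a ball\<close>

text \<open>The potential is the integral of the form along the segments issuing from the centre.\<close>

theorem closed_form_exact_on_ball:
  fixes l :: "2 \<Rightarrow> real^2 \<Rightarrow> real"
  assumes l: "\<And>a. smooth_on (ball p r) (l a)"
    and closed: "\<And>q a b. q \<in> ball p r \<Longrightarrow> partial a (l b) q = partial b (l a) q"
  obtains h where "smooth_on (ball p r) h" "\<And>a q. q \<in> ball p r \<Longrightarrow> partial a h q = l a q"
proof -
  let ?B = "ball p r"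
  define z where "z x t = p + t *\<^sub>R (x - p)" for x :: "real^2" and t :: real
  define f where "f x t = (\<Sum>a\<in>UNIV. l a (z x t) * (x - p) $ a)" for x t
  \<comment> \<open>\<open>c b x t\<close> is the derivative of \<open>f x t\<close> in direction
    \<open>b\<close> of \<open>x\<close>. Closedness of the form will turn it into the
    \<open>t\<close>-derivative of \<open>t * l b (z x t)\<close>.\<close>
  define c where "c b x t = t * (\<Sum>a\<in>UNIV. partial b (l a) (z x t) * (x - p) $ a) + l b (z x t)" for b x t
  \<comment> \<open>The Leibniz rule takes derivatives as bounded linear functions;
    \<open>E b\<close> is the coordinate projection in that type.\<close>
  define E where "E b = Blinfun (\<lambda>v :: real^2. v $ b)" for b
  have E: "blinfun_apply (E b) = (\<lambda>v. v $ b)" for b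
    unfolding E_def by (intro bounded_linear_Blinfun_apply bounded_linear_vec_nth)
  define fx where "fx x t = (\<Sum>b\<in>UNIV. c b x t *\<^sub>R E b)" for x t
  have zB: "z x t \<in> ?B" if "x \<in> ?B" "t \<in> cbox 0 1" for x t
  proof -
    have "norm (t *\<^sub>R (x - p)) \<le> 1 * norm (x - p)" using that by (simp add: mult_left_le_one_le)
    then show ?thesis using that by (auto simp: z_def dist_norm norm_minus_commute)
  qed
  have fxa: "blinfun_apply (fx x t) v = (\<Sum>b\<in>UNIV. c b x t * v $ b)" for x t v
    by (simp add: fx_def blinfun.sum_left blinfun.scaleR_left E)
  have d: "((\<lambda>x. f x t) has_derivative blinfun_apply (fx x t)) (at x within ?B)" if "x \<in> ?B" "t \<in> cbox 0 1" for x t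
  proof -
    have "((\<lambda>x. z x t) has_derivative (\<lambda>v. t *\<^sub>R v)) (at x within ?B)"
      unfolding z_def by (auto intro!: derivative_eq_intros)
    from has_derivative_compose[OF this has_derivative_partials]
    have lz: "((\<lambda>x. l a (z x t)) has_derivative (\<lambda>v. \<Sum>b\<in>UNIV. (t *\<^sub>R v) $ b *\<^sub>R partial b (l a) (z x t))) (at x within ?B)" for a
      using smooth_on_differentiable[OF open_ball l zB[OF that]] by blast
    have xp: "((\<lambda>x. (x - p) $ a) has_derivative (\<lambda>v. v $ a)) (at x within ?B)" for a
      by (auto intro!: derivative_eq_intros bounded_linear.has_derivative[OF bounded_linear_vec_nth])
    have "((\<lambda>x. f x t) has_derivative (\<lambda>v. \<Sum>a\<in>UNIV. l a (z x t) * v $ a + (\<Sum>b\<in>UNIV. (t *\<^sub>R v) $ b *\<^sub>R partial b (l a) (z x t)) * (x - p) $ a)) (at x within ?B)"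
      unfolding f_def by (intro has_derivative_sum has_derivative_mult lz xp)
    moreover have "(\<Sum>a\<in>UNIV. l a (z x t) * v $ a + (\<Sum>b\<in>UNIV. (t *\<^sub>R v) $ b *\<^sub>R partial b (l a) (z x t)) * (x - p) $ a)
        = blinfun_apply (fx x t) v" for v
      unfolding fxa c_def sum_2 by (simp add: algebra_simps)
    ultimately show ?thesis by simp
  qed
  have contz: "continuous_on (?B \<times> cbox 0 1) (\<lambda>y. z (fst y) (snd y))"
    unfolding z_def by (intro continuous_intros)
  have cont_comp: "continuous_on (?B \<times> cbox 0 1) (\<lambda>y. g (z (fst y) (snd y)))" if "continuous_on ?B g" for g :: "real^2 \<Rightarrow> real"
    by (rule continuous_on_compose2[OF that contz]) (use zB in \<open>auto simp del: mem_ball mem_box_real cbox_interval\<close>)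
  have cont_fx: "continuous_on (?B \<times> cbox 0 1) (\<lambda>y. fx (fst y) (snd y))"
    unfolding fx_def c_def
    by (intro continuous_intros cont_comp smooth_on_imp_continuous_on l smooth_on_partial)
  have fint: "f x integrable_on cbox 0 1" if "x \<in> ?B" for x
  proof -
    have "continuous_on (cbox 0 1) (\<lambda>t. l a (z x t))" for a
    proof (rule continuous_on_compose2[OF smooth_on_imp_continuous_on[OF l]])
      show "continuous_on (cbox 0 1) (z x)" unfolding z_def by (intro continuous_intros)
      show "z x ` cbox 0 1 \<subseteq> ?B" using zB[OF that] by blast
    qed
    then show ?thesis unfolding f_def
      by (intro integrable_continuous continuous_intros)
  qed
  have hd: "((\<lambda>x. integral (cbox 0 1) (f x)) has_derivative blinfun_apply (integral (cbox 0 1) (fx x))) (at x)" if "x \<in> ?B" for x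
    using leibniz_rule[of ?B 0 1 f fx x] d fint cont_fx that at_within_open[OF that open_ball] by (simp add: split_beta del: cbox_interval)
  define h where "h x = integral (cbox 0 1) (f x)" for x
  have ph: "partial b h x = l b x" if x: "x \<in> ?B" for b x
  proof -
    have cont: "continuous_on (cbox 0 1) (\<lambda>t. fx x t)"
      using continuous_on_compose2[OF cont_fx, of "cbox 0 1" "\<lambda>t. (x, t)"] x
      by (simp add: continuous_on_Pair image_subset_iff del: cbox_interval)
    have "partial b h x = blinfun_apply (integral (cbox 0 1) (fx x)) (axis b 1)"
      using has_derivative_partial[OF hd[OF x]] by (simp add: h_def[abs_def])
    also have "\<dots> = integral (cbox 0 1) (\<lambda>t. blinfun_apply (fx x t) (axis b 1))"
      using integral_linear[OF integrable_continuous[OF cont] blinfun.bounded_linear_left[of "axis b 1"]]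
      by (simp add: o_def)
    also have "\<dots> = integral (cbox 0 1) (c b x)"
      by (simp add: fxa axis_def if_distrib cong: if_cong)
    \<comment> \<open>In the boundary terms the factor \<open>t\<close> removes the value at the
      centre, and \<open>z x 1\<close> is \<open>x\<close>.\<close>
    also have "\<dots> = 1 * l b (z x 1) - 0 * l b (z x 0)"
    proof (rule integral_unique, unfold cbox_interval, rule fundamental_theorem_of_calculus)
      fix t :: real assume "t \<in> {0..1}"
      then have zt: "z x t \<in> ?B" using zB[OF x] by simp
      have "((\<lambda>t. z x t) has_derivative (\<lambda>s. s *\<^sub>R (x - p))) (at t within {0..1})"
        unfolding z_def by (auto intro!: derivative_eq_intros)
      from has_derivative_compose[OF this has_derivative_partials[OF smooth_on_differentiable[OF open_ball l[of b] zt]]]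
      have "((\<lambda>t. t * l b (z x t)) has_derivative
        (\<lambda>s. t * (\<Sum>a\<in>UNIV. (s *\<^sub>R (x - p)) $ a *\<^sub>R partial a (l b) (z x t)) + s * l b (z x t))) (at t within {0..1})"
        by (intro has_derivative_mult has_derivative_ident)
      moreover have "t * (\<Sum>a\<in>UNIV. (s *\<^sub>R (x - p)) $ a *\<^sub>R partial a (l b) (z x t)) + s * l b (z x t) = s *\<^sub>R c b x t" for s
        unfolding c_def closed[OF zt, of b] sum_2 by (simp add: algebra_simps)
      ultimately show "((\<lambda>t. t * l b (z x t)) has_vector_derivative c b x t) (at t within {0..1})"
        by (simp add: has_vector_derivative_def)
    qed simp
    finally show ?thesis by (simp add: z_def)
  qed
  have "smooth_on ?B h"
  proof (rule smooth_onI)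
    show "h differentiable_on ?B"
      unfolding differentiable_on_eq_differentiable_at[OF open_ball] differentiable_def h_def using hd by blast
    show "smooth_on ?B (partial a h)" for a
      using smooth_on_cong[of ?B "partial a h" "l a"] ph l by simp
  qed
  then show ?thesis using that ph by blast
qed

section \<open>Linear algebra in dimension six\<close>

lemma exhaust_6: "x = 1 \<or> x = 2 \<or> x = 3 \<or> x = 4 \<or> x = 5 \<or> x = 6" for x :: 6
proof (induct x)
  case (of_int z)
  then have "z = 0 \<or> z = 1 \<or> z = 2 \<or> z = 3 \<or> z = 4 \<or> z = 5" by (simp, arith)
  then show ?case by auto
qed

lemma forall_6: "(\<forall>i::6. P i) \<longleftrightarrow> P 1 \<and> P 2 \<and> P 3 \<and> P 4 \<and> P 5 \<and> P 6"
  by (metis exhaust_6)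

lemma UNIV_6: "UNIV = {1, 2, 3, 4, 5, 6::6}"
  using exhaust_6 by auto

lemma sum_6: "sum f (UNIV::6 set) = f 1 + f 2 + f 3 + f 4 + f 5 + f 6"
  unfolding UNIV_6 by (simp add: ac_simps)

lemma exhaust_10: "x = 1 \<or> x = 2 \<or> x = 3 \<or> x = 4 \<or> x = 5 \<or> x = 6 \<or> x = 7 \<or> x = 8 \<or> x = 9 \<or> x = 10" for x :: 10
proof (induct x)
  case (of_int z)
  then have "z = 0 \<or> z = 1 \<or> z = 2 \<or> z = 3 \<or> z = 4 \<or> z = 5 \<or> z = 6 \<or> z = 7 \<or> z = 8 \<or> z = 9" by (simp, arith)
  then show ?case by auto
qed

lemma forall_10: "(\<forall>i::10. P i) \<longleftrightarrow>
    P 1 \<and> P 2 \<and> P 3 \<and> P 4 \<and> P 5 \<and> P 6 \<and> P 7 \<and> P 8 \<and> P 9 \<and> P 10" (is "?L \<longleftrightarrow> ?R")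
proof
  assume R: ?R
  show ?L
  proof
    fix i show "P i" using R exhaust_10[of i] by (elim conjE disjE) simp_all
  qed
qed simp

lemma vector_6 [simp]:
  "(vector [a, b, c, d, e, f] :: 'a::zero^6) $ 1 = a"
  "(vector [a, b, c, d, e, f] :: 'a::zero^6) $ 2 = b"
  "(vector [a, b, c, d, e, f] :: 'a::zero^6) $ 3 = c"
  "(vector [a, b, c, d, e, f] :: 'a::zero^6) $ 4 = d"
  "(vector [a, b, c, d, e, f] :: 'a::zero^6) $ 5 = e"
  "(vector [a, b, c, d, e, f] :: 'a::zero^6) $ 6 = f"
  unfolding vector_def by simp_all

lemma vector_10 [simp]:
  "(vector [a, b, c, d, e, f, g, h, i, j] :: 'a::zero^10) $ 1 = a"
  "(vector [a, b, c, d, e, f, g, h, i, j] :: 'a::zero^10) $ 2 = b"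
  "(vector [a, b, c, d, e, f, g, h, i, j] :: 'a::zero^10) $ 3 = c"
  "(vector [a, b, c, d, e, f, g, h, i, j] :: 'a::zero^10) $ 4 = d"
  "(vector [a, b, c, d, e, f, g, h, i, j] :: 'a::zero^10) $ 5 = e"
  "(vector [a, b, c, d, e, f, g, h, i, j] :: 'a::zero^10) $ 6 = f"
  "(vector [a, b, c, d, e, f, g, h, i, j] :: 'a::zero^10) $ 7 = g"
  "(vector [a, b, c, d, e, f, g, h, i, j] :: 'a::zero^10) $ 8 = h"
  "(vector [a, b, c, d, e, f, g, h, i, j] :: 'a::zero^10) $ 9 = i"
  "(vector [a, b, c, d, e, f, g, h, i, j] :: 'a::zero^10) $ 10 = j"
  unfolding vector_def by simp_all

lemma matrix_vector_zero_iff: "A *v v = 0 \<longleftrightarrow> (\<forall>i. A $ i \<bullet> v = 0)" for A :: "real^'n^'m"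
  by (simp add: vec_eq_iff matrix_vector_mul_component)

lemma det_nonzero_iff_kernel: "det A \<noteq> 0 \<longleftrightarrow> (\<forall>v. A *v v = 0 \<longrightarrow> v = 0)" for A :: "real^'n^'n"
  by (simp add: invertible_left_inverse matrix_left_invertible_ker flip: invertible_det_nz)

lemma det_nonzero_iff_rows:
  fixes A :: "real^'n^'n"
  shows "det A \<noteq> 0 \<longleftrightarrow> (\<forall>c. (\<Sum>i\<in>UNIV. c $ i *\<^sub>R A $ i) = 0 \<longrightarrow> c = 0)"
proof -
  have "transpose A *v c = (\<Sum>i\<in>UNIV. c $ i *\<^sub>R A $ i)" for c
    by (simp add: vec_eq_iff matrix_vector_mult_def transpose_def mult.commute)
  then show ?thesis using det_nonzero_iff_kernel[of "transpose A"] by simp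
qed

lemma det_vector6_nonzero_iff:
  "det (vector [r1, r2, r3, r4, r5, r6] :: real^6^6) \<noteq> 0 \<longleftrightarrow>
    (\<forall>c1 c2 c3 c4 c5 c6. c1 *\<^sub>R r1 + c2 *\<^sub>R r2 + c3 *\<^sub>R r3 + c4 *\<^sub>R r4 + c5 *\<^sub>R r5 + c6 *\<^sub>R r6 = 0
      \<longrightarrow> c1 = 0 \<and> c2 = 0 \<and> c3 = 0 \<and> c4 = 0 \<and> c5 = 0 \<and> c6 = 0)" (is "_ \<longleftrightarrow> ?R")
proof -
  have "(\<forall>c :: real^6. c $ 1 *\<^sub>R r1 + c $ 2 *\<^sub>R r2 + c $ 3 *\<^sub>R r3 + c $ 4 *\<^sub>R r4 + c $ 5 *\<^sub>R r5 + c $ 6 *\<^sub>R r6 = 0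
      \<longrightarrow> c = 0) \<longleftrightarrow> ?R" (is "?L \<longleftrightarrow> _")
  proof
    assume L: ?L
    show ?R
    proof (intro allI impI)
      fix c1 c2 c3 c4 c5 c6 :: real
      assume "c1 *\<^sub>R r1 + c2 *\<^sub>R r2 + c3 *\<^sub>R r3 + c4 *\<^sub>R r4 + c5 *\<^sub>R r5 + c6 *\<^sub>R r6 = 0"
      then have "vector [c1, c2, c3, c4, c5, c6] = (0 :: real^6)"
        using L[rule_format, of "vector [c1, c2, c3, c4, c5, c6]"] by simp
      then show "c1 = 0 \<and> c2 = 0 \<and> c3 = 0 \<and> c4 = 0 \<and> c5 = 0 \<and> c6 = 0"
        by (metis vector_6 zero_index)
    qed
  next
    assume R: ?R
    show ?L
    proof (intro allI impI)
      fix c :: "real^6"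
      assume "c $ 1 *\<^sub>R r1 + c $ 2 *\<^sub>R r2 + c $ 3 *\<^sub>R r3 + c $ 4 *\<^sub>R r4 + c $ 5 *\<^sub>R r5 + c $ 6 *\<^sub>R r6 = 0"
      then have "c $ 1 = 0 \<and> c $ 2 = 0 \<and> c $ 3 = 0 \<and> c $ 4 = 0 \<and> c $ 5 = 0 \<and> c $ 6 = 0" using R by blast
      then show "c = 0" unfolding vec_eq_iff[of c] forall_6 by simp
    qed
  qed
  then show ?thesis by (simp add: det_nonzero_iff_rows sum_6)
qed

text \<open>\<open>independent\<close> speaks of sets and cannot see repetitions; together with
  \<open>distinct\<close> it says that the list is independent as an indexed family, which allows
  coefficients to be compared.\<close>

lemma distinct_independent_iff:
  "distinct xs \<and> independent (set xs) \<longleftrightarrow>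
    (\<forall>c::nat \<Rightarrow> real. (\<Sum>i<length xs. c i *\<^sub>R xs ! i) = 0 \<longrightarrow> (\<forall>i<length xs. c i = 0))"
    (is "?L \<longleftrightarrow> ?R") for xs :: "'a::real_vector list"
proof
  assume L: ?L
  show ?R
  proof (intro allI impI)
    fix c :: "nat \<Rightarrow> real" and i
    assume c: "(\<Sum>i<length xs. c i *\<^sub>R xs ! i) = 0" and i: "i < length xs"
    have bij: "bij_betw ((!) xs) {..<length xs} (set xs)"
      using L by (intro bij_betw_nth) auto
    define u where "u v = c (inv_into {..<length xs} ((!) xs) v)" for v
    have u: "u (xs ! j) = c j" if "j < length xs" for j
      unfolding u_def using that bij by (subst inv_into_f_f) (auto simp: bij_betw_def)
    have "(\<Sum>v\<in>set xs. u v *\<^sub>R v) = (\<Sum>i<length xs. u (xs ! i) *\<^sub>R xs ! i)"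
      by (rule sum.reindex_bij_betw[OF bij, symmetric])
    also have "\<dots> = 0" using c u by simp
    finally have "u (xs ! i) = 0"
      using L i by (intro independentD[of "set xs" "set xs" u]) auto
    then show "c i = 0" using u i by simp
  qed
next
  assume R: ?R
  have d: "distinct xs"
    unfolding distinct_conv_nth
  proof (intro allI impI)
    fix i j assume ij: "i < length xs" "j < length xs" "i \<noteq> j"
    show "xs ! i \<noteq> xs ! j"
    proof
      assume eq: "xs ! i = xs ! j"
      \<comment> \<open>Two equal entries satisfy the relation with coefficients \<open>1\<close>
        and \<open>-1\<close>.\<close>
      define c :: "nat \<Rightarrow> real" where "c k = (if k = i then 1 else 0) - (if k = j then 1 else 0)" for k
      have "(\<Sum>k<length xs. c k *\<^sub>R xs ! k) = (\<Sum>k<length xs. (if k = i then xs ! k else 0) - (if k = j then xs ! k else 0))"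
        by (intro sum.cong) (auto simp: c_def)
      also have "\<dots> = 0" using ij eq by (simp add: sum_subtractf)
      finally have "c i = 0" using R ij by blast
      then show False using ij by (simp add: c_def)
    qed
  qed
  moreover have "independent (set xs)"
  proof (rule independent_if_scalars_zero)
    fix f x assume f: "(\<Sum>x\<in>set xs. f x *\<^sub>R x) = 0" and x: "x \<in> set xs"
    have bij: "bij_betw ((!) xs) {..<length xs} (set xs)"
      using d by (intro bij_betw_nth) auto
    have "(\<Sum>i<length xs. f (xs ! i) *\<^sub>R xs ! i) = 0"
      using f sum.reindex_bij_betw[OF bij, of "\<lambda>x. f x *\<^sub>R x"] by simp
    then show "f x = 0" using R[rule_format, of "\<lambda>i. f (xs ! i)"] x by (auto simp: in_set_conv_nth)
  qed simp
  ultimately show ?L by simp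
qed

lemma distinct_independent_5:
  "distinct [r1, r2, r3, r4, r5] \<and> independent (set [r1, r2, r3, r4, r5]) \<longleftrightarrow>
    (\<forall>c1 c2 c3 c4 c5. c1 *\<^sub>R r1 + c2 *\<^sub>R r2 + c3 *\<^sub>R r3 + c4 *\<^sub>R r4 + c5 *\<^sub>R r5 = 0
      \<longrightarrow> c1 = 0 \<and> c2 = 0 \<and> c3 = 0 \<and> c4 = 0 \<and> c5 = 0)" (is "?L \<longleftrightarrow> ?R") for r1 :: "'a::real_vector"
proof -
  have "?L \<longleftrightarrow> (\<forall>c::nat \<Rightarrow> real. c 0 *\<^sub>R r1 + c 1 *\<^sub>R r2 + c 2 *\<^sub>R r3 + c 3 *\<^sub>R r4 + c 4 *\<^sub>R r5 = 0
      \<longrightarrow> c 0 = 0 \<and> c 1 = 0 \<and> c 2 = 0 \<and> c 3 = 0 \<and> c 4 = 0)"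
  proof -
    have "{..<5::nat} = {0, 1, 2, 3, 4}" by auto
    then have "(\<Sum>i<5. f i) = f 0 + f 1 + f 2 + f 3 + f 4" for f :: "nat \<Rightarrow> 'a" by (simp add: add.assoc)
    moreover have "(\<forall>i<5. P i) \<longleftrightarrow> P 0 \<and> P 1 \<and> P 2 \<and> P 3 \<and> P 4" for P :: "nat \<Rightarrow> bool"
      by (simp add: numeral_eq_Suc All_less_Suc2)
    moreover have "length [r1, r2, r3, r4, r5] = 5" by simp
    ultimately show ?thesis unfolding distinct_independent_iff by (simp only: nth_Cons_0 nth_Cons_numeral) simp
  qed
  also have "\<dots> \<longleftrightarrow> ?R"
  proof (intro iffI allI impI)
    fix c1 c2 c3 c4 c5 :: real
    assume *: "\<forall>c::nat \<Rightarrow> real. c 0 *\<^sub>R r1 + c 1 *\<^sub>R r2 + c 2 *\<^sub>R r3 + c 3 *\<^sub>R r4 + c 4 *\<^sub>R r5 = 0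
      \<longrightarrow> c 0 = 0 \<and> c 1 = 0 \<and> c 2 = 0 \<and> c 3 = 0 \<and> c 4 = 0"
      and "c1 *\<^sub>R r1 + c2 *\<^sub>R r2 + c3 *\<^sub>R r3 + c4 *\<^sub>R r4 + c5 *\<^sub>R r5 = 0"
    then show "c1 = 0 \<and> c2 = 0 \<and> c3 = 0 \<and> c4 = 0 \<and> c5 = 0"
      using *[rule_format, of "(!) [c1, c2, c3, c4, c5]"] by simp
  next
    fix c :: "nat \<Rightarrow> real"
    assume ?R and "c 0 *\<^sub>R r1 + c 1 *\<^sub>R r2 + c 2 *\<^sub>R r3 + c 3 *\<^sub>R r4 + c 4 *\<^sub>R r5 = 0"
    then show "c 0 = 0 \<and> c 1 = 0 \<and> c 2 = 0 \<and> c 3 = 0 \<and> c 4 = 0" by blast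
  qed
  finally show ?thesis .
qed

lemma linear_det_row:
  fixes A :: "real^'n^'n"
  shows "linear (\<lambda>x. det (\<chi> i. if i = k then x else A $ i))"
proof (rule linearI)
  fix x y and r :: real
  show "det (\<chi> i. if i = k then x + y else A $ i) = det (\<chi> i. if i = k then x else A $ i) + det (\<chi> i. if i = k then y else A $ i)"
    by (rule det_row_add)
  show "det (\<chi> i. if i = k then r *\<^sub>R x else A $ i) = r *\<^sub>R det (\<chi> i. if i = k then x else A $ i)"
    using det_row_mul[of k r "\<lambda>_. x" "($) A"] unfolding scalar_mult_eq_scaleR by simp
qed

lemma linear_det_vector6:
  "linear (\<lambda>x. det (vector [r1, r2, r3, x, r5, r6] :: real^6^6))"
  "linear (\<lambda>x. det (vector [r1, r2, r3, r4, x, r6] :: real^6^6))"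
  "linear (\<lambda>x. det (vector [r1, r2, r3, r4, r5, x] :: real^6^6))"
proof -
  have "(vector [r1, r2, r3, x, r5, r6] :: real^6^6) = (\<chi> i. if i = 4 then x else (vector [r1, r2, r3, x', r5, r6] :: real^6^6) $ i)"
   "(vector [r1, r2, r3, r4, x, r6] :: real^6^6) = (\<chi> i. if i = 5 then x else (vector [r1, r2, r3, r4, x', r6] :: real^6^6) $ i)"
   "(vector [r1, r2, r3, r4, r5, x] :: real^6^6) = (\<chi> i. if i = 6 then x else (vector [r1, r2, r3, r4, r5, x'] :: real^6^6) $ i)"
    for x x' unfolding vec_eq_iff[where 'b=6] forall_6 by simp_all
  \<comment> \<open>The variable \<open>x'\<close> stands for the row that gets overwritten, so any
    value serves; zero is inserted.\<close>
  from this[of _ 0] show "linear (\<lambda>x. det (vector [r1, r2, r3, x, r5, r6] :: real^6^6))"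
  "linear (\<lambda>x. det (vector [r1, r2, r3, r4, x, r6] :: real^6^6))"
  "linear (\<lambda>x. det (vector [r1, r2, r3, r4, r5, x] :: real^6^6))"
    using linear_det_row by simp_all
qed

lemma det_vector6_repeated:
  "det (vector [r1, r2, r3, r1, r5, r6] :: real^6^6) = 0"
  "det (vector [r1, r2, r3, r2, r5, r6] :: real^6^6) = 0"
  "det (vector [r1, r2, r3, r3, r5, r6] :: real^6^6) = 0"
  "det (vector [r1, r2, r3, r5, r5, r6] :: real^6^6) = 0"
  "det (vector [r1, r2, r3, r4, r1, r6] :: real^6^6) = 0"
  "det (vector [r1, r2, r3, r4, r2, r6] :: real^6^6) = 0"
  "det (vector [r1, r2, r3, r4, r3, r6] :: real^6^6) = 0"
  by (rule det_identical_rows[of 1 4] det_identical_rows[of 2 4] det_identical_rows[of 3 4]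
      det_identical_rows[of 4 5] det_identical_rows[of 1 5] det_identical_rows[of 2 5] det_identical_rows[of 3 5];
      simp add: row_def vec_eq_iff)+

section \<open>Five vectors in the hyperplane orthogonal to \<open>W\<close>\<close>

context
  fixes W r1 r2 r3 r4 r5 :: "real^6"
  assumes W: "W \<noteq> 0"
    and r: "r1 \<bullet> W = 0" "r2 \<bullet> W = 0" "r3 \<bullet> W = 0" "r4 \<bullet> W = 0" "r5 \<bullet> W = 0"
begin

text \<open>The vector \<open>(W \<bullet> W) *\<^sub>R x - (x \<bullet> W) *\<^sub>R W\<close> is
  orthogonal to \<open>W\<close>. With it as last row, \<open>W\<close> is a nonzero kernel vector
  and the determinant vanishes. This converts the determinants \<open>E1\<close> and
  \<open>E2\<close> into pairings with \<open>W\<close>.\<close>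

lemma det_hyperplane_last_row:
  "det (vector [r1, r2, r3, r4, r5, x] :: real^6^6) * (W \<bullet> W) = (x \<bullet> W) * det (vector [r1, r2, r3, r4, r5, W] :: real^6^6)"
proof -
  let ?L = "\<lambda>x. det (vector [r1, r2, r3, r4, r5, x] :: real^6^6)"
  have "?L ((W \<bullet> W) *\<^sub>R x - (x \<bullet> W) *\<^sub>R W) = 0"
    using W det_nonzero_iff_kernel[of "vector [r1, r2, r3, r4, r5, (W \<bullet> W) *\<^sub>R x - (x \<bullet> W) *\<^sub>R W]"]
    unfolding matrix_vector_zero_iff forall_6 by (auto simp: r inner_diff_left)
  then show ?thesis
    by (simp add: linear_diff[OF linear_det_vector6(3)] linear_cmul[OF linear_det_vector6(3)] mult.commute)
qed

text \<open>Pairing a linear relation with \<open>W\<close> kills the coefficient of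
  \<open>W\<close>, so adjoining \<open>W\<close> creates no new relation. Independence thereby
  becomes the nonvanishing of one determinant, which is continuous in the rows.\<close>

lemma hyperplane_independent_iff:
  "distinct [r1, r2, r3, r4, r5] \<and> independent (set [r1, r2, r3, r4, r5]) \<longleftrightarrow>
    det (vector [r1, r2, r3, r4, r5, W] :: real^6^6) \<noteq> 0"
  unfolding distinct_independent_5 det_vector6_nonzero_iff
proof (intro iffI allI impI)
  fix c1 c2 c3 c4 c5 c6
  assume *: "\<forall>c1 c2 c3 c4 c5. c1 *\<^sub>R r1 + c2 *\<^sub>R r2 + c3 *\<^sub>R r3 + c4 *\<^sub>R r4 + c5 *\<^sub>R r5 = 0
      \<longrightarrow> c1 = 0 \<and> c2 = 0 \<and> c3 = 0 \<and> c4 = 0 \<and> c5 = 0"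
    and c: "c1 *\<^sub>R r1 + c2 *\<^sub>R r2 + c3 *\<^sub>R r3 + c4 *\<^sub>R r4 + c5 *\<^sub>R r5 + c6 *\<^sub>R W = 0"
  have "(c1 *\<^sub>R r1 + c2 *\<^sub>R r2 + c3 *\<^sub>R r3 + c4 *\<^sub>R r4 + c5 *\<^sub>R r5 + c6 *\<^sub>R W) \<bullet> W = c6 * (W \<bullet> W)"
    by (simp add: inner_add_left r)
  with c W have "c6 = 0" by simp
  with c * show "c1 = 0 \<and> c2 = 0 \<and> c3 = 0 \<and> c4 = 0 \<and> c5 = 0 \<and> c6 = 0" by simp
next
  fix c1 c2 c3 c4 c5
  assume *: "\<forall>c1 c2 c3 c4 c5 c6. c1 *\<^sub>R r1 + c2 *\<^sub>R r2 + c3 *\<^sub>R r3 + c4 *\<^sub>R r4 + c5 *\<^sub>R r5 + c6 *\<^sub>R W = 0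
      \<longrightarrow> c1 = 0 \<and> c2 = 0 \<and> c3 = 0 \<and> c4 = 0 \<and> c5 = 0 \<and> c6 = 0"
    and "c1 *\<^sub>R r1 + c2 *\<^sub>R r2 + c3 *\<^sub>R r3 + c4 *\<^sub>R r4 + c5 *\<^sub>R r5 = 0"
  then show "c1 = 0 \<and> c2 = 0 \<and> c3 = 0 \<and> c4 = 0 \<and> c5 = 0"
    using *[rule_format, of c1 c2 c3 c4 c5 0] by simp
qed

text \<open>The five rows and \<open>W\<close> form a basis, and pairing with \<open>W\<close> shows
  that \<open>x\<close> has no component along \<open>W\<close>.\<close>

lemma hyperplane_span:
  assumes G: "det (vector [r1, r2, r3, r4, r5, W] :: real^6^6) \<noteq> 0" and x: "x \<bullet> W = 0"
  obtains c1 c2 c3 c4 c5 where "x = c1 *\<^sub>R r1 + c2 *\<^sub>R r2 + c3 *\<^sub>R r3 + c4 *\<^sub>R r4 + c5 *\<^sub>R r5"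
proof -
  let ?A = "vector [r1, r2, r3, r4, r5, W] :: real^6^6"
  have "inj ((*v) (transpose ?A))"
    by (rule inj_matrix_vector_mult) (simp add: invertible_det_nz G)
  then have "surj ((*v) (transpose ?A))"
    by (rule linear_inj_imp_surj[OF matrix_vector_mul_linear])
  then obtain c where "transpose ?A *v c = x" by (metis surjD)
  then have c: "x = c $ 1 *\<^sub>R r1 + c $ 2 *\<^sub>R r2 + c $ 3 *\<^sub>R r3 + c $ 4 *\<^sub>R r4 + c $ 5 *\<^sub>R r5 + c $ 6 *\<^sub>R W"
    by (simp add: vec_eq_iff matrix_vector_mult_def transpose_def sum_6 mult.commute)
  have "x \<bullet> W = c $ 6 * (W \<bullet> W)" by (subst c) (simp add: inner_add_left r)
  with x W have "c $ 6 = 0" by simp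
  with c have c: "x = c $ 1 *\<^sub>R r1 + c $ 2 *\<^sub>R r2 + c $ 3 *\<^sub>R r3 + c $ 4 *\<^sub>R r4 + c $ 5 *\<^sub>R r5" by simp
  then show thesis by (rule that)
qed

end

text \<open>Cramer's rule: by multilinearity only the term without a repeated row survives.\<close>

lemma det_cramer:
  assumes c: "x = c1 *\<^sub>R r1 + c2 *\<^sub>R r2 + c3 *\<^sub>R r3 + c4 *\<^sub>R r4 + c5 *\<^sub>R r5"
  shows "det (vector [r1, r2, r3, x, r5, r6] :: real^6^6) = c4 * det (vector [r1, r2, r3, r4, r5, r6] :: real^6^6)"
    and "det (vector [r1, r2, r3, r4, x, r6] :: real^6^6) = c5 * det (vector [r1, r2, r3, r4, r5, r6] :: real^6^6)"
  unfolding c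
  by (simp_all add: linear_add[OF linear_det_vector6(1)] linear_cmul[OF linear_det_vector6(1)]
      linear_add[OF linear_det_vector6(2)] linear_cmul[OF linear_det_vector6(2)] det_vector6_repeated)

text \<open>A vector orthogonal to \<open>W\<close> and to all rows lies in the kernel, so it is a
  multiple of \<open>W\<close> and orthogonal to itself. Hence the rows and \<open>W\<close> span
  everything, and removing \<open>W\<close> loses at most one dimension.\<close>

lemma rank_ge_5_of_kernel:
  fixes A :: "real^6^'m"
  assumes "\<And>v. A *v v = 0 \<Longrightarrow> v \<in> span {W}"
  shows "rank A \<ge> 5"
proof -
  have "span (insert W (rows A)) = UNIV"
  proof (rule ccontr)
    assume "span (insert W (rows A)) \<noteq> UNIV"
    then obtain x where x: "x \<noteq> 0" "\<forall>y\<in>span (insert W (rows A)). x \<bullet> y = 0"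
      using span_not_UNIV_orthogonal by blast
    have "A $ i \<in> rows A" for i by (auto simp: rows_def row_def vec_nth_inverse)
    then have "A $ i \<bullet> x = 0" for i
      using x(2) by (metis inner_commute insertCI span_base)
    then have "x \<in> span {W}" using assms by (simp add: matrix_vector_zero_iff)
    then obtain k where k: "x = k *\<^sub>R W" by (auto simp: span_singleton)
    have "x \<bullet> W = 0" using x(2) span_base[of W "insert W (rows A)"] by simp
    then have "x \<bullet> x = 0" by (subst (2) k) simp
    then show False using x(1) by simp
  qed
  then have "dim (insert W (rows A)) = 6"
    using dim_span[of "insert W (rows A)"] by (simp add: dim_UNIV)
  then show ?thesis by (auto simp: row_rank_def dim_insert split: if_splits)
qed

section \<open>The connection and its curvature\<close>

lemma bounded_bilinear_matrix_vector: "bounded_bilinear (\<lambda>(A :: real^'n^'m) v. A *v v)"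
  by (intro bilinear_conv_bounded_bilinear[THEN iffD1])
    (auto simp: bilinear_def matrix_vector_mult_add_rdistrib scaleR_matrix_vector_assoc intro!: linearI)

lemma bounded_bilinear_vector_matrix: "bounded_bilinear (\<lambda>v (A :: real^'n^'m). v v* A)"
proof -
  have "v v* A = (\<Sum>i\<in>UNIV. v $ i *\<^sub>R A $ i)" for v and A :: "real^'n^'m"
    by (simp add: vec_eq_iff vector_matrix_mult_def mult.commute)
  then show ?thesis
    by (intro bilinear_conv_bounded_bilinear[THEN iffD1])
      (auto simp: bilinear_def sum.distrib scaleR_add_left scaleR_add_right scaleR_sum_right mult.commute intro!: linearI)
qed

locale smooth_connection =
  fixes U :: "(real^2) set" and \<Gamma> :: connection
  assumes open_U: "open U" and torsion_free: "torsion_free_connection_on U \<Gamma>"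
begin

abbreviation "a0 \<equiv> A0 \<Gamma>"
abbreviation "a1 \<equiv> A1 \<Gamma>"
abbreviation "a2 \<equiv> A2 \<Gamma>"
abbreviation "a3 \<equiv> A3 \<Gamma>"
abbreviation "V \<equiv> V_row \<Gamma>"
abbreviation "\<Omega> a q \<equiv> (if a = 1 then \<Omega>1 \<Gamma> q else \<Omega>2 \<Gamma> q)"

lemma smooth_A [smooth]: "smooth_on U a0" "smooth_on U a1" "smooth_on U a2" "smooth_on U a3"
proof -
  have "smooth_on U (\<Gamma> c a b)" for c a b
    using torsion_free by (simp add: torsion_free_connection_on_def)
  then show "smooth_on U a0" "smooth_on U a1" "smooth_on U a2" "smooth_on U a3"
    unfolding A0_def[abs_def] A1_def[abs_def] A2_def[abs_def] A3_def[abs_def]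
    by (auto intro!: smooth open_U)
qed

lemma smooth_L [smooth]: "smooth_on U (L1 \<Gamma>)" "smooth_on U (L2 \<Gamma>)"
  unfolding L1_def[abs_def] L2_def[abs_def] by (intro smooth open_U)+

lemma smooth_V [smooth]: "smooth_on U V"
proof (rule smooth_on_componentwise[OF open_U])
  have "\<forall>i. smooth_on U (\<lambda>q. V q $ i)"
    unfolding forall_6 V_row_def[abs_def] vector_6 by (intro conjI smooth open_U)
  then show "smooth_on U (\<lambda>q. V q $ i)" for i by blast
qed

text \<open>Separate equations for the entries let the smoothness proofs and the curvature
  computation rewrite entrywise, without unfolding nested \<open>vector\<close> lists.\<close>

lemma \<Omega>1_nth:
  "\<Omega>1 \<Gamma> q $ 1 $ 1 = - 2/3 * a1 q"
  "\<Omega>1 \<Gamma> q $ 1 $ 2 = 2 * a0 q"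
  "\<Omega>1 \<Gamma> q $ 1 $ 3 = 0"
  "\<Omega>1 \<Gamma> q $ 1 $ 4 = 0"
  "\<Omega>1 \<Gamma> q $ 1 $ 5 = 0"
  "\<Omega>1 \<Gamma> q $ 1 $ 6 = 0"
  "\<Omega>1 \<Gamma> q $ 2 $ 1 = 0"
  "\<Omega>1 \<Gamma> q $ 2 $ 2 = 0"
  "\<Omega>1 \<Gamma> q $ 2 $ 3 = 0"
  "\<Omega>1 \<Gamma> q $ 2 $ 4 = - 1/2"
  "\<Omega>1 \<Gamma> q $ 2 $ 5 = 0"
  "\<Omega>1 \<Gamma> q $ 2 $ 6 = 0"
  "\<Omega>1 \<Gamma> q $ 3 $ 1 = - 2 * a3 q"
  "\<Omega>1 \<Gamma> q $ 3 $ 2 = - 2/3 * a2 q"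
  "\<Omega>1 \<Gamma> q $ 3 $ 3 = 4/3 * a1 q"
  "\<Omega>1 \<Gamma> q $ 3 $ 4 = 0"
  "\<Omega>1 \<Gamma> q $ 3 $ 5 = 1"
  "\<Omega>1 \<Gamma> q $ 3 $ 6 = 0"
  "\<Omega>1 \<Gamma> q $ 4 $ 1 = - 4/3 * \<partial>\<^sub>x a2 q + 4 * a0 q * a3 q + 2/3 *
      \<partial>\<^sub>y a1 q"
  "\<Omega>1 \<Gamma> q $ 4 $ 2 = - 2 * \<partial>\<^sub>y a0 q + 2/3 * \<partial>\<^sub>x a1 q + 4 *
      a2 q * a0 q - 4/9 * (a1 q)^2"
  "\<Omega>1 \<Gamma> q $ 4 $ 3 = 2 * \<partial>\<^sub>x a0 q - 4 * a0 q * a1 q"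
  "\<Omega>1 \<Gamma> q $ 4 $ 4 = - 1/3 * a1 q"
  "\<Omega>1 \<Gamma> q $ 4 $ 5 = - 3 * a0 q"
  "\<Omega>1 \<Gamma> q $ 4 $ 6 = 0"
  "\<Omega>1 \<Gamma> q $ 5 $ 1 = 0"
  "\<Omega>1 \<Gamma> q $ 5 $ 2 = 0"
  "\<Omega>1 \<Gamma> q $ 5 $ 3 = 0"
  "\<Omega>1 \<Gamma> q $ 5 $ 4 = 0"
  "\<Omega>1 \<Gamma> q $ 5 $ 5 = 0"
  "\<Omega>1 \<Gamma> q $ 5 $ 6 = - 1"
  "\<Omega>1 \<Gamma> q $ 6 $ 1 = - 4/3 * \<partial>\<^sub>x (\<partial>\<^sub>y a2) q - 20/3 * a0 q *
      a2 q * a3 q + 2/3 * \<partial>\<^sub>y (\<partial>\<^sub>y a1) q + 4 * a3 q * \<partial>\<^sub>y a0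
      q - 2 * a0 q * \<partial>\<^sub>y a3 q - 16/9 * a2 q * \<partial>\<^sub>x a2 q + 8/9 * a2 q *
      \<partial>\<^sub>y a1 q"
  "\<Omega>1 \<Gamma> q $ 6 $ 2 = 2/3 * \<partial>\<^sub>x (\<partial>\<^sub>y a1) q - 4/3 * a1 q *
      \<partial>\<^sub>y a1 q + 2 * a0 q * \<partial>\<^sub>y a2 q - 2 * \<partial>\<^sub>y
      (\<partial>\<^sub>y a0) q + 4 * a2 q * \<partial>\<^sub>y a0 q + 4 * a3 q * \<partial>\<^sub>x a0 q
      + 6 * a0 q * \<partial>\<^sub>x a3 q + 8/9 * a1 q * \<partial>\<^sub>x a2 q + 4/3 * a0 q * a1 q * a3
      q - 4/3 * a0 q * (a2 q)^2"
  "\<Omega>1 \<Gamma> q $ 6 $ 3 = 2 * \<partial>\<^sub>x (\<partial>\<^sub>y a0) q + 2/3 * a0 q *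
      \<partial>\<^sub>x a2 q - 4/3 * a2 q * \<partial>\<^sub>x a0 q - 4 * a1 q * \<partial>\<^sub>y a0 q
      - 4/3 * a0 q * \<partial>\<^sub>y a1 q + 8/3 * a0 q * a1 q * a2 q + 4 * a3 q * (a0 q)^2"
  "\<Omega>1 \<Gamma> q $ 6 $ 4 = 4/3 * \<partial>\<^sub>x a2 q - \<partial>\<^sub>y a1 q + 5 * a0 q *
      a3 q"
  "\<Omega>1 \<Gamma> q $ 6 $ 5 = 1/3 * \<partial>\<^sub>x a1 q - 4 * \<partial>\<^sub>y a0 q + 3 * a2
      q * a0 q - 2/9 * (a1 q)^2"
  "\<Omega>1 \<Gamma> q $ 6 $ 6 = - 1/3 * a1 q"
  by (simp_all add: \<Omega>1_def Let_def)

lemma \<Omega>2_nth: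
  "\<Omega>2 \<Gamma> q $ 1 $ 1 = - 4/3 * a2 q"
  "\<Omega>2 \<Gamma> q $ 1 $ 2 = 2/3 * a1 q"
  "\<Omega>2 \<Gamma> q $ 1 $ 3 = 2 * a0 q"
  "\<Omega>2 \<Gamma> q $ 1 $ 4 = 1"
  "\<Omega>2 \<Gamma> q $ 1 $ 5 = 0"
  "\<Omega>2 \<Gamma> q $ 1 $ 6 = 0"
  "\<Omega>2 \<Gamma> q $ 2 $ 1 = 0"
  "\<Omega>2 \<Gamma> q $ 2 $ 2 = 0"
  "\<Omega>2 \<Gamma> q $ 2 $ 3 = 0"
  "\<Omega>2 \<Gamma> q $ 2 $ 4 = 0"
  "\<Omega>2 \<Gamma> q $ 2 $ 5 = - 1/2"
  "\<Omega>2 \<Gamma> q $ 2 $ 6 = 0"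
  "\<Omega>2 \<Gamma> q $ 3 $ 1 = 0"
  "\<Omega>2 \<Gamma> q $ 3 $ 2 = - 2 * a3 q"
  "\<Omega>2 \<Gamma> q $ 3 $ 3 = 2/3 * a2 q"
  "\<Omega>2 \<Gamma> q $ 3 $ 4 = 0"
  "\<Omega>2 \<Gamma> q $ 3 $ 5 = 0"
  "\<Omega>2 \<Gamma> q $ 3 $ 6 = 0"
  "\<Omega>2 \<Gamma> q $ 4 $ 1 = 0"
  "\<Omega>2 \<Gamma> q $ 4 $ 2 = 0"
  "\<Omega>2 \<Gamma> q $ 4 $ 3 = 0"
  "\<Omega>2 \<Gamma> q $ 4 $ 4 = 0"
  "\<Omega>2 \<Gamma> q $ 4 $ 5 = 0"
  "\<Omega>2 \<Gamma> q $ 4 $ 6 = - 1"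
  "\<Omega>2 \<Gamma> q $ 5 $ 1 = - 2 * \<partial>\<^sub>y a3 q - 4 * a3 q * a2 q"
  "\<Omega>2 \<Gamma> q $ 5 $ 2 = 2 * \<partial>\<^sub>x a3 q - 2/3 * \<partial>\<^sub>y a2 q + 4 * a1
      q * a3 q - 4/9 * (a2 q)^2"
  "\<Omega>2 \<Gamma> q $ 5 $ 3 = 4/3 * \<partial>\<^sub>y a1 q - 2/3 * \<partial>\<^sub>x a2 q + 4 *
      a0 q * a3 q"
  "\<Omega>2 \<Gamma> q $ 5 $ 4 = 3 * a3 q"
  "\<Omega>2 \<Gamma> q $ 5 $ 5 = 1/3 * a2 q"
  "\<Omega>2 \<Gamma> q $ 5 $ 6 = 0"
  "\<Omega>2 \<Gamma> q $ 6 $ 1 = - 2 * \<partial>\<^sub>x (\<partial>\<^sub>y a3) q - 4 * a2 q *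
      \<partial>\<^sub>x a3 q - 4/3 * a3 q * \<partial>\<^sub>x a2 q + 2/3 * a3 q * \<partial>\<^sub>y a1
      q - 4/3 * a1 q * \<partial>\<^sub>y a3 q - 4 * a0 q * (a3 q)^2 - 8/3 * a1 q * a2 q * a3 q"
  "\<Omega>2 \<Gamma> q $ 6 $ 2 = 2 * \<partial>\<^sub>x (\<partial>\<^sub>x a3) q - 4/3 * a2 q *
      \<partial>\<^sub>x a2 q - 4/3 * a0 q * a2 q * a3 q - 2/3 * \<partial>\<^sub>x (\<partial>\<^sub>y
      a2) q + 4 * a1 q * \<partial>\<^sub>x a3 q + 4 * a0 q * \<partial>\<^sub>y a3 q + 6 * a3 q *
      \<partial>\<^sub>y a0 q + 4/3 * a3 q * (a1 q)^2 + 2 * a3 q * \<partial>\<^sub>x a1 q + 8/9 * a2 q *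
      \<partial>\<^sub>y a1 q"
  "\<Omega>2 \<Gamma> q $ 6 $ 3 = - 2/3 * \<partial>\<^sub>x (\<partial>\<^sub>x a2) q + 8/9 * a1 q *
      \<partial>\<^sub>x a2 q + 4 * a0 q * \<partial>\<^sub>x a3 q - 2 * a3 q * \<partial>\<^sub>x a0 q -
      16/9 * a1 q * \<partial>\<^sub>y a1 q + 4/3 * \<partial>\<^sub>x (\<partial>\<^sub>y a1) q + 20/3 *
      a0 q * a1 q * a3 q"
  "\<Omega>2 \<Gamma> q $ 6 $ 4 = 4 * \<partial>\<^sub>x a3 q - 1/3 * \<partial>\<^sub>y a2 q + 3 * a1
      q * a3 q - 2/9 * (a2 q)^2"
  "\<Omega>2 \<Gamma> q $ 6 $ 5 = \<partial>\<^sub>x a2 q - 4/3 * \<partial>\<^sub>y a1 q + 5 * a0 q *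
      a3 q"
  "\<Omega>2 \<Gamma> q $ 6 $ 6 = 1/3 * a2 q"
  by (simp_all add: \<Omega>2_def Let_def)

lemma smooth_\<Omega>_entries [smooth]: "smooth_on U (\<lambda>q. \<Omega>1 \<Gamma> q $ i $ j)" "smooth_on U (\<lambda>q. \<Omega>2 \<Gamma> q $ i $ j)"
proof -
  have "\<forall>i j. smooth_on U (\<lambda>q. \<Omega>1 \<Gamma> q $ i $ j)" "\<forall>i j. smooth_on U (\<lambda>q. \<Omega>2 \<Gamma> q $ i $ j)"
    unfolding forall_6 \<Omega>1_nth \<Omega>2_nth by (intro conjI smooth open_U)+
  then show "smooth_on U (\<lambda>q. \<Omega>1 \<Gamma> q $ i $ j)" "smooth_on U (\<lambda>q. \<Omega>2 \<Gamma> q $ i $ j)" by blast+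
qed

lemma smooth_\<Omega>: "smooth_on U (\<Omega>1 \<Gamma>)" "smooth_on U (\<Omega>2 \<Gamma>)" "smooth_on U (\<lambda>q. \<Omega> a q)"
proof -
  show *: "smooth_on U (\<Omega>1 \<Gamma>)" "smooth_on U (\<Omega>2 \<Gamma>)"
    by (rule smooth_on_componentwise[OF open_U], rule smooth_on_componentwise[OF open_U], rule smooth_\<Omega>_entries)+
  then show "smooth_on U (\<lambda>q. \<Omega> a q)" by (cases "a = 1") auto
qed

text \<open>As rewrite rules these normalise mixed derivatives so that \<open>partial 2\<close> is
  applied first; the second rule treats the third-order derivatives that occur in
  \<open>V\<close>.\<close>

lemma partial_21:
  fixes f :: "real^2 \<Rightarrow> real"
  assumes "smooth_on U f"
  shows "q \<in> U \<Longrightarrow> partial 2 (partial 1 f) q = partial 1 (partial 2 f) q"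
    and "q \<in> U \<Longrightarrow> partial a (partial 2 (partial 1 f)) q = partial a (partial 1 (partial 2 f)) q"
  using partial_commute[OF open_U assms] partial_cong[OF open_U] by blast+

lemmas partial_simps = partial_add[OF open_U] partial_diff[OF open_U] partial_mult[OF open_U]
  partial_minus[OF open_U]

text \<open>Closure rules with openness of \<open>U\<close> discharged, so that the simplifier can
  use them to solve the side conditions of \<open>partial_simps\<close>.\<close>

lemma smooth_U:
  fixes f g :: "real^2 \<Rightarrow> real"
  shows "smooth_on U (\<lambda>q. c)"
    "smooth_on U f \<Longrightarrow> smooth_on U (partial a f)"
    "smooth_on U f \<Longrightarrow> smooth_on U g \<Longrightarrow> smooth_on U (\<lambda>q. f q + g q)"
    "smooth_on U f \<Longrightarrow> smooth_on U g \<Longrightarrow> smooth_on U (\<lambda>q. f q - g q)"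
    "smooth_on U f \<Longrightarrow> smooth_on U g \<Longrightarrow> smooth_on U (\<lambda>q. f q * g q)"
    "smooth_on U f \<Longrightarrow> smooth_on U (\<lambda>q. - f q)"
  by (intro smooth open_U; assumption)+

text \<open>Once derivatives are expanded and mixed partials sorted, every entry is a polynomial
  identity in the \<open>A\<close> coefficients and their derivatives. All rows cancel except the
  last.\<close>

lemma curvature_matrix:
  assumes q: "q \<in> U"
  shows "partial 1 (\<lambda>z. \<Omega>2 \<Gamma> z $ i $ j) q - partial 2 (\<lambda>z. \<Omega>1 \<Gamma> z $ i $ j) q
    + (\<Omega>1 \<Gamma> q ** \<Omega>2 \<Gamma> q) $ i $ j - (\<Omega>2 \<Gamma> q ** \<Omega>1 \<Gamma> q) $ i $ j = (if i = 6 then V q $ j else 0)"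
proof -
  have "\<forall>i j. partial 1 (\<lambda>z. \<Omega>2 \<Gamma> z $ i $ j) q - partial 2 (\<lambda>z. \<Omega>1 \<Gamma> z $ i $ j) q
    + (\<Sum>k\<in>UNIV. \<Omega>1 \<Gamma> q $ i $ k * \<Omega>2 \<Gamma> q $ k $ j) - (\<Sum>k\<in>UNIV. \<Omega>2 \<Gamma> q $ i $ k * \<Omega>1 \<Gamma> q $ k $ j)
      = (if i = 6 then V q $ j else 0)"
    unfolding forall_6 sum_6 \<Omega>1_nth \<Omega>2_nth V_row_def vector_6 L1_def[abs_def] L2_def[abs_def] power2_eq_square
    by (intro conjI;
        (simp only: partial_simps[OF q] partial_const partial_21 q smooth_U smooth_A
          mult_zero_left mult_zero_right add_0_left add_0_right diff_0_right diff_0 minus_zero mult_1_left mult_1_right)?;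
        simp add: algebra_simps)
  then show ?thesis by (simp add: matrix_matrix_mult_def)
qed

lemma curvature:
  assumes q: "q \<in> U"
  shows "partial 1 (\<Omega>2 \<Gamma>) q - partial 2 (\<Omega>1 \<Gamma>) q + \<Omega>1 \<Gamma> q ** \<Omega>2 \<Gamma> q - \<Omega>2 \<Gamma> q ** \<Omega>1 \<Gamma> q
    = (\<chi> i. if i = 6 then V q else 0)"
proof -
  have "partial b \<Omega>' q $ i $ j = partial b (\<lambda>z. \<Omega>' z $ i $ j) q" if "smooth_on U \<Omega>'" for \<Omega>' :: "real^2 \<Rightarrow> real^6^6" and b i j
    using that by (simp add: partial_nth[OF open_U q] smooth_on_nth[OF open_U])
  then show ?thesis
    using curvature_matrix[OF q] by (simp add: vec_eq_iff smooth_\<Omega>)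
qed

lemma partial_commute_vec:
  fixes f :: "real^2 \<Rightarrow> real^'n"
  assumes "smooth_on U f" "q \<in> U"
  shows "partial b (partial a f) q = partial a (partial b f) q"
proof -
  have "partial b (partial a f) q $ i = partial b (partial a (\<lambda>z. f z $ i)) q" for a b i
  proof -
    have "partial b (partial a (\<lambda>z. f z $ i)) q = partial b (\<lambda>z. partial a f z $ i) q"
      by (rule partial_cong[OF open_U assms(2)]) (rule partial_nth[OF open_U _ assms(1)])
    then show ?thesis
      using partial_nth[OF open_U assms(2) smooth_on_partial[OF assms(1)]] by simp
  qed
  then show ?thesis
    using partial_commute[OF open_U smooth_on_nth[OF open_U assms(1)] assms(2)] by (simp add: vec_eq_iff)
qed

lemma smooth_D: "smooth_on U W \<Longrightarrow> smooth_on U (D \<Gamma> a W)"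
  unfolding D_def[abs_def]
  by (intro smooth open_U smooth_on_bilinear[OF bounded_bilinear_vector_matrix] smooth_\<Omega>)

lemma D_cong:
  assumes "\<And>z. z \<in> N \<Longrightarrow> W z = W' z" "open N" "q \<in> N"
  shows "D \<Gamma> a W q = D \<Gamma> a W' q"
  using assms partial_cong[OF assms(2,3,1)] by (simp add: D_def)

text \<open>The second derivatives of \<open>W\<close> cancel in the commutator, which leaves minus
  the row \<open>W q\<close> times the curvature matrix. Only the sixth row of that matrix is
  nonzero, so only \<open>W q $ 6\<close> enters.\<close>

lemma D_commute:
  assumes W: "smooth_on U W" and q: "q \<in> U"
  shows "D \<Gamma> 1 (D \<Gamma> 2 W) q = D \<Gamma> 2 (D \<Gamma> 1 W) q - W q $ 6 *\<^sub>R V q"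
proof -
  note part = partial_bilinear[OF open_U q bounded_bilinear_vector_matrix W]
  have "D \<Gamma> 1 (D \<Gamma> 2 W) q = partial 1 (partial 2 W) q - (partial 1 W q v* \<Omega>2 \<Gamma> q + W q v* partial 1 (\<Omega>2 \<Gamma>) q)
      - (partial 2 W q - W q v* \<Omega>2 \<Gamma> q) v* \<Omega>1 \<Gamma> q"
    by (simp add: D_def[abs_def] part smooth_\<Omega> W smooth_on_partial
        partial_diff[OF open_U q] smooth_on_bilinear[OF bounded_bilinear_vector_matrix open_U])
  moreover have "D \<Gamma> 2 (D \<Gamma> 1 W) q = partial 2 (partial 1 W) q - (partial 2 W q v* \<Omega>1 \<Gamma> q + W q v* partial 2 (\<Omega>1 \<Gamma>) q)
      - (partial 1 W q - W q v* \<Omega>1 \<Gamma> q) v* \<Omega>2 \<Gamma> q"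
    by (simp add: D_def[abs_def] part smooth_\<Omega> W smooth_on_partial
        partial_diff[OF open_U q] smooth_on_bilinear[OF bounded_bilinear_vector_matrix open_U])
  ultimately have "D \<Gamma> 1 (D \<Gamma> 2 W) q - D \<Gamma> 2 (D \<Gamma> 1 W) q
      = - (W q v* (partial 1 (\<Omega>2 \<Gamma>) q - partial 2 (\<Omega>1 \<Gamma>) q + \<Omega>1 \<Gamma> q ** \<Omega>2 \<Gamma> q - \<Omega>2 \<Gamma> q ** \<Omega>1 \<Gamma> q))"
    using partial_commute_vec[OF W q, of 1 2]
    by (simp add: vector_matrix_mul_assoc vector_matrix_mult_diff_distrib vector_matrix_left_distrib
        vector_matrix_mult_add_rdistrib vector_matrix_mult_diff_rdistrib)
  also have "\<dots> = - (W q $ 6 *\<^sub>R V q)"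
    unfolding curvature[OF q] by (simp add: vec_eq_iff vector_matrix_mult_def sum_6 mult.commute)
  finally show ?thesis by (simp add: algebra_simps)
qed

text \<open>The connection dual to \<open>D\<close>: its sign is the one for which the pairing of
  rows and columns obeys the Leibniz rule, see \<open>partial_pairing\<close>.\<close>

definition cov :: "2 \<Rightarrow> (real^2 \<Rightarrow> real^6) \<Rightarrow> real^2 \<Rightarrow> real^6" where
  "cov a \<psi> q = partial a \<psi> q + \<Omega> a q *v \<psi> q"

lemma cov_cong:
  assumes "\<And>z. z \<in> N \<Longrightarrow> W z = W' z" "open N" "q \<in> N"
  shows "cov a W q = cov a W' q"
  using assms partial_cong[OF assms(2,3,1)] by (simp add: cov_def)

end

text \<open>The rows derived from \<open>V\<close> are smooth on all of \<open>U\<close>, whereas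
  the columns paired with them exist only locally; hence a second open set.\<close>

locale smooth_connection_on_subset = smooth_connection +
  fixes N assumes open_N: "open N" and N_subset: "N \<subseteq> U"
begin

lemma smooth_N: "smooth_on U f \<Longrightarrow> smooth_on N f"
  using N_subset by (rule smooth_on_subset[rotated])

lemma smooth_cov: "smooth_on N \<psi> \<Longrightarrow> smooth_on N (cov a \<psi>)"
  unfolding cov_def[abs_def]
  by (intro smooth open_N smooth_on_bilinear[OF bounded_bilinear_matrix_vector] smooth_N[OF smooth_\<Omega>(3)])

text \<open>The two matrix terms, one from \<open>D\<close> and one from \<open>cov\<close>, cancel
  by the adjointness of \<open>v*\<close> and \<open>*v\<close>.\<close>

lemma partial_pairing:
  assumes R: "smooth_on U R" and psi: "smooth_on N \<psi>" and q: "q \<in> N"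
  shows "partial a (\<lambda>z. R z \<bullet> \<psi> z) q = D \<Gamma> a R q \<bullet> \<psi> q + R q \<bullet> cov a \<psi> q"
  using partial_inner[OF open_N q smooth_N[OF R] psi]
  by (simp add: D_def cov_def inner_add_right inner_diff_left dot_lmul_matrix)

lemma cov_scaleR:
  assumes "smooth_on N f" "smooth_on N \<psi>" "q \<in> N"
  shows "cov a (\<lambda>z. f z *\<^sub>R \<psi> z) q = partial a f q *\<^sub>R \<psi> q + f q *\<^sub>R cov a \<psi> q"
  using partial_scaleR[OF open_N assms(3,1,2)] by (simp add: cov_def matrix_vector_mult_scaleR algebra_simps)

text \<open>On columns the commutator is multiplication by the curvature matrix, whose only nonzero
  row \<open>V\<close> contributes in the sixth component.\<close>

lemma cov_commute:
  assumes psi: "smooth_on N \<psi>" and q: "q \<in> N"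
  shows "cov 1 (cov 2 \<psi>) q = cov 2 (cov 1 \<psi>) q + (V q \<bullet> \<psi> q) *\<^sub>R axis 6 1"
proof -
  have qU: "q \<in> U" using q N_subset by blast
  \<comment> \<open>The section is smooth only on \<open>N\<close>, so the symmetry of its second
    derivatives is taken from the restricted connection.\<close>
  interpret N: smooth_connection N \<Gamma>
    using open_N torsion_free N_subset
    by unfold_locales (auto simp: torsion_free_connection_on_def intro: smooth_on_subset[OF _ N_subset])
  note part = partial_bilinear[OF open_N q bounded_bilinear_matrix_vector _ psi] 
  have "cov 1 (cov 2 \<psi>) q = partial 1 (partial 2 \<psi>) q + (partial 1 (\<Omega>2 \<Gamma>) q *v \<psi> q + \<Omega>2 \<Gamma> q *v partial 1 \<psi> q)
      + \<Omega>1 \<Gamma> q *v (partial 2 \<psi> q + \<Omega>2 \<Gamma> q *v \<psi> q)"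
    by (simp add: cov_def[abs_def] part smooth_N smooth_\<Omega> psi smooth_on_partial
        partial_add[OF open_N q] smooth_on_bilinear[OF bounded_bilinear_matrix_vector open_N])
  moreover have "cov 2 (cov 1 \<psi>) q = partial 2 (partial 1 \<psi>) q + (partial 2 (\<Omega>1 \<Gamma>) q *v \<psi> q + \<Omega>1 \<Gamma> q *v partial 2 \<psi> q)
      + \<Omega>2 \<Gamma> q *v (partial 1 \<psi> q + \<Omega>1 \<Gamma> q *v \<psi> q)"
    by (simp add: cov_def[abs_def] part smooth_N smooth_\<Omega> psi smooth_on_partial
        partial_add[OF open_N q] smooth_on_bilinear[OF bounded_bilinear_matrix_vector open_N])
  moreover have "(\<chi> i. if i = 6 then V q else 0) *v \<psi> q = (V q \<bullet> \<psi> q) *\<^sub>R axis 6 1"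
    by (simp add: vec_eq_iff matrix_vector_mul_component axis_def)
  ultimately show ?thesis
    using N.partial_commute_vec[OF psi q, of 1 2] arg_cong[OF curvature[OF qU], of "\<lambda>M. M *v \<psi> q"]
    by (simp add: matrix_vector_mul_assoc algebra_simps)
qed

end

section \<open>The metric defined by a parallel section\<close>

text \<open>The components \<open>2 1 2\<close> and \<open>1 1 2\<close> of the difference must be
  the two components of the one-form. Once these are used to define it, the remaining four
  components match because the four invariants agree.\<close>

lemma projective_classI:
  assumes "torsion_free_connection_on N \<Gamma>" "torsion_free_connection_on N \<Gamma>'"
    and A: "\<And>q. q \<in> N \<Longrightarrow> A0 \<Gamma>' q = A0 \<Gamma> q" "\<And>q. q \<in> N \<Longrightarrow> A1 \<Gamma>' q = A1 \<Gamma> q"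
      "\<And>q. q \<in> N \<Longrightarrow> A2 \<Gamma>' q = A2 \<Gamma> q" "\<And>q. q \<in> N \<Longrightarrow> A3 \<Gamma>' q = A3 \<Gamma> q"
  shows "\<Gamma>' \<in> projective_class N \<Gamma>"
proof -
  define \<omega> where "\<omega> a q = (if a = 1 then \<Gamma>' 2 1 2 q - \<Gamma> 2 1 2 q else \<Gamma>' 1 1 2 q - \<Gamma> 1 1 2 q)" for a :: 2 and q
  have sym: "\<Gamma> c 2 1 q = \<Gamma> c 1 2 q" "\<Gamma>' c 2 1 q = \<Gamma>' c 1 2 q" if "q \<in> N" for c q
    using assms(1,2) that unfolding torsion_free_connection_on_def by blast+
  have "\<forall>c a b. \<Gamma>' c a b q = \<Gamma> c a b q + of_bool (c = a) * \<omega> b q + of_bool (c = b) * \<omega> a q" if "q \<in> N" for q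
    using A[OF that] sym[OF that] unfolding forall_2 \<omega>_def A0_def A1_def A2_def A3_def by simp
  then show ?thesis unfolding projective_class_def using assms(2) by blast
qed

text \<open>\<open>matrix_inv\<close> is a choice of two-sided inverse; for square matrices a
  one-sided inverse already determines it.\<close>

lemma matrix_inv_eqI:
  fixes A B :: "real^'n^'n"
  assumes "A ** B = mat 1"
  shows "matrix_inv A = B"
proof -
  have "A ** matrix_inv A = mat 1 \<and> matrix_inv A ** A = mat 1"
    unfolding matrix_inv_def by (rule someI[of _ B]) (use assms matrix_left_right_inverse in blast)
  then show ?thesis
    by (metis assms matrix_mul_assoc matrix_mul_lid matrix_mul_rid)
qed

context smooth_connection_on_subset
begin

text \<open>The classical correspondence: \<open>\<psi>\<close> solves the linear system of Liouville iff the metric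
  \<open>(\<psi>\<^sub>1 dx\<^sup>2 + 2 \<psi>\<^sub>2 dx dy + \<psi>\<^sub>3 dy\<^sup>2) / (\<psi>\<^sub>1 \<psi>\<^sub>3 - \<psi>\<^sub>2\<^sup>2)\<^sup>2\<close> is compatible.\<close>

lemma parallel_section_metric:
  assumes psi: "smooth_on N \<psi>"
    and par: "\<And>a q. q \<in> N \<Longrightarrow> cov a \<psi> q = 0"
    and nondeg: "\<And>q. q \<in> N \<Longrightarrow> \<psi> q $ 1 * \<psi> q $ 3 - (\<psi> q $ 2)\<^sup>2 \<noteq> 0"
  shows "\<exists>g. metric_on N g \<and> levi_civita g \<in> projective_class N \<Gamma>"
proof -
  define \<Delta> where "\<Delta> q = \<psi> q $ 1 * \<psi> q $ 3 - \<psi> q $ 2 * \<psi> q $ 2" for q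
  define s where "s q = inverse (\<Delta> q)" for q
  \<comment> \<open>\<open>S\<close> is the symmetric matrix with entries taken from the first three
    components, and \<open>T\<close> is its adjugate, so their product is \<open>\<Delta>\<close>
    times the identity. Hence \<open>\<Delta>\<close> times \<open>T\<close> inverts
    \<open>S\<close> divided by the square of \<open>\<Delta>\<close>.\<close>
  define S where "S b d q = \<psi> q $ (if b = 1 \<and> d = 1 then 1 else if b = 2 \<and> d = 2 then 3 else 2)" for b d :: 2 and q
  define T where "T b d q = (if b = 1 \<and> d = 1 then \<psi> q $ 3 else if b = 2 \<and> d = 2 then \<psi> q $ 1 else - \<psi> q $ 2)" for b d :: 2 and q
  define g :: "real^2 \<Rightarrow> real^2^2" where "g q = (\<chi> b d. s q * s q * S b d q)" for q
  define h :: "real^2 \<Rightarrow> real^2^2" where "h q = (\<chi> b d. \<Delta> q * T b d q)" for q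
  have \<Delta>: "\<Delta> q \<noteq> 0" if "q \<in> N" for q using nondeg[OF that] by (simp add: \<Delta>_def power2_eq_square)
  have sD: "s q * \<Delta> q = 1" if "q \<in> N" for q using \<Delta>[OF that] by (simp add: s_def)
  have psi_i: "smooth_on N (\<lambda>q. \<psi> q $ i)" for i by (intro smooth open_N psi)
  have sm: "smooth_on N \<Delta>" "smooth_on N s" "smooth_on N (S b d)" "smooth_on N (T b d)" for b d
  proof -
    show *: "smooth_on N \<Delta>" unfolding \<Delta>_def[abs_def] by (intro smooth open_N psi)
    show "smooth_on N s" unfolding s_def[abs_def] by (intro smooth open_N * \<Delta>)
    show "smooth_on N (S b d)" unfolding S_def[abs_def] by (intro smooth open_N psi)
    show "smooth_on N (T b d)" unfolding T_def[abs_def]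
      by (cases "b = 1 \<and> d = 1"; cases "b = 2 \<and> d = 2") (auto intro!: smooth open_N psi)
  qed
  have g_nth: "(\<lambda>q. g q $ b $ d) = (\<lambda>q. s q * s q * S b d q)" for b d by (simp add: g_def)
  have sm_g: "smooth_on N (\<lambda>q. g q $ b $ d)" for b d
    unfolding g_nth by (intro smooth open_N sm)
  have metric: "metric_on N g"
    unfolding metric_on_def
  proof (intro conjI ballI)
    show "smooth_on N g"
      by (rule smooth_on_componentwise[OF open_N], rule smooth_on_componentwise[OF open_N], rule sm_g)
    fix q assume q: "q \<in> N"
    show "transpose (g q) = g q"
      unfolding vec_eq_iff[of _ "g q"] vec_eq_iff[of _ "g q $ _"] forall_2 by (simp add: transpose_def g_def S_def)
    have "det (g q) = (s q * s q) * (s q * s q) * \<Delta> q"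
      by (simp add: det_2 g_def S_def \<Delta>_def algebra_simps)
    then show "det (g q) \<noteq> 0" using \<Delta>[OF q] by (simp add: s_def)
  qed
  have inv: "matrix_inv (g q) = h q" if q: "q \<in> N" for q
  proof (rule matrix_inv_eqI)
    have "(s q * s q * \<Delta> q) * \<Delta> q = 1" using sD[OF q] by (simp add: mult.assoc)
    then have "s q * s q * \<Delta> q * (\<psi> q $ 1 * \<psi> q $ 3 - \<psi> q $ 2 * \<psi> q $ 2) = 1" by (simp add: \<Delta>_def)
    then show "g q ** h q = mat 1"
      unfolding vec_eq_iff[of _ "mat 1"] vec_eq_iff[of _ "mat 1 $ _"] forall_2
      by (simp add: matrix_matrix_mult_def sum_2 g_def h_def S_def T_def mat_def algebra_simps)
  qed
  have LC: "levi_civita g c a b q = 1/2 * (\<Sum>d\<in>UNIV. \<Delta> q * T c d q *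
       (partial a (\<lambda>z. g z $ b $ d) q + partial b (\<lambda>z. g z $ a $ d) q - partial d (\<lambda>z. g z $ a $ b) q))"
    if "q \<in> N" for c a b q
    by (simp add: levi_civita_def inv[OF that] h_def)
  have tf: "torsion_free_connection_on N (levi_civita g)"
    unfolding torsion_free_connection_on_def
  proof (intro conjI allI ballI)
    fix c a b
    have "smooth_on N (\<lambda>q. 1/2 * (\<Sum>d\<in>UNIV. \<Delta> q * T c d q *
       (partial a (\<lambda>z. g z $ b $ d) q + partial b (\<lambda>z. g z $ a $ d) q - partial d (\<lambda>z. g z $ a $ b) q)))"
      by (intro smooth open_N sm smooth_on_partial[OF sm_g])
    then show "smooth_on N (levi_civita g c a b)"
      by (subst smooth_on_cong[OF open_N, OF LC[of _ c a b]])
    fix q assume "q \<in> N"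
    have gs: "g z $ a' $ b' = g z $ b' $ a'" for z a' b' by (simp add: g_def S_def)
    show "levi_civita g c a b q = levi_civita g c b a q"
      unfolding levi_civita_def gs[of _ a b] by (simp add: add.commute)
  qed
  have dg: "partial a (\<lambda>z. g z $ b $ d) q
      = s q * s q * s q * (\<Delta> q * partial a (S b d) q - 2 * partial a \<Delta> q * S b d q)" if q: "q \<in> N" for a b d q
  proof -
    have ds: "partial a s q = - partial a \<Delta> q * (s q)\<^sup>2"
      unfolding s_def[abs_def] by (rule partial_inverse[OF open_N q sm(1) \<Delta>[OF q]])
    have "partial a (\<lambda>z. g z $ b $ d) q = (partial a s q * s q + s q * partial a s q) * S b d q + s q * s q * partial a (S b d) q"
      unfolding g_nth by (simp add: partial_mult[OF open_N q] sm smooth_on_mult[OF open_N])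
    \<comment> \<open>The factor \<open>s q * \<Delta> q\<close>, which equals one, is inserted so
      that both terms share the cube of \<open>s q\<close>.\<close>
    also have "\<dots> = s q * s q * (s q * \<Delta> q) * partial a (S b d) q - 2 * s q * s q * s q * partial a \<Delta> q * S b d q"
      unfolding ds sD[OF q] by (simp add: power2_eq_square algebra_simps)
    finally show ?thesis by (simp add: algebra_simps)
  qed
  have LC': "levi_civita g c a b q = 1/2 * (s q * s q) * (\<Sum>d\<in>UNIV. T c d q *
       ((\<Delta> q * partial a (S b d) q - 2 * partial a \<Delta> q * S b d q)
      + (\<Delta> q * partial b (S a d) q - 2 * partial b \<Delta> q * S a d q)
      - (\<Delta> q * partial d (S a b) q - 2 * partial d \<Delta> q * S a b q)))" (is "_ = 1/2 * _ * ?sum")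
    if q: "q \<in> N" for c a b q
  proof -
    have "levi_civita g c a b q = 1/2 * (s q * s q) * (s q * \<Delta> q) * ?sum"
      unfolding LC[OF q] dg[OF q] sum_2 by (simp add: algebra_simps)
    then show ?thesis unfolding sD[OF q] by simp
  qed
  have "levi_civita g \<in> projective_class N \<Gamma>"
  proof (rule projective_classI[OF _ tf])
    show "torsion_free_connection_on N \<Gamma>"
      using torsion_free N_subset by (auto simp: torsion_free_connection_on_def intro: smooth_on_subset[OF _ N_subset])
    fix q assume q: "q \<in> N"
    have d\<Delta>: "partial a \<Delta> q = partial a \<psi> q $ 1 * \<psi> q $ 3 + \<psi> q $ 1 * partial a \<psi> q $ 3 - 2 * \<psi> q $ 2 * partial a \<psi> q $ 2" for a
      unfolding \<Delta>_def[abs_def]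
      by (simp add: partial_diff[OF open_N q] partial_mult[OF open_N q] partial_nth[OF open_N q psi] psi_i smooth_on_mult[OF open_N])
    have dS: "partial a (S b d) q = partial a \<psi> q $ (if b = 1 \<and> d = 1 then 1 else if b = 2 \<and> d = 2 then 3 else 2)" for a b d
      unfolding S_def[abs_def] by (rule partial_nth[OF open_N q psi])
    have "partial 1 \<psi> q $ i = - (\<Omega>1 \<Gamma> q *v \<psi> q) $ i" "partial 2 \<psi> q $ i = - (\<Omega>2 \<Gamma> q *v \<psi> q) $ i" for i
      using par[OF q, of 1] par[OF q, of 2] unfolding cov_def by (auto simp: vec_eq_iff eq_neg_iff_add_eq_0)
    \<comment> \<open>These are the derivatives that enter the Christoffel symbols. The terms in
      \<open>\<psi> q $ 4\<close> and \<open>\<psi> q $ 5\<close> cancel in the four projective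
      invariants.\<close>
    then have d\<psi>:
      "partial 1 \<psi> q $ 1 = 2/3 * a1 q * \<psi> q $ 1 - 2 * a0 q * \<psi> q $ 2"
      "partial 1 \<psi> q $ 2 = 1/2 * \<psi> q $ 4"
      "partial 1 \<psi> q $ 3 = 2 * a3 q * \<psi> q $ 1 + 2/3 * a2 q * \<psi> q $ 2 - 4/3 * a1 q * \<psi> q $ 3 - \<psi> q $ 5"
      "partial 2 \<psi> q $ 1 = 4/3 * a2 q * \<psi> q $ 1 - 2/3 * a1 q * \<psi> q $ 2 - 2 * a0 q * \<psi> q $ 3 - \<psi> q $ 4"
      "partial 2 \<psi> q $ 2 = 1/2 * \<psi> q $ 5"
      "partial 2 \<psi> q $ 3 = 2 * a3 q * \<psi> q $ 2 - 2/3 * a2 q * \<psi> q $ 3"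
      by (simp_all add: matrix_vector_mult_def sum_6 \<Omega>1_nth \<Omega>2_nth)
    have ss: "s q * s q * (\<Delta> q * \<Delta> q) = 1" proof -
      have "s q * s q * (\<Delta> q * \<Delta> q) = (s q * \<Delta> q) * (s q * \<Delta> q)" by (simp only: ac_simps)
      then show ?thesis unfolding sD[OF q] by simp
    qed
    have LC2: "\<Delta> q * \<Delta> q * levi_civita g c a b q = 1/2 * (\<Sum>d\<in>UNIV. T c d q *
       ((\<Delta> q * partial a (S b d) q - 2 * partial a \<Delta> q * S b d q)
      + (\<Delta> q * partial b (S a d) q - 2 * partial b \<Delta> q * S a d q)
      - (\<Delta> q * partial d (S a b) q - 2 * partial d \<Delta> q * S a b q)))" (is "_ = 1/2 * ?sum") for c a b
    proof -
      have "\<Delta> q * \<Delta> q * levi_civita g c a b q = (s q * s q * (\<Delta> q * \<Delta> q)) * (1/2 * ?sum)"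
        unfolding LC'[OF q] by (simp only: ac_simps)
      then show ?thesis unfolding ss by simp
    qed
    \<comment> \<open>Multiplying by the square of \<open>\<Delta> q\<close> clears denominators,
      which makes each of the four comparisons a polynomial identity.\<close>
    have cancel: "x = y" if "\<Delta> q * \<Delta> q * x = \<Delta> q * \<Delta> q * y" for x y
      using that \<Delta>[OF q] by simp
    note expand = sum_2 d\<Delta> dS T_def S_def \<Delta>_def
    show "A0 (levi_civita g) q = A0 \<Gamma> q"
    proof (rule cancel)
      have "\<Delta> q * \<Delta> q * A0 (levi_civita g) q = - (\<Delta> q * \<Delta> q * levi_civita g 2 1 1 q)"
        by (simp add: A0_def)
      also have "\<dots> = \<Delta> q * \<Delta> q * a0 q"
        unfolding LC2 unfolding expand by (simp add: d\<psi> algebra_simps)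
      finally show "\<Delta> q * \<Delta> q * A0 (levi_civita g) q = \<Delta> q * \<Delta> q * a0 q" .
    qed
    show "A1 (levi_civita g) q = A1 \<Gamma> q"
    proof (rule cancel)
      have "\<Delta> q * \<Delta> q * A1 (levi_civita g) q = \<Delta> q * \<Delta> q * levi_civita g 1 1 1 q - 2 * (\<Delta> q * \<Delta> q * levi_civita g 2 1 2 q)"
        by (simp add: A1_def algebra_simps)
      also have "\<dots> = \<Delta> q * \<Delta> q * a1 q"
        unfolding LC2 unfolding expand by (simp add: d\<psi> algebra_simps)
      finally show "\<Delta> q * \<Delta> q * A1 (levi_civita g) q = \<Delta> q * \<Delta> q * a1 q" .
    qed
    show "A2 (levi_civita g) q = A2 \<Gamma> q"
    proof (rule cancel)
      have "\<Delta> q * \<Delta> q * A2 (levi_civita g) q = 2 * (\<Delta> q * \<Delta> q * levi_civita g 1 1 2 q) - \<Delta> q * \<Delta> q * levi_civita g 2 2 2 q"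
        by (simp add: A2_def algebra_simps)
      also have "\<dots> = \<Delta> q * \<Delta> q * a2 q"
        unfolding LC2 unfolding expand by (simp add: d\<psi> algebra_simps)
      finally show "\<Delta> q * \<Delta> q * A2 (levi_civita g) q = \<Delta> q * \<Delta> q * a2 q" .
    qed
    show "A3 (levi_civita g) q = A3 \<Gamma> q"
    proof (rule cancel)
      have "\<Delta> q * \<Delta> q * A3 (levi_civita g) q = \<Delta> q * \<Delta> q * levi_civita g 1 2 2 q"
        by (simp add: A3_def)
      also have "\<dots> = \<Delta> q * \<Delta> q * a3 q"
        unfolding LC2 unfolding expand by (simp add: d\<psi> algebra_simps)
      finally show "\<Delta> q * \<Delta> q * A3 (levi_civita g) q = \<Delta> q * \<Delta> q * a3 q" .
    qed
  qed
  with metric show ?thesis by blast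
qed

end

section \<open>A kernel section and the third-order obstruction\<close>

locale kernel_section = smooth_connection_on_subset +
  fixes W :: "real^2 \<Rightarrow> real^6"
  assumes smooth_W: "smooth_on N W"
    and W_nonzero: "\<And>q. q \<in> N \<Longrightarrow> W q \<noteq> 0"
    and kernel: "\<And>q. q \<in> N \<Longrightarrow> {v. M_mat \<Gamma> q *v v = 0} = span {W q}"
begin

lemma in_U: "q \<in> N \<Longrightarrow> q \<in> U"
  using N_subset by blast

text \<open>The curvature term in \<open>D_commute\<close> carries the sixth component of
  \<open>V\<close> as its coefficient, and that component is zero.\<close>

lemma DV_commute: "q \<in> U \<Longrightarrow> D \<Gamma> 1 (D \<Gamma> 2 V) q = D \<Gamma> 2 (D \<Gamma> 1 V) q"
  using D_commute[OF smooth_V] by (simp add: V_row_def)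

lemma DV_commute': "q \<in> U \<Longrightarrow> D \<Gamma> a (D \<Gamma> b V) q = D \<Gamma> b (D \<Gamma> a V) q"
  using DV_commute exhaust_2[of a] exhaust_2[of b] by auto

lemma DD_sym_eq: "q \<in> U \<Longrightarrow> DD_sym \<Gamma> a b q = D \<Gamma> a (D \<Gamma> b V) q"
  unfolding DD_sym_def DV_commute'[of q a b] by (simp flip: scaleR_2)

lemma M_kernel_iff:
  assumes "q \<in> U"
  shows "M_mat \<Gamma> q *v v = 0 \<longleftrightarrow> V q \<bullet> v = 0 \<and> (\<forall>a. D \<Gamma> a V q \<bullet> v = 0) \<and> (\<forall>a b. D \<Gamma> a (D \<Gamma> b V) q \<bullet> v = 0)"
  unfolding matrix_vector_zero_iff forall_6 forall_2 M_mat_def vector_6 DD_sym_eq[OF assms]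
  using DV_commute[OF assms] by auto

lemma M_W: "q \<in> N \<Longrightarrow> M_mat \<Gamma> q *v W q = 0"
  using kernel[of q] span_base[of "W q" "{W q}"] by blast

lemma orthogonal_W:
  assumes "q \<in> N"
  shows "V q \<bullet> W q = 0" "D \<Gamma> a V q \<bullet> W q = 0" "D \<Gamma> a (D \<Gamma> b V) q \<bullet> W q = 0"
    "DD_sym \<Gamma> a b q \<bullet> W q = 0"
  using M_W[OF assms] M_kernel_iff[OF in_U[OF assms]] DD_sym_eq[OF in_U[OF assms]] by auto

text \<open>The pairing vanishes throughout the open set \<open>N\<close>, so its derivative does
  too, and the Leibniz rule moves the derivative from \<open>R\<close> to \<open>W\<close>.\<close>

lemma D_inner_W:
  assumes R: "smooth_on U R" and "\<And>z. z \<in> N \<Longrightarrow> R z \<bullet> W z = 0" and q: "q \<in> N"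
  shows "D \<Gamma> a R q \<bullet> W q = - (R q \<bullet> cov a W q)"
proof -
  have "partial a (\<lambda>z. R z \<bullet> W z) q = partial a (\<lambda>z. 0) q"
    by (rule partial_cong[OF open_N q assms(2)])
  then show ?thesis using partial_pairing[OF R smooth_W q] by (simp add: partial_const)
qed

text \<open>\<open>W\<close> is orthogonal to the rows of order up to two; moving one derivative
  onto \<open>W\<close> leaves orthogonality to those of order up to one.\<close>

lemma first_order_cov:
  assumes "q \<in> N"
  shows "V q \<bullet> cov a W q = 0" "D \<Gamma> b V q \<bullet> cov a W q = 0"
  using D_inner_W[OF smooth_V orthogonal_W(1) assms, of a] orthogonal_W[OF assms]
    D_inner_W[OF smooth_D[OF smooth_V] orthogonal_W(2) assms, of a b] by auto

definition obstruction :: "2 \<Rightarrow> 2 \<Rightarrow> 2 \<Rightarrow> real^2 \<Rightarrow> real" where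
  "obstruction a b c q = D \<Gamma> a (D \<Gamma> b (D \<Gamma> c V)) q \<bullet> W q"

lemma obstruction_cov:
  assumes "q \<in> N"
  shows "obstruction a b c q = - (DD_sym \<Gamma> b c q \<bullet> cov a W q)"
  unfolding obstruction_def DD_sym_eq[OF in_U[OF assms]]
  by (rule D_inner_W[OF _ _ assms]) (auto intro: smooth_D smooth_V orthogonal_W)

text \<open>The inner two indices commute because the derivatives of \<open>V\<close> do so near
  \<open>q\<close>. Exchanging the outer two produces a multiple of \<open>V\<close>, which
  \<open>W\<close> annihilates.\<close>

lemma obstruction_commute:
  assumes q: "q \<in> N"
  shows "obstruction a b c q = obstruction a c b q" "obstruction a b c q = obstruction b a c q"
proof -
  show "obstruction a b c q = obstruction a c b q"
    unfolding obstruction_def using D_cong[where a = a, OF DV_commute'[of _ b c] open_U in_U[OF q]] by simp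
  have "obstruction 1 2 c q = obstruction 2 1 c q" for c
    using D_commute[OF smooth_D[OF smooth_V] in_U[OF q]] orthogonal_W(1)[OF q]
    by (simp add: obstruction_def inner_diff_left)
  then show "obstruction a b c q = obstruction b a c q"
    using exhaust_2[of a] exhaust_2[of b] by auto
qed

lemma DDD_sym_inner:
  assumes q: "q \<in> N"
  shows "DDD_sym \<Gamma> a b c q \<bullet> W q = obstruction a b c q"
proof -
  note comm = obstruction_commute[OF q]
  have "obstruction a c b q = obstruction a b c q" "obstruction b a c q = obstruction a b c q"
    by (rule comm)+
  moreover have "obstruction b c a q = obstruction b a c q" "obstruction c a b q = obstruction a c b q"
    by (rule comm)+
  moreover have "obstruction c b a q = obstruction c a b q"
    by (rule comm)
  ultimately show ?thesis
    unfolding DDD_sym_def by (simp add: inner_add_left flip: obstruction_def)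
qed

definition unobstructed :: "real^2 \<Rightarrow> bool" where
  "unobstructed q \<longleftrightarrow> obstruction 1 1 1 q = 0 \<and> obstruction 1 1 2 q = 0 \<and> obstruction 1 2 2 q = 0 \<and> obstruction 2 2 2 q = 0"

lemma unobstructed_iff:
  assumes "q \<in> N"
  shows "unobstructed q \<longleftrightarrow> (\<forall>a b c. obstruction a b c q = 0)"
  unfolding unobstructed_def forall_2
  using obstruction_commute(1)[OF assms, of 1 1 2] obstruction_commute(1)[OF assms, of 2 1 2]
    obstruction_commute(2)[OF assms, of 1 2 1] obstruction_commute(2)[OF assms, of 1 2 2] by auto

lemma M10_kernel_iff: "M_mat10 \<Gamma> q *v v = 0 \<longleftrightarrow> M_mat \<Gamma> q *v v = 0 \<and> DDD_sym \<Gamma> 1 1 1 q \<bullet> v = 0 \<and>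
    DDD_sym \<Gamma> 1 1 2 q \<bullet> v = 0 \<and> DDD_sym \<Gamma> 1 2 2 q \<bullet> v = 0 \<and> DDD_sym \<Gamma> 2 2 2 q \<bullet> v = 0"
  unfolding matrix_vector_zero_iff forall_6 forall_10 M_mat_def M_mat10_def vector_6 vector_10 by blast

text \<open>The four extra rows can only shrink the kernel, which is the line through
  \<open>W q\<close>. So the rank is five or six, and it is five exactly if these rows annihilate
  \<open>W q\<close>.\<close>

lemma rank_M10_iff:
  assumes q: "q \<in> N"
  shows "rank (M_mat10 \<Gamma> q) = 5 \<longleftrightarrow> unobstructed q"
proof -
  have "rank (M_mat10 \<Gamma> q) \<ge> 5"
    using kernel[OF q] by (intro rank_ge_5_of_kernel[of _ "W q"]) (auto simp: M10_kernel_iff)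
  moreover have "rank (M_mat10 \<Gamma> q) \<le> 6"
    using rank_bound[of "M_mat10 \<Gamma> q"] by simp
  moreover have "rank (M_mat10 \<Gamma> q) \<noteq> 6 \<longleftrightarrow> M_mat10 \<Gamma> q *v W q = 0"
  proof -
    have "M_mat10 \<Gamma> q *v W q = 0" if x: "x \<noteq> 0" "M_mat10 \<Gamma> q *v x = 0" for x
    proof -
      obtain k where k: "x = k *\<^sub>R W q"
        using x(2) kernel[OF q] by (auto simp: M10_kernel_iff span_singleton)
      then have "k \<noteq> 0" using x(1) by auto
      then show ?thesis using x(2) by (simp add: k matrix_vector_mult_scaleR)
    qed
    then show ?thesis
      using matrix_nonfull_linear_equations_eq[of "M_mat10 \<Gamma> q"] W_nonzero[OF q] by auto
  qed
  moreover have "M_mat10 \<Gamma> q *v W q = 0 \<longleftrightarrow> unobstructed q"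
    unfolding M10_kernel_iff unobstructed_def by (simp add: DDD_sym_inner[OF q] M_W[OF q])
  ultimately show ?thesis by linarith
qed

text \<open>Without obstructions \<open>cov a W\<close> lies in the kernel of \<open>M_mat\<close>,
  hence \<open>W\<close> is parallel up to scale, and on a ball the scale can be integrated.\<close>

lemma unobstructed_imp_metric:
  assumes ball: "N = ball p r"
    and nondeg: "\<And>q. q \<in> N \<Longrightarrow> W q $ 1 * W q $ 3 - (W q $ 2)\<^sup>2 \<noteq> 0"
    and unob: "\<And>q. q \<in> N \<Longrightarrow> unobstructed q"
  shows "\<exists>g. metric_on N g \<and> levi_civita g \<in> projective_class N \<Gamma>"
proof -
  \<comment> \<open>The proportionality factor is written as a projection onto \<open>W\<close>, so
    that it is smooth before proportionality is known.\<close>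
  define l where "l a q = (cov a W q \<bullet> W q) * inverse (W q \<bullet> W q)" for a q
  have sm_l: "smooth_on N (l a)" for a
    unfolding l_def[abs_def] using W_nonzero by (intro smooth open_N smooth_cov smooth_W) auto
  have cov_l: "cov a W q = l a q *\<^sub>R W q" if q: "q \<in> N" for a q
  proof -
    have "DD_sym \<Gamma> b c q \<bullet> cov a W q = 0" for b c
      using obstruction_cov[OF q, of a b c] unob[OF q] unobstructed_iff[OF q] by simp
    then have "M_mat \<Gamma> q *v cov a W q = 0"
      using M_kernel_iff[OF in_U[OF q]] first_order_cov[OF q] DD_sym_eq[OF in_U[OF q]] by simp
    then have "cov a W q \<in> span {W q}" using kernel[OF q] by blast
    then obtain k where "cov a W q = k *\<^sub>R W q" by (auto simp: span_singleton)
    then show ?thesis using W_nonzero[OF q] by (simp add: l_def)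
  qed
  have "partial 1 (l 2) q = partial 2 (l 1) q" if q: "q \<in> N" for q
  proof -
    have cc: "cov b (cov a W) q = (partial b (l a) q + l a q * l b q) *\<^sub>R W q" for a b
    proof -
      have "cov b (cov a W) q = cov b (\<lambda>z. l a z *\<^sub>R W z) q"
        by (rule cov_cong[OF cov_l open_N q])
      then show ?thesis
        using cov_scaleR[OF sm_l smooth_W q] cov_l[OF q] by (simp add: scaleR_add_left)
    qed
    \<comment> \<open>The curvature term of \<open>cov_commute\<close> vanishes because
      \<open>V\<close> annihilates \<open>W\<close>; the products of the \<open>l\<close> then
      cancel.\<close>
    then have "(partial 1 (l 2) q + l 2 q * l 1 q) *\<^sub>R W q = (partial 2 (l 1) q + l 1 q * l 2 q) *\<^sub>R W q"
      using cov_commute[OF smooth_W q] orthogonal_W(1)[OF q] by simp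
    then show ?thesis using W_nonzero[OF q] by simp
  qed
  then have closed: "partial a (l b) q = partial b (l a) q" if "q \<in> ball p r" for a b q
    using that exhaust_2[of a] exhaust_2[of b] ball by auto
  obtain h where h: "smooth_on N h" "\<And>a q. q \<in> N \<Longrightarrow> partial a h q = l a q"
    using closed_form_exact_on_ball[OF _ closed] sm_l unfolding ball by metis
  \<comment> \<open>The derivative of \<open>f\<close> contributes \<open>- l a q\<close> and so
    compensates the factor in \<open>cov a W\<close>.\<close>
  define f where "f q = exp (- h q)" for q
  have f: "smooth_on N f" "\<And>a q. q \<in> N \<Longrightarrow> partial a f q = - l a q * f q"
  proof -
    have mh: "smooth_on N (\<lambda>q. - h q)" by (intro smooth open_N h)
    show "smooth_on N f" unfolding f_def[abs_def] by (rule smooth_on_exp(1)[OF open_N mh])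
    show "partial a f q = - l a q * f q" if "q \<in> N" for a q
      unfolding f_def[abs_def] smooth_on_exp(2)[OF open_N mh that] partial_minus[OF open_N that h(1)] h(2)[OF that] ..
  qed
  show ?thesis
  proof (rule parallel_section_metric)
    show "smooth_on N (\<lambda>q. f q *\<^sub>R W q)" by (intro smooth open_N f smooth_W)
    fix q assume q: "q \<in> N"
    show "cov a (\<lambda>q. f q *\<^sub>R W q) q = 0" for a
      using cov_scaleR[OF f(1) smooth_W q] f(2)[OF q] cov_l[OF q] by simp
    have "(f q *\<^sub>R W q) $ 1 * (f q *\<^sub>R W q) $ 3 - ((f q *\<^sub>R W q) $ 2)\<^sup>2 = (f q)\<^sup>2 * (W q $ 1 * W q $ 3 - (W q $ 2)\<^sup>2)"
      by (simp add: power2_eq_square algebra_simps)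
    then show "(f q *\<^sub>R W q) $ 1 * (f q *\<^sub>R W q) $ 3 - ((f q *\<^sub>R W q) $ 2)\<^sup>2 \<noteq> 0"
      using nondeg[OF q] by (simp add: f_def)
  qed
qed

subsection \<open>Admissible choices\<close>

text \<open>At points of \<open>N\<close>, nonvanishing of \<open>G\<close> means independence of
  the five chosen rows, by \<open>hyperplane_independent_iff\<close>.\<close>

definition G :: "second_order_choice \<Rightarrow> real^2 \<Rightarrow> real" where
  "G s q = det (vector (chosen_rows \<Gamma> s q @ [W q]) :: real^6^6)"

lemma G_eq:
  "det (vector [V q, D \<Gamma> 1 V q, D \<Gamma> 2 V q, DD_sym \<Gamma> 1 1 q, DD_sym \<Gamma> 2 2 q, W q] :: real^6^6) = G XX_YY q"
  "det (vector [V q, D \<Gamma> 1 V q, D \<Gamma> 2 V q, DD_sym \<Gamma> 1 1 q, DD_sym \<Gamma> 1 2 q, W q] :: real^6^6) = G XX_XY q"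
  "det (vector [V q, D \<Gamma> 1 V q, D \<Gamma> 2 V q, DD_sym \<Gamma> 1 2 q, DD_sym \<Gamma> 2 2 q, W q] :: real^6^6) = G XY_YY q"
  by (simp_all add: G_def)

text \<open>Independent chosen rows span the whole hyperplane orthogonal to \<open>W q\<close>, so
  the remaining second-order row is in their span. For \<open>XX_YY\<close>, Cramer's rule gives
  \<open>c4\<close> and \<open>c5\<close> as the ratios of \<open>G XY_YY q\<close> and
  \<open>G XX_XY q\<close> to \<open>G XX_YY q\<close>.\<close>

lemma admissible_iff:
  assumes q: "q \<in> N"
  shows "admissible \<Gamma> s q \<longleftrightarrow> G s q \<noteq> 0 \<and> (s = XX_YY \<longrightarrow> G XY_YY q * G XX_XY q \<noteq> G XX_YY q * G XX_YY q)"
proof -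
  note ortho = orthogonal_W[OF q]
  have span5: "x \<in> span (set xs)" if "x = c1 *\<^sub>R r1 + c2 *\<^sub>R r2 + c3 *\<^sub>R r3 + c4 *\<^sub>R r4 + c5 *\<^sub>R r5"
    "set [r1, r2, r3, r4, r5] \<subseteq> set xs"
    for x r1 r2 r3 r4 r5 :: "real^6" and c1 c2 c3 c4 c5 and xs
    unfolding that(1) using that(2) by (intro span_add span_scale span_base) auto
  note indep = hyperplane_independent_iff[OF W_nonzero[OF q] ortho(1,2,2,4,4)]
  note spn = hyperplane_span[OF W_nonzero[OF q] ortho(1,2,2,4,4) _ ortho(4)]
  show ?thesis
  proof (cases s)
    case XX_YY
    have "(\<exists>c1 c2 c3 c4 c5 :: real.
        DD_sym \<Gamma> 1 2 q = c1 *\<^sub>R V q + c2 *\<^sub>R D \<Gamma> 1 V q + c3 *\<^sub>R D \<Gamma> 2 V q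
          + c4 *\<^sub>R DD_sym \<Gamma> 1 1 q + c5 *\<^sub>R DD_sym \<Gamma> 2 2 q \<and> c4 * c5 \<noteq> 1)
      \<longleftrightarrow> G XY_YY q * G XX_XY q \<noteq> G XX_YY q * G XX_YY q" if G: "G XX_YY q \<noteq> 0"
    proof -
      have *: "G XY_YY q * G XX_XY q \<noteq> G XX_YY q * G XX_YY q \<longleftrightarrow> c4 * c5 \<noteq> 1"
        if "DD_sym \<Gamma> 1 2 q = c1 *\<^sub>R V q + c2 *\<^sub>R D \<Gamma> 1 V q + c3 *\<^sub>R D \<Gamma> 2 V q
          + c4 *\<^sub>R DD_sym \<Gamma> 1 1 q + c5 *\<^sub>R DD_sym \<Gamma> 2 2 q" for c1 c2 c3 c4 c5
        using det_cramer[OF that, of "W q"] G unfolding G_eq by auto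
      obtain c1 c2 c3 c4 c5 where "DD_sym \<Gamma> 1 2 q = c1 *\<^sub>R V q + c2 *\<^sub>R D \<Gamma> 1 V q + c3 *\<^sub>R D \<Gamma> 2 V q
          + c4 *\<^sub>R DD_sym \<Gamma> 1 1 q + c5 *\<^sub>R DD_sym \<Gamma> 2 2 q"
        by (rule spn[of 1 2 1 1 2 2 1 2]) (use G in \<open>simp add: G_eq\<close>)
      with * show ?thesis by meson
    qed
    then show ?thesis
      unfolding XX_YY admissible.simps chosen_rows.simps conj_assoc[symmetric] indep G_eq
      by blast
  next
    case XX_XY
    have "DD_sym \<Gamma> 2 2 q \<in> span (set (chosen_rows \<Gamma> XX_XY q))" if G: "G XX_XY q \<noteq> 0"
    proof -
      obtain c1 c2 c3 c4 c5 where "DD_sym \<Gamma> 2 2 q = c1 *\<^sub>R V q + c2 *\<^sub>R D \<Gamma> 1 V q + c3 *\<^sub>R D \<Gamma> 2 V q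
          + c4 *\<^sub>R DD_sym \<Gamma> 1 1 q + c5 *\<^sub>R DD_sym \<Gamma> 1 2 q"
        by (rule spn[of 1 2 1 1 1 2 2 2]) (use G in \<open>simp add: G_eq\<close>)
      then show ?thesis unfolding chosen_rows.simps by (rule span5) simp
    qed
    then show ?thesis
      unfolding XX_XY admissible.simps chosen_rows.simps conj_assoc[symmetric] indep G_eq
      by blast
  next
    case XY_YY
    have "DD_sym \<Gamma> 1 1 q \<in> span (set (chosen_rows \<Gamma> XY_YY q))" if G: "G XY_YY q \<noteq> 0"
    proof -
      obtain c1 c2 c3 c4 c5 where "DD_sym \<Gamma> 1 1 q = c1 *\<^sub>R V q + c2 *\<^sub>R D \<Gamma> 1 V q + c3 *\<^sub>R D \<Gamma> 2 V q
          + c4 *\<^sub>R DD_sym \<Gamma> 1 2 q + c5 *\<^sub>R DD_sym \<Gamma> 2 2 q"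
        by (rule spn[of 1 2 1 2 2 2 1 1]) (use G in \<open>simp add: G_eq\<close>)
      then show ?thesis unfolding chosen_rows.simps by (rule span5) simp
    qed
    then show ?thesis
      unfolding XY_YY admissible.simps chosen_rows.simps conj_assoc[symmetric] indep G_eq
      by blast
  qed
qed

lemma continuous_G: "continuous_on N (G s)"
proof -
  have V: "smooth_on N V" and DV: "smooth_on N (D \<Gamma> a V)" for a
    by (auto intro: smooth_N smooth_V smooth_D)
  have DD: "smooth_on N (DD_sym \<Gamma> a b)" for a b
    unfolding DD_sym_def[abs_def] by (intro smooth open_N smooth_N smooth_D smooth_V)
  have "\<forall>i. smooth_on N (\<lambda>q. (vector (chosen_rows \<Gamma> s q @ [W q]) :: real^6^6) $ i)"
    unfolding forall_6 using V DV DD smooth_W by (cases s) simp_all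
  then have "smooth_on N (\<lambda>q. (vector (chosen_rows \<Gamma> s q @ [W q]) :: real^6^6) $ i $ j)" for i j
    by (intro smooth_on_nth[OF open_N, where i = j]) (rule spec)
  then have "smooth_on N (G s)"
    unfolding G_def[abs_def] by (rule smooth_on_det[OF open_N])
  then show ?thesis by (rule smooth_on_imp_continuous_on)
qed

text \<open>By \<open>admissible_iff\<close> the condition consists of inequations between
  continuous functions.\<close>

lemma admissible_open:
  assumes q: "q \<in> N" and "admissible \<Gamma> s q"
  shows "\<forall>\<^sub>F z in nhds q. admissible \<Gamma> s z"
proof -
  have cont: "(G s \<longlongrightarrow> G s q) (nhds q)" for s
    using continuous_G[of s] q open_N
    by (simp add: continuous_on_eq_continuous_at isCont_def tendsto_at_iff_tendsto_nhds)
  have "\<forall>\<^sub>F z in nhds q. G s z \<noteq> 0"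
    by (rule tendsto_imp_eventually_ne[OF cont]) (use assms(2)[unfolded admissible_iff[OF q]] in simp)
  moreover have "\<forall>\<^sub>F z in nhds q. s = XX_YY \<longrightarrow> G XY_YY z * G XX_XY z \<noteq> G XX_YY z * G XX_YY z"
  proof (cases "s = XX_YY")
    case True
    have "\<forall>\<^sub>F z in nhds q. G XY_YY z * G XX_XY z - G XX_YY z * G XX_YY z \<noteq> 0"
      by (rule tendsto_imp_eventually_ne[OF tendsto_diff[OF tendsto_mult[OF cont cont] tendsto_mult[OF cont cont]]])
        (use assms(2)[unfolded admissible_iff[OF q]] True in simp)
    then show ?thesis by eventually_elim simp
  qed simp
  moreover have "\<forall>\<^sub>F z in nhds q. z \<in> N" using open_N q by (rule eventually_nhds_in_open)
  ultimately show ?thesis by eventually_elim (simp add: admissible_iff)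
qed

text \<open>Each of the two determinants is a nonzero multiple of one obstruction. The relation
  among the second-order rows expresses the other two obstructions through these.\<close>

lemma E_iff:
  assumes q: "q \<in> N" and adm: "admissible \<Gamma> s q"
  shows "E1 \<Gamma> s q = 0 \<and> E2 \<Gamma> s q = 0 \<longleftrightarrow> unobstructed q"
proof -
  note ortho = orthogonal_W[OF q]
  have G: "G s q \<noteq> 0" using adm admissible_iff[OF q] by blast
  have last: "det (vector (chosen_rows \<Gamma> s q @ [DDD_sym \<Gamma> a b c q]) :: real^6^6) = 0 \<longleftrightarrow> obstruction a b c q = 0" for a b c
  proof -
    have "det (vector (chosen_rows \<Gamma> s q @ [DDD_sym \<Gamma> a b c q]) :: real^6^6) * (W q \<bullet> W q) = obstruction a b c q * G s q"
      unfolding G_def DDD_sym_inner[OF q, symmetric]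
      using det_hyperplane_last_row[OF W_nonzero[OF q] ortho(1,2,2,4,4)] by (cases s) auto
    then show ?thesis using G W_nonzero[OF q] by (metis inner_eq_zero_iff mult_eq_0_iff)
  qed
  \<comment> \<open>Instead of differentiating the relation, it is paired with
    \<open>cov a W\<close>, which annihilates the first-order rows; derivatives of the coefficients
    never appear.\<close>
  have rel: "obstruction a b c q = c4 * obstruction a b' c' q + c5 * obstruction a b'' c'' q"
    if "DD_sym \<Gamma> b c q = c1 *\<^sub>R V q + c2 *\<^sub>R D \<Gamma> 1 V q + c3 *\<^sub>R D \<Gamma> 2 V q
          + c4 *\<^sub>R DD_sym \<Gamma> b' c' q + c5 *\<^sub>R DD_sym \<Gamma> b'' c'' q" for a b c b' c' b'' c'' c1 c2 c3 c4 c5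
    unfolding obstruction_cov[OF q] that by (simp add: inner_add_left first_order_cov[OF q])
  note spn = hyperplane_span[OF W_nonzero[OF q] ortho(1,2,2,4,4) _ ortho(4)]
  have comm: "obstruction 2 1 1 q = obstruction 1 1 2 q" "obstruction 2 1 2 q = obstruction 1 2 2 q"
    using obstruction_commute(1)[OF q, of 1 1 2] obstruction_commute(2)[OF q, of 1 2 1] obstruction_commute(2)[OF q, of 1 2 2] by auto
  have "unobstructed q" if E: "E1 \<Gamma> s q = 0" "E2 \<Gamma> s q = 0"
  proof (cases s)
    case XX_YY
    then have o: "obstruction 1 1 1 q = 0" "obstruction 2 2 2 q = 0"
      using E last by auto
    obtain c1 c2 c3 c4 c5 where c: "DD_sym \<Gamma> 1 2 q = c1 *\<^sub>R V q + c2 *\<^sub>R D \<Gamma> 1 V q + c3 *\<^sub>R D \<Gamma> 2 V q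
          + c4 *\<^sub>R DD_sym \<Gamma> 1 1 q + c5 *\<^sub>R DD_sym \<Gamma> 2 2 q" "c4 * c5 \<noteq> 1"
      using adm XX_YY by auto
    have "obstruction 1 1 2 q = c5 * obstruction 1 2 2 q" "obstruction 1 2 2 q = c4 * obstruction 1 1 2 q"
      using rel[OF c(1), of 1] rel[OF c(1), of 2] o comm by auto
    \<comment> \<open>The two mixed obstructions solve a homogeneous linear system of determinant
      \<open>1 - c4 * c5\<close>.\<close>
    then have "(1 - c4 * c5) * obstruction 1 1 2 q = 0" "obstruction 1 2 2 q = c4 * obstruction 1 1 2 q"
      by (auto simp: algebra_simps)
    then show ?thesis using c(2) o by (auto simp: unobstructed_def)
  next
    case XX_XY
    then have o: "obstruction 1 1 1 q = 0" "obstruction 1 1 2 q = 0"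
      using E last by auto
    obtain c1 c2 c3 c4 c5 where "DD_sym \<Gamma> 2 2 q = c1 *\<^sub>R V q + c2 *\<^sub>R D \<Gamma> 1 V q + c3 *\<^sub>R D \<Gamma> 2 V q
          + c4 *\<^sub>R DD_sym \<Gamma> 1 1 q + c5 *\<^sub>R DD_sym \<Gamma> 1 2 q"
      by (rule spn[of 1 2 1 1 1 2 2 2]) (use G XX_XY in \<open>simp add: G_eq\<close>)
    from rel[OF this, of 1] rel[OF this, of 2] show ?thesis
      using o comm by (simp add: unobstructed_def)
  next
    case XY_YY
    then have o: "obstruction 1 2 2 q = 0" "obstruction 2 2 2 q = 0"
      using E last by auto
    obtain c1 c2 c3 c4 c5 where "DD_sym \<Gamma> 1 1 q = c1 *\<^sub>R V q + c2 *\<^sub>R D \<Gamma> 1 V q + c3 *\<^sub>R D \<Gamma> 2 V q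
          + c4 *\<^sub>R DD_sym \<Gamma> 1 2 q + c5 *\<^sub>R DD_sym \<Gamma> 2 2 q"
      by (rule spn[of 1 2 1 2 2 2 1 1]) (use G XY_YY in \<open>simp add: G_eq\<close>)
    from rel[OF this, of 1] rel[OF this, of 2] show ?thesis
      using o comm by (simp add: unobstructed_def)
  qed
  moreover have "E1 \<Gamma> s q = 0 \<and> E2 \<Gamma> s q = 0" if "unobstructed q"
    using that last unfolding unobstructed_def by (cases s) auto
  ultimately show ?thesis by blast
qed

end

section \<open>Columns of the adjugate as kernel vectors\<close>

definition cofactor_vec :: "'n \<Rightarrow> real^'n^'n \<Rightarrow> real^'n" where
  "cofactor_vec i A = (\<chi> j. det (\<chi> k. if k = i then axis j 1 else A $ k))"

text \<open>This is the expansion of the determinant along row \<open>i\<close>, obtained from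
  linearity in that row.\<close>

lemma inner_cofactor_vec: "v \<bullet> cofactor_vec i A = det (\<chi> k. if k = i then v else A $ k)"
proof -
  have "det (\<chi> k. if k = i then (\<Sum>j\<in>UNIV. v $ j *\<^sub>R axis j 1) else A $ k) = v \<bullet> cofactor_vec i A"
    by (simp add: linear_sum[OF linear_det_row] linear_cmul[OF linear_det_row] cofactor_vec_def inner_vec_def)
  moreover have "(\<Sum>j\<in>UNIV. v $ j *\<^sub>R axis j 1) = v"
    by (simp add: basis_expansion flip: scalar_mult_eq_scaleR)
  ultimately show ?thesis by (simp only:)
qed

text \<open>Pairing with row \<open>i\<close> gives \<open>det A\<close>; pairing with any other row
  gives a determinant with two equal rows.\<close>

lemma cofactor_vec_in_kernel:
  assumes "det A = 0"
  shows "A *v cofactor_vec i A = 0"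
  unfolding matrix_vector_zero_iff
proof
  fix k
  show "A $ k \<bullet> cofactor_vec i A = 0"
  proof (cases "k = i")
    case True
    have "(\<chi> k. if k = i then A $ i else A $ k) = A" by (simp add: vec_eq_iff)
    then show ?thesis using assms True by (simp add: inner_cofactor_vec)
  next
    case False
    then show ?thesis unfolding inner_cofactor_vec
      by (intro det_identical_rows[of i k]) (auto simp: row_def vec_eq_iff)
  qed
qed

text \<open>With row \<open>i\<close> replaced by the cofactor vector, the determinant is the
  squared norm of that vector. So a kernel vector orthogonal to it must vanish.\<close>

lemma kernel_eq_span_cofactor_vec:
  assumes det: "det A = 0" and nz: "cofactor_vec i A \<noteq> 0"
  shows "{v. A *v v = 0} = span {cofactor_vec i A}"
proof -
  let ?c = "cofactor_vec i A"
  have "v \<in> span {?c}" if v: "A *v v = 0" for v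
  proof -
    \<comment> \<open>Up to the factor \<open>?c \<bullet> ?c\<close>, this is the part of
      \<open>v\<close> orthogonal to \<open>?c\<close>; the scaling avoids division.\<close>
    define w where "w = (?c \<bullet> ?c) *\<^sub>R v - (?c \<bullet> v) *\<^sub>R ?c"
    have "A *v w = 0"
      using v cofactor_vec_in_kernel[OF det] by (simp add: w_def matrix_vector_mult_diff_distrib matrix_vector_mult_scaleR)
    moreover have "?c \<bullet> w = 0" by (simp add: w_def inner_diff_right)
    ultimately have "(\<chi> k. if k = i then ?c else A $ k) *v w = 0"
      by (simp add: matrix_vector_zero_iff)
    moreover have "det (\<chi> k. if k = i then ?c else A $ k) \<noteq> 0"
      using nz by (simp flip: inner_cofactor_vec)
    ultimately have "w = 0" using det_nonzero_iff_kernel by blast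
    then have "v = ((?c \<bullet> v) / (?c \<bullet> ?c)) *\<^sub>R ?c"
      using nz by (simp add: w_def field_simps) (metis (no_types, lifting) divide_inverse_commute inner_eq_zero_iff scaleR_scaleR left_inverse scaleR_one)
    then show ?thesis by (metis span_base span_scale singletonI)
  qed
  moreover have "A *v v = 0" if "v \<in> span {?c}" for v
    using that cofactor_vec_in_kernel[OF det] by (auto simp: span_singleton matrix_vector_mult_scaleR)
  ultimately show ?thesis by blast
qed

text \<open>A row with nonzero coefficient in a linear relation is redundant. Replacing it by
  \<open>W\<close> gives an invertible matrix, whose determinant is the pairing of \<open>W\<close>
  with the cofactor vector.\<close>

lemma cofactor_vec_nonzero:
  assumes ker: "{v. A *v v = 0} = span {W}" and W: "W \<noteq> 0"
  shows "\<exists>i. cofactor_vec i A \<noteq> 0"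
proof -
  have "A *v W = 0" using ker span_base[of W "{W}"] by blast
  then have "det A = 0" using W det_nonzero_iff_kernel by blast
  then obtain y where y: "(\<Sum>i\<in>UNIV. y $ i *\<^sub>R A $ i) = 0" "y \<noteq> 0"
    using det_nonzero_iff_rows by blast
  then obtain i where i: "y $ i \<noteq> 0" by (auto simp: vec_eq_iff)
  have "v = 0" if v: "(\<chi> k. if k = i then W else A $ k) *v v = 0" for v
  proof -
    have k: "A $ k \<bullet> v = 0" if "k \<noteq> i" for k
      using v that unfolding matrix_vector_zero_iff by (metis (mono_tags, lifting) vec_lambda_beta)
    have Wv: "W \<bullet> v = 0"
      using v unfolding matrix_vector_zero_iff by (metis (mono_tags, lifting) vec_lambda_beta)
    have "0 = (\<Sum>j\<in>UNIV. y $ j *\<^sub>R A $ j) \<bullet> v" using y by simp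
    also have "\<dots> = (\<Sum>j\<in>UNIV. y $ j * (A $ j \<bullet> v))" by (simp add: inner_sum_left)
    also have "\<dots> = (\<Sum>j\<in>UNIV. if j = i then y $ i * (A $ i \<bullet> v) else 0)"
      by (intro sum.cong) (auto simp: k)
    also have "\<dots> = y $ i * (A $ i \<bullet> v)" by simp
    finally have "A $ i \<bullet> v = 0" using i by simp
    then have "A *v v = 0" unfolding matrix_vector_zero_iff using k by metis
    then obtain c where "v = c *\<^sub>R W" using ker by (auto simp: span_singleton)
    with Wv W show "v = 0" by auto
  qed
  then have "W \<bullet> cofactor_vec i A \<noteq> 0"
    unfolding inner_cofactor_vec using det_nonzero_iff_kernel by blast
  then show ?thesis by (metis inner_zero_right)
qed

lemma distinct_independent_3:
  "distinct [r1, r2, r3] \<and> independent {r1, r2, r3} \<longleftrightarrow>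
    (\<forall>c1 c2 c3. c1 *\<^sub>R r1 + c2 *\<^sub>R r2 + c3 *\<^sub>R r3 = 0 \<longrightarrow> c1 = 0 \<and> c2 = 0 \<and> c3 = 0)" (is "?L \<longleftrightarrow> ?R") for r1 :: "'a::real_vector"
proof -
  have "?L \<longleftrightarrow> (\<forall>c::nat \<Rightarrow> real. c 0 *\<^sub>R r1 + c 1 *\<^sub>R r2 + c 2 *\<^sub>R r3 = 0
      \<longrightarrow> c 0 = 0 \<and> c 1 = 0 \<and> c 2 = 0)"
  proof -
    have "{..<3::nat} = {0, 1, 2}" by auto
    then have "(\<Sum>i<3. f i) = f 0 + f 1 + f 2" for f :: "nat \<Rightarrow> 'a" by (simp add: add.assoc)
    moreover have "(\<forall>i<3. P i) \<longleftrightarrow> P 0 \<and> P 1 \<and> P 2" for P :: "nat \<Rightarrow> bool"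
      by (simp add: numeral_eq_Suc All_less_Suc2)
    moreover have "length [r1, r2, r3] = 3" by simp
    moreover have "set [r1, r2, r3] = {r1, r2, r3}" by simp
    ultimately show ?thesis using distinct_independent_iff[of "[r1, r2, r3]"] by (simp only: nth_Cons_0 nth_Cons_numeral) simp
  qed
  also have "\<dots> \<longleftrightarrow> ?R"
  proof (intro iffI allI impI)
    fix c1 c2 c3 :: real
    assume *: "\<forall>c::nat \<Rightarrow> real. c 0 *\<^sub>R r1 + c 1 *\<^sub>R r2 + c 2 *\<^sub>R r3 = 0
      \<longrightarrow> c 0 = 0 \<and> c 1 = 0 \<and> c 2 = 0"
      and "c1 *\<^sub>R r1 + c2 *\<^sub>R r2 + c3 *\<^sub>R r3 = 0"
    then show "c1 = 0 \<and> c2 = 0 \<and> c3 = 0"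
      using *[rule_format, of "(!) [c1, c2, c3]"] by simp
  next
    fix c :: "nat \<Rightarrow> real"
    assume ?R and "c 0 *\<^sub>R r1 + c 1 *\<^sub>R r2 + c 2 *\<^sub>R r3 = 0"
    then show "c 0 = 0 \<and> c 1 = 0 \<and> c 2 = 0" by blast
  qed
  finally show ?thesis .
qed

section \<open>Points with independent first-order rows, and their density\<close>

context kernel_section
begin

definition regular :: "real^2 \<Rightarrow> bool" where
  "regular q \<longleftrightarrow> distinct [V q, D \<Gamma> 1 V q, D \<Gamma> 2 V q] \<and> independent {V q, D \<Gamma> 1 V q, D \<Gamma> 2 V q}"

text \<open>Since \<open>M_mat\<close> is singular, its rows satisfy a nontrivial relation, which by
  regularity involves a second-order row. That row can be left out of the choice.\<close>

lemma regular_imp_admissible: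
  assumes q: "q \<in> N" and "regular q"
  shows "\<exists>s. admissible \<Gamma> s q"
proof -
  let ?xx = "DD_sym \<Gamma> 1 1 q" and ?xy = "DD_sym \<Gamma> 1 2 q" and ?yy = "DD_sym \<Gamma> 2 2 q"
  have reg: "c1 = 0 \<and> c2 = 0 \<and> c3 = 0" if "c1 *\<^sub>R V q + c2 *\<^sub>R D \<Gamma> 1 V q + c3 *\<^sub>R D \<Gamma> 2 V q = 0" for c1 c2 c3
    using assms(2) that unfolding regular_def distinct_independent_3 by blast
  have "det (M_mat \<Gamma> q) = 0"
    using M_W[OF q] W_nonzero[OF q] det_nonzero_iff_kernel by blast
  then obtain y where y: "(\<Sum>i\<in>UNIV. y $ i *\<^sub>R M_mat \<Gamma> q $ i) = 0" "y \<noteq> 0"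
    using det_nonzero_iff_rows by blast
  have rel: "y $ 1 *\<^sub>R V q + y $ 2 *\<^sub>R D \<Gamma> 1 V q + y $ 3 *\<^sub>R D \<Gamma> 2 V q + y $ 4 *\<^sub>R ?xx + y $ 5 *\<^sub>R ?xy + y $ 6 *\<^sub>R ?yy = 0"
    using y(1) by (simp add: sum_6 M_mat_def)
  have y456: "y $ 4 \<noteq> 0 \<or> y $ 5 \<noteq> 0 \<or> y $ 6 \<noteq> 0"
  proof (rule ccontr)
    assume "\<not> ?thesis"
    then have "y = 0" using rel reg[of "y $ 1" "y $ 2" "y $ 3"] by (simp add: vec_eq_iff[of y] forall_6)
    with y show False by simp
  qed
  have dep: "y $ 4 * (?xx \<bullet> v) + y $ 5 * (?xy \<bullet> v) + y $ 6 * (?yy \<bullet> v) = 0"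
    if "V q \<bullet> v = 0" "D \<Gamma> 1 V q \<bullet> v = 0" "D \<Gamma> 2 V q \<bullet> v = 0" for v
    using arg_cong[OF rel, of "\<lambda>x. x \<bullet> v"] that by (simp add: inner_add_left)
  have zero: "v = 0" if "V q \<bullet> v = 0" "D \<Gamma> 1 V q \<bullet> v = 0" "D \<Gamma> 2 V q \<bullet> v = 0"
      "?xx \<bullet> v = 0" "?xy \<bullet> v = 0" "?yy \<bullet> v = 0" "W q \<bullet> v = 0" for v
  proof -
    have "M_mat \<Gamma> q *v v = 0"
      using that by (simp add: matrix_vector_zero_iff forall_6 M_mat_def)
    then obtain k where k: "v = k *\<^sub>R W q" using kernel[OF q] by (auto simp: span_singleton)
    with that(7) show ?thesis using W_nonzero[OF q] by simp
  qed
  \<comment> \<open>A row with nonzero coefficient vanishes on a vector as soon as the other five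
    do, so these five and \<open>W q\<close> still have trivial common kernel.\<close>
  have Gy: "y $ 4 \<noteq> 0 \<Longrightarrow> G XY_YY q \<noteq> 0" "y $ 5 \<noteq> 0 \<Longrightarrow> G XX_YY q \<noteq> 0" "y $ 6 \<noteq> 0 \<Longrightarrow> G XX_XY q \<noteq> 0"
    unfolding G_def chosen_rows.simps append.simps det_nonzero_iff_kernel matrix_vector_zero_iff forall_6 vector_6
    using dep zero by (metis add_0 add_cancel_right_right mult_eq_0_iff mult_zero_right)+
  show ?thesis
  \<comment> \<open>If both of these determinants vanish, the extra condition on
    \<open>XX_YY\<close> only says that the square of \<open>G XX_YY q\<close> is nonzero; otherwise
    one of the other choices works.\<close>
  proof (cases "G XY_YY q = 0 \<and> G XX_XY q = 0")
    case True
    then have "G XX_YY q \<noteq> 0" using y456 Gy by blast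
    with True have "admissible \<Gamma> XX_YY q" unfolding admissible_iff[OF q] by simp
    then show ?thesis ..
  next
    case False
    then have "admissible \<Gamma> XY_YY q \<or> admissible \<Gamma> XX_XY q" unfolding admissible_iff[OF q] by auto
    then show ?thesis by blast
  qed
qed

text \<open>A first-order relation could be differentiated, so it would leave at most three
  independent rows in \<^const>\<open>M_mat\<close>.\<close>

lemma no_first_order_relation:
  assumes Q: "open Q" "Q \<subseteq> N" and sm: "smooth_on Q \<alpha>" "smooth_on Q \<beta>" and ab: "a \<noteq> b"
    and rel: "\<And>q. q \<in> Q \<Longrightarrow> D \<Gamma> b V q = \<alpha> q *\<^sub>R V q + \<beta> q *\<^sub>R D \<Gamma> a V q"
  shows "Q = {}"
proof (rule ccontr)
  assume "Q \<noteq> {}"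
  then obtain q where q: "q \<in> Q" by blast
  have qN: "q \<in> N" using q Q by blast
  note qU = in_U[OF qN]
  let ?S = "{V q, D \<Gamma> a V q, D \<Gamma> a (D \<Gamma> a V) q}"
  have smO: "smooth_on Q V" "smooth_on Q (D \<Gamma> a V)"
    using Q N_subset by (meson smooth_on_subset smooth_V smooth_D)+
  have S: "V q \<in> span ?S" "D \<Gamma> a V q \<in> span ?S" "D \<Gamma> a (D \<Gamma> a V) q \<in> span ?S"
    by (auto intro: span_base)
  have lin: "x *\<^sub>R u + y *\<^sub>R v \<in> span ?S" if "u \<in> span ?S" "v \<in> span ?S" for x y u v
    using that by (intro span_add span_scale)
  have Db: "D \<Gamma> b V q \<in> span ?S"
    unfolding rel[OF q] by (rule lin) (use S in auto)
  have deriv: "D \<Gamma> c (D \<Gamma> b V) q = partial c \<alpha> q *\<^sub>R V q + \<alpha> q *\<^sub>R D \<Gamma> c V q + (partial c \<beta> q *\<^sub>R D \<Gamma> a V q + \<beta> q *\<^sub>R D \<Gamma> c (D \<Gamma> a V) q)" for c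
  proof -
    have "D \<Gamma> c (D \<Gamma> b V) q = D \<Gamma> c (\<lambda>z. \<alpha> z *\<^sub>R V z + \<beta> z *\<^sub>R D \<Gamma> a V z) q"
      by (rule D_cong[OF rel Q(1) q])
    then show ?thesis
      unfolding D_def[of \<Gamma> c]
      by (simp add: partial_add[OF Q(1) q] partial_scaleR[OF Q(1) q] sm smO smooth_on_scaleR[OF Q(1)]
          algebra_simps scaleR_vector_matrix_assoc)
  qed
  \<comment> \<open>The relation is differentiated along \<open>a\<close>, the two derivatives are
    exchanged, and then it is differentiated along \<open>b\<close>; this captures every
    second-order row.\<close>
  have Dab: "D \<Gamma> a (D \<Gamma> b V) q \<in> span ?S"
    unfolding deriv by (intro span_add lin span_scale S)
  then have Dba: "D \<Gamma> b (D \<Gamma> a V) q \<in> span ?S" by (simp add: DV_commute'[OF qU, of b a])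
  have Dbb: "D \<Gamma> b (D \<Gamma> b V) q \<in> span ?S"
    unfolding deriv by (intro span_add lin span_scale S Db Dba)
  have all: "D \<Gamma> c V q \<in> span ?S" "D \<Gamma> c (D \<Gamma> d V) q \<in> span ?S" for c d
  proof -
    have "c = a \<or> c = b" "d = a \<or> d = b" using ab exhaust_2[of a] exhaust_2[of b] exhaust_2[of c] exhaust_2[of d] by auto
    then show "D \<Gamma> c V q \<in> span ?S" "D \<Gamma> c (D \<Gamma> d V) q \<in> span ?S" using S Db Dab Dba Dbb by auto
  qed
  have "\<forall>i. M_mat \<Gamma> q $ i \<in> span ?S"
    unfolding forall_6 M_mat_def vector_6 DD_sym_eq[OF qU] using all S(1) by blast
  then have "rows (M_mat \<Gamma> q) \<subseteq> span ?S"
    by (auto simp: rows_def row_def)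
  then have "rank (M_mat \<Gamma> q) \<le> card ?S"
    unfolding row_rank_def by (intro dim_le_card) auto
  also have "\<dots> \<le> 3" by (simp add: card_insert_if)
  finally show False using rank_ge_5_of_kernel[of "M_mat \<Gamma> q" "W q"] kernel[OF qN] by auto
qed

text \<open>If no point of \<open>Q\<close> were regular, the rows would degenerate in three stages:
  \<open>V\<close> and \<open>?V1\<close> are dependent, then \<open>V\<close> vanishes, then so
  does its derivative. At each stage \<open>no_first_order_relation\<close> empties the open set
  where the previous degeneration fails.\<close>

lemma regular_dense:
  assumes Q: "open Q" "Q \<subseteq> N" "Q \<noteq> {}"
  shows "\<exists>q\<in>Q. regular q"
proof (rule ccontr)
  assume "\<not> ?thesis"
  then have irr: "\<not> regular q" if "q \<in> Q" for q using that by blast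
  let ?V1 = "D \<Gamma> 1 V" and ?V2 = "D \<Gamma> 2 V"
  \<comment> \<open>The Gram determinant of \<open>V\<close> and \<open>?V1\<close>, zero exactly
    where they are dependent.\<close>
  define \<gamma> where "\<gamma> q = (V q \<bullet> V q) * (?V1 q \<bullet> ?V1 q) - (V q \<bullet> ?V1 q) * (V q \<bullet> ?V1 q)" for q
  have smU: "smooth_on U V" "smooth_on U (D \<Gamma> a V)" for a by (auto intro: smooth_V smooth_D)
  have OU: "Q \<subseteq> U" using Q N_subset by blast
  have smO: "smooth_on Q' V" "smooth_on Q' (D \<Gamma> a V)" if "Q' \<subseteq> Q" for a Q'
    using that OU smU by (meson smooth_on_subset order_trans)+
  have open_nz: "open {q\<in>Q. f q \<noteq> 0}" if "continuous_on Q f" for f :: "real^2 \<Rightarrow> 'a::real_normed_vector"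
  proof -
    have "{q\<in>Q. f q \<noteq> 0} = Q \<inter> f -` (- {0})" by auto
    then show ?thesis using continuous_open_preimage[OF that Q(1), of "- {0}"] by auto
  qed
  have "smooth_on Q \<gamma>" unfolding \<gamma>_def[abs_def] by (intro smooth Q(1) smO order_refl)
  then have open\<gamma>: "open {q\<in>Q. \<gamma> q \<noteq> 0}" by (intro open_nz smooth_on_imp_continuous_on)
  have "{q\<in>Q. \<gamma> q \<noteq> 0} = {}" (is "?Q = _")
  proof (rule no_first_order_relation[OF open\<gamma>, where a = 1 and b = 2])
    have sub: "?Q \<subseteq> Q" by auto
    show "?Q \<subseteq> N" using Q by auto
    have gi: "smooth_on ?Q (\<lambda>q. inverse (\<gamma> q))"
      by (rule smooth_on_inverse[OF open\<gamma> smooth_on_subset[OF \<open>smooth_on Q \<gamma>\<close> sub]]) auto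
    \<comment> \<open>The coefficients of \<open>?V2\<close> in terms of \<open>V\<close> and
      \<open>?V1\<close> come from Cramer's rule for the Gram system, which exhibits them as
      smooth.\<close>
    show "smooth_on ?Q (\<lambda>q. ((?V2 q \<bullet> V q) * (?V1 q \<bullet> ?V1 q) - (?V2 q \<bullet> ?V1 q) * (V q \<bullet> ?V1 q)) * inverse (\<gamma> q))"
      by (intro smooth open\<gamma> gi smO sub)
    show "smooth_on ?Q (\<lambda>q. ((V q \<bullet> V q) * (?V2 q \<bullet> ?V1 q) - (?V2 q \<bullet> V q) * (V q \<bullet> ?V1 q)) * inverse (\<gamma> q))"
      by (intro smooth open\<gamma> gi smO sub)
    fix q assume q: "q \<in> ?Q"
    obtain c1 c2 c3 where c: "c1 *\<^sub>R V q + c2 *\<^sub>R ?V1 q + c3 *\<^sub>R ?V2 q = 0" "\<not> (c1 = 0 \<and> c2 = 0 \<and> c3 = 0)"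
      using irr[of q] q unfolding regular_def distinct_independent_3 by blast
    have g: "\<gamma> q \<noteq> 0" using q by simp
    have e: "c1 * (V q \<bullet> V q) + c2 * (V q \<bullet> ?V1 q) + c3 * (?V2 q \<bullet> V q) = 0"
      "c1 * (V q \<bullet> ?V1 q) + c2 * (?V1 q \<bullet> ?V1 q) + c3 * (?V2 q \<bullet> ?V1 q) = 0"
      using arg_cong[OF c(1), of "\<lambda>x. x \<bullet> V q"] arg_cong[OF c(1), of "\<lambda>x. x \<bullet> ?V1 q"]
      by (simp_all add: inner_add_left inner_commute[of "?V1 q" "V q"])
    have e1: "c1 * \<gamma> q = - c3 * ((?V2 q \<bullet> V q) * (?V1 q \<bullet> ?V1 q) - (?V2 q \<bullet> ?V1 q) * (V q \<bullet> ?V1 q))"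
      and e2: "c2 * \<gamma> q = - c3 * ((V q \<bullet> V q) * (?V2 q \<bullet> ?V1 q) - (?V2 q \<bullet> V q) * (V q \<bullet> ?V1 q))"
      using e unfolding \<gamma>_def by algebra+
    have c3: "c3 \<noteq> 0" using c(2) e1 e2 g by auto
    define a b where "a = ((?V2 q \<bullet> V q) * (?V1 q \<bullet> ?V1 q) - (?V2 q \<bullet> ?V1 q) * (V q \<bullet> ?V1 q)) * inverse (\<gamma> q)"
      and "b = ((V q \<bullet> V q) * (?V2 q \<bullet> ?V1 q) - (?V2 q \<bullet> V q) * (V q \<bullet> ?V1 q)) * inverse (\<gamma> q)"
    have "c1 = - (c3 * a)" "c2 = - (c3 * b)"
      using e1 e2 g by (auto simp: a_def b_def field_simps)
    then have "c3 *\<^sub>R (?V2 q - (a *\<^sub>R V q + b *\<^sub>R ?V1 q)) = 0"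
      using c(1) by (simp add: algebra_simps)
    then show "?V2 q = a *\<^sub>R V q + b *\<^sub>R ?V1 q" using c3 by simp
  qed simp
  then have \<gamma>0: "\<gamma> q = 0" if "q \<in> Q" for q using that by blast
  have contV: "continuous_on Q V" by (intro smooth_on_imp_continuous_on smO order_refl)
  have "{q\<in>Q. V q \<noteq> 0} = {}" (is "?Q = _")
  proof (rule no_first_order_relation[OF open_nz[OF contV], where a = 2 and b = 1])
    have sub: "?Q \<subseteq> Q" by auto
    show "?Q \<subseteq> N" using Q by auto
    show "smooth_on ?Q (\<lambda>q. (?V1 q \<bullet> V q) * inverse (V q \<bullet> V q))"
      by (intro smooth open_nz[OF contV] smO sub) auto
    show "smooth_on ?Q (\<lambda>q. 0 :: real)" by (rule smooth_on_const)
    fix q assume q: "q \<in> ?Q"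
    let ?v = "V q" and ?w = "?V1 q"
    \<comment> \<open>The squared norm of the scaled orthogonal part of \<open>?w\<close> is a
      multiple of the Gram determinant, which is already known to vanish.\<close>
    have "((?v \<bullet> ?v) *\<^sub>R ?w - (?v \<bullet> ?w) *\<^sub>R ?v) \<bullet> ((?v \<bullet> ?v) *\<^sub>R ?w - (?v \<bullet> ?w) *\<^sub>R ?v) = (?v \<bullet> ?v) * \<gamma> q"
      by (simp add: \<gamma>_def inner_diff_left inner_diff_right inner_commute[of ?w ?v] algebra_simps)
    then have "(?v \<bullet> ?v) *\<^sub>R ?w = (?v \<bullet> ?w) *\<^sub>R ?v" using \<gamma>0 q by simp
    then have "inverse (?v \<bullet> ?v) *\<^sub>R (?v \<bullet> ?v) *\<^sub>R ?w = inverse (?v \<bullet> ?v) *\<^sub>R (?v \<bullet> ?w) *\<^sub>R ?v" by simp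
    then show "?w = ((?w \<bullet> ?v) * inverse (?v \<bullet> ?v)) *\<^sub>R ?v + 0 *\<^sub>R ?V2 q"
      using q by (simp add: inner_commute mult.commute)
  qed simp
  then have V0: "V q = 0" if "q \<in> Q" for q using that by blast
  have "Q = {}"
  proof (rule no_first_order_relation[OF Q(1,2), where a = 2 and b = 1])
    fix q assume q: "q \<in> Q"
    have "?V1 q = D \<Gamma> 1 (\<lambda>z. 0) q" by (rule D_cong[OF V0 Q(1) q])
    also have "\<dots> = 0" by (simp add: D_def partial_const)
    finally show "?V1 q = 0 *\<^sub>R V q + 0 *\<^sub>R ?V2 q" by simp
  qed (simp_all add: smooth_on_const)
  with Q(3) show False by blast
qed

lemma continuous_obstruction: "continuous_on N (obstruction a b c)"
  unfolding obstruction_def[abs_def]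
  by (intro smooth_on_imp_continuous_on smooth open_N smooth_N smooth_D smooth_V smooth_W)

text \<open>A nonzero obstruction stays nonzero on an open set, which contains a regular point.
  There some choice is admissible, and \<open>E_iff\<close> gives a contradiction.\<close>

lemma unobstructed_if_E_vanish:
  assumes Q: "open Q" "Q \<subseteq> N"
    and E: "\<And>q s. q \<in> Q \<Longrightarrow> admissible \<Gamma> s q \<Longrightarrow> E1 \<Gamma> s q = 0 \<and> E2 \<Gamma> s q = 0"
    and q: "q \<in> Q"
  shows "unobstructed q"
proof -
  have qN: "q \<in> N" using q Q by blast
  have "obstruction a b c q = 0" for a b c
  proof (rule ccontr)
    assume nz: "obstruction a b c q \<noteq> 0"
    let ?Q = "Q \<inter> obstruction a b c -` (- {0})"
    have "open ?Q"
      using continuous_on_subset[OF continuous_obstruction Q(2)] Q(1) by (rule continuous_open_preimage) auto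
    moreover have "?Q \<subseteq> N" "?Q \<noteq> {}" using Q q nz by auto
    ultimately obtain z where z: "z \<in> ?Q" "regular z" using regular_dense by blast
    have zN: "z \<in> N" using z Q by blast
    obtain s where s: "admissible \<Gamma> s z" using regular_imp_admissible[OF zN z(2)] by blast
    have "unobstructed z" using E_iff[OF zN s] E[OF _ s] z by blast
    then show False using z unobstructed_iff[OF zN] by auto
  qed
  then show ?thesis using unobstructed_iff[OF qN] by blast
qed

end

section \<open>The local kernel section and the conclusion\<close>

lemma (in smooth_connection) smooth_M_mat: "smooth_on U (\<lambda>q. M_mat \<Gamma> q $ i $ j)"
proof -
  have "\<forall>i. smooth_on U (\<lambda>q. M_mat \<Gamma> q $ i)"
    unfolding forall_6 M_mat_def vector_6 DD_sym_def
    by (intro conjI smooth open_U smooth_D smooth_V)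
  then have "smooth_on U (\<lambda>q. M_mat \<Gamma> q $ i)" by blast
  then show ?thesis by (rule smooth_on_nth[OF open_U])
qed

lemma (in smooth_connection) smooth_cofactor_vec: "smooth_on U (\<lambda>q. cofactor_vec i (M_mat \<Gamma> q))"
proof (rule smooth_on_componentwise[OF open_U])
  fix j
  have "smooth_on U (\<lambda>q. (\<chi> k. if k = i then axis j 1 else M_mat \<Gamma> q $ k) $ k $ l)" for k l
    by (cases "k = i") (simp_all add: smooth_on_const smooth_M_mat)
  then have "smooth_on U (\<lambda>q. det (\<chi> k. if k = i then axis j 1 else M_mat \<Gamma> q $ k))"
    by (rule smooth_on_det[OF open_U])
  then show "smooth_on U (\<lambda>q. cofactor_vec i (M_mat \<Gamma> q) $ j)" by (simp add: cofactor_vec_def)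
qed

text \<open>A column of the adjugate that is nonzero at \<open>p\<close> extends the given kernel
  vector, up to scale, to a smooth section. All smaller radii are included because the ball will be
  shrunk with the same section.\<close>

lemma (in smooth_connection) local_kernel_section:
  assumes rank: "\<forall>q\<in>U. rank (M_mat \<Gamma> q) < 6" and p: "p \<in> U"
    and ker: "{v. M_mat \<Gamma> p *v v = 0} = span {W0}"
    and nondeg: "W0 $ 1 * W0 $ 3 - (W0 $ 2)\<^sup>2 \<noteq> 0"
  obtains W r where "0 < r" "\<And>r'. r' \<le> r \<Longrightarrow> kernel_section U \<Gamma> (ball p r') W"
    "\<And>q. q \<in> ball p r \<Longrightarrow> W q $ 1 * W q $ 3 - (W q $ 2)\<^sup>2 \<noteq> 0"
proof -
  have det0: "det (M_mat \<Gamma> q) = 0" if "q \<in> U" for q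
    using rank that by (simp add: det_eq_0_rank)
  have "W0 \<noteq> 0" using nondeg by auto
  then obtain i where i: "cofactor_vec i (M_mat \<Gamma> p) \<noteq> 0"
    using cofactor_vec_nonzero[OF ker] by blast
  define W where "W q = cofactor_vec i (M_mat \<Gamma> q)" for q
  define f where "f q = W q $ 1 * W q $ 3 - (W q $ 2)\<^sup>2" for q
  have smW: "smooth_on U W" unfolding W_def[abs_def] by (rule smooth_cofactor_vec)
  have smf: "smooth_on U f" unfolding f_def[abs_def] by (intro smooth open_U smW)
  have "W p \<in> span {W0}"
    using cofactor_vec_in_kernel[OF det0[OF p], of i] ker by (auto simp: W_def)
  then obtain k where k: "W p = k *\<^sub>R W0" by (auto simp: span_singleton)
  have "k \<noteq> 0" using i k by (auto simp: W_def)
  moreover have "f p = k\<^sup>2 * (W0 $ 1 * W0 $ 3 - (W0 $ 2)\<^sup>2)"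
    by (simp add: f_def k power2_eq_square algebra_simps)
  ultimately have fp: "f p \<noteq> 0" using nondeg by simp
  have "open (U \<inter> f -` (- {0}))"
    by (rule continuous_open_preimage[OF smooth_on_imp_continuous_on[OF smf] open_U]) auto
  moreover have "p \<in> U \<inter> f -` (- {0})" using p fp by simp
  ultimately obtain r where r: "r > 0" "ball p r \<subseteq> U \<inter> f -` (- {0})"
    using openE by blast
  have nd: "W q $ 1 * W q $ 3 - (W q $ 2)\<^sup>2 \<noteq> 0" if "q \<in> ball p r" for q
    using r that by (auto simp: f_def)
  have "kernel_section U \<Gamma> (ball p r') W" if r': "r' \<le> r" for r'
  proof
    have sub: "ball p r' \<subseteq> ball p r" using r' by (rule subset_ball)
    show "ball p r' \<subseteq> U" using sub r by blast
    then show "smooth_on (ball p r') W" using smW by (rule smooth_on_subset[rotated])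
    fix q assume q: "q \<in> ball p r'"
    then have "W q $ 1 * W q $ 3 - (W q $ 2)\<^sup>2 \<noteq> 0" using nd sub by blast
    then show nz: "W q \<noteq> 0" by auto
    show "{v. M_mat \<Gamma> q *v v = 0} = span {W q}"
      using kernel_eq_span_cofactor_vec[OF det0, of q i] nz q \<open>ball p r' \<subseteq> U\<close> unfolding W_def by blast
  qed auto
  then show ?thesis by (rule that[OF r(1) _ nd])
qed

text \<open>The rank condition is stated on a neighbourhood of \<open>p\<close>, where the parallel
  section is integrated. The equivalence appears for a fixed choice admissible at \<open>p\<close>,
  and also for all choices admissible at nearby points, since no choice is assumed to be admissible
  at \<open>p\<close> itself.\<close>

theorem theorem1p3:
  fixes U :: "(real^2) set" and \<Gamma> :: connection and p :: "real^2" and W :: "real^6"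
  assumes "open U"
    and "torsion_free_connection_on U \<Gamma>"
    and "real_analytic_on U (A0 \<Gamma>)" "real_analytic_on U (A1 \<Gamma>)"
        "real_analytic_on U (A2 \<Gamma>)" "real_analytic_on U (A3 \<Gamma>)"
    and "\<forall>q\<in>U. rank (M_mat \<Gamma> q) < 6"
    and "p \<in> U"
    and "rank (M_mat \<Gamma> p) = 5"
    and "{v. M_mat \<Gamma> p *v v = 0} = span {W}"
    and "W$1 * W$3 - (W$2)^2 \<noteq> 0"
  shows "((\<forall>\<^sub>F q in nhds p. rank (M_mat10 \<Gamma> q) = 5) \<longrightarrow> metrisable_near U \<Gamma> p) \<and>
    (\<forall>s. admissible \<Gamma> s p \<longrightarrow>
       ((\<forall>\<^sub>F q in nhds p. rank (M_mat10 \<Gamma> q) = 5) \<longleftrightarrow>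
        (\<forall>\<^sub>F q in nhds p. E1 \<Gamma> s q = 0 \<and> E2 \<Gamma> s q = 0))) \<and>
    ((\<forall>\<^sub>F q in nhds p. rank (M_mat10 \<Gamma> q) = 5) \<longleftrightarrow>
     (\<forall>\<^sub>F q in nhds p. \<forall>s. admissible \<Gamma> s q \<longrightarrow> E1 \<Gamma> s q = 0 \<and> E2 \<Gamma> s q = 0)) \<and>
    (distinct [V_row \<Gamma> p, D \<Gamma> 1 (V_row \<Gamma>) p, D \<Gamma> 2 (V_row \<Gamma>) p] \<and>
     independent {V_row \<Gamma> p, D \<Gamma> 1 (V_row \<Gamma>) p, D \<Gamma> 2 (V_row \<Gamma>) p} \<longrightarrow>
     (\<exists>s. admissible \<Gamma> s p))"
proof -
  interpret smooth_connection U \<Gamma> by unfold_locales fact+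
  obtain K r where r: "0 < r" and K: "\<And>r'. r' \<le> r \<Longrightarrow> kernel_section U \<Gamma> (ball p r') K"
    and nondeg: "\<And>q. q \<in> ball p r \<Longrightarrow> K q $ 1 * K q $ 3 - (K q $ 2)\<^sup>2 \<noteq> 0"
    by (rule local_kernel_section[OF assms(7,8,10,11)], rule that)
  interpret N: kernel_section U \<Gamma> "ball p r" K using K by simp
  have pN: "p \<in> ball p r" using r by simp
  have evN: "\<forall>\<^sub>F q in nhds p. q \<in> ball p r"
    using pN by (intro eventually_nhds_in_open) auto
  have rank_iff: "(\<forall>\<^sub>F q in nhds p. rank (M_mat10 \<Gamma> q) = 5) \<longleftrightarrow> (\<forall>\<^sub>F q in nhds p. N.unobstructed q)"
    by (rule eventually_subst) (use evN in eventually_elim, simp add: N.rank_M10_iff)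
  have "metrisable_near U \<Gamma> p" if ev: "\<forall>\<^sub>F q in nhds p. N.unobstructed q"
  proof -
    obtain e where e: "e > 0" "\<And>q. dist q p < e \<Longrightarrow> N.unobstructed q"
      using ev unfolding eventually_nhds_metric by blast
    \<comment> \<open>The radius is reduced until every point of the ball is unobstructed; the
      section \<open>K\<close> stays the same, so the obstructions do too.\<close>
    define r' where "r' = min e r"
    have r': "0 < r'" "r' \<le> r" "r' \<le> e" using e r by (auto simp: r'_def)
    interpret B: kernel_section U \<Gamma> "ball p r'" K using K r' by simp
    have "\<exists>g. metric_on (ball p r') g \<and> levi_civita g \<in> projective_class (ball p r') \<Gamma>"
    proof (rule B.unobstructed_imp_metric[OF refl])
      fix q assume q: "q \<in> ball p r'"
      then show "K q $ 1 * K q $ 3 - (K q $ 2)\<^sup>2 \<noteq> 0" using nondeg r' by auto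
      show "B.unobstructed q" using e(2)[of q] q r' by (auto simp: dist_commute)
    qed
    then show ?thesis
      unfolding metrisable_near_def using r'(1) B.N_subset by (metis centre_in_ball open_ball)
  qed
  \<comment> \<open>A choice admissible at \<open>p\<close> remains admissible nearby, so
    \<open>E_iff\<close> applies at all nearby points.\<close>
  moreover have "(\<forall>\<^sub>F q in nhds p. N.unobstructed q) \<longleftrightarrow> (\<forall>\<^sub>F q in nhds p. E1 \<Gamma> s q = 0 \<and> E2 \<Gamma> s q = 0)"
    if "admissible \<Gamma> s p" for s
    by (rule eventually_subst)
      (use evN N.admissible_open[OF pN that] in eventually_elim, simp only: N.E_iff)
  moreover have "(\<forall>\<^sub>F q in nhds p. N.unobstructed q) \<longleftrightarrow>
     (\<forall>\<^sub>F q in nhds p. \<forall>s. admissible \<Gamma> s q \<longrightarrow> E1 \<Gamma> s q = 0 \<and> E2 \<Gamma> s q = 0)" (is "_ \<longleftrightarrow> eventually ?E _")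
  proof
    assume "\<forall>\<^sub>F q in nhds p. N.unobstructed q"
    with evN show "eventually ?E (nhds p)"
      by eventually_elim (use N.E_iff in blast)
  next
    assume "eventually ?E (nhds p)"
    then obtain S where S: "open S" "p \<in> S" "\<And>q. q \<in> S \<Longrightarrow> ?E q"
      unfolding eventually_nhds by blast
    \<comment> \<open>\<open>E_iff\<close> reaches only the points with an admissible choice;
      density of regular points and continuity cover the others.\<close>
    have "N.unobstructed q" if "q \<in> S \<inter> ball p r" for q
      by (rule N.unobstructed_if_E_vanish[of "S \<inter> ball p r"]) (use S that in auto)
    then show "\<forall>\<^sub>F q in nhds p. N.unobstructed q"
      unfolding eventually_nhds using S pN by (intro exI[of _ "S \<inter> ball p r"]) auto
  qed
  moreover have "\<exists>s. admissible \<Gamma> s p" if "N.regular p"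
    using N.regular_imp_admissible[OF pN that] .
  ultimately show ?thesis
    unfolding rank_iff N.regular_def by blast
qed

end
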